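(* Let $W_n=\frac1{\sqrt n}X_n+A_n$, where $A_n$ is a real symmetric $n\times n$ matrix with eigenvalues $\theta,0,\dots,0$ and $v_1^{(n)}$ is a unit eigenvector of $A_n$ for $\theta$, as described in the context. Let $x\in(-2,2)$ and let $(\varepsilon_n)_{n\ge1}$ be a sequence of positive reals satisfying $n^\delta/\sqrt n\ll\varepsilon_n\ll1$ for some $\delta>0$. Put $\mathcal I^{(n)}_{\varepsilon_n}(x)=\{1\le i\le n:\ |\lambda_i^{(n)}-x|\le\varepsilon_n\}$. Then for every $t>0$, $$\mathbf P\left(\left|\frac{n}{|\mathcal I^{(n)}_{\varepsilon_n}(x)|}\sum_{i\in\mathcal I^{(n)}_{\varepsilon_n}(x)}\left|\langle\phi_i^{(n)},v_1^{(n)}\rangle\right|^2-\frac{1}{\theta^2-\theta x+1}\right|>t\right)\underset{n\to+\infty}{\longrightarrow}0.$$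
   Context: For each $n\ge1$, $X_n$ is an $n\times n$ real symmetric random matrix whose entries $X^{(n)}_{ij}$, $1\le i\le j\le n$, are i.i.d. copies of a fixed real random variable $X$ (whose law does not depend on $n$) with $\mathbf E[X]=0$, $\mathbf E[X^2]=1$ and finite moments of all orders. $A_n$ is deterministic (or random and independent of $X_n$), real symmetric, with eigenvalues $\gamma_1^{(n)}=\theta$ and $\gamma_2^{(n)}=\dots=\gamma_n^{(n)}=0$, $\theta\in\mathbf R$ fixed, i.e. $A_n=\theta\,v_1^{(n)}(v_1^{(n)})^T$ with $v_1^{(n)}$ a unit vector (independent of $X_n$). $\lambda_1^{(n)}\ge\dots\ge\lambda_n^{(n)}$ are the eigenvalues of $W_n$ and $\phi_1^{(n)},\dots,\phi_n^{(n)}$ an associated orthonormal basis of eigenvectors. For positive sequences, $a_n\ll b_n$ means $a_n/b_n\to0$. *)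

theory Defs
  imports "HOL-Probability.Probability" "Jordan_Normal_Form.Char_Poly"
begin

unbundle no vec_syntax and no inner_syntax

text \<open>Vectors and matrices are those of \<open>Jordan_Normal_Form\<close>, so the size \<open>n\<close> may vary;
  rows, columns and eigenvalues are numbered from 0 to \<open>n - 1\<close>.\<close>

definition much_less :: "(nat \<Rightarrow> real) \<Rightarrow> (nat \<Rightarrow> real) \<Rightarrow> bool" (infix \<open>\<lless>\<close> 50) where
  "a \<lless> b \<longleftrightarrow> (\<lambda>n. a n / b n) \<longlonglongrightarrow> 0"

definition symmetric :: "'a mat \<Rightarrow> bool" where
  "symmetric B \<longleftrightarrow> transpose_mat B = B"

definition upper_indices :: "nat \<Rightarrow> (nat \<times> nat) set" where
  "upper_indices n = {(i, j). i \<le> j \<and> j < n}"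

text \<open>\<open>N\<close> and \<open>\<xi>\<close> carry the reference variable; \<open>M\<close> carries the \<open>n \<times> n\<close> random matrix \<open>Y\<close>.\<close>

definition iid_symmetric_matrix ::
  "'b measure \<Rightarrow> ('b \<Rightarrow> real) \<Rightarrow> 'a measure \<Rightarrow> nat \<Rightarrow> ('a \<Rightarrow> real mat) \<Rightarrow> bool" where
  "iid_symmetric_matrix N \<xi> M n Y \<longleftrightarrow>
     (\<forall>\<omega>\<in>space M. Y \<omega> \<in> carrier_mat n n \<and> symmetric (Y \<omega>)) \<and>
     prob_space.indep_vars M (\<lambda>_. borel) (\<lambda>ij \<omega>. Y \<omega> $$ ij) (upper_indices n) \<and>
     (\<forall>ij\<in>upper_indices n. distr M borel (\<lambda>\<omega>. Y \<omega> $$ ij) = distr N borel \<xi>)"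

text \<open>Joint independence of all coordinates of \<open>u\<close> from all entries of \<open>Y\<close>. By symmetry of \<open>Y\<close>
  the entries on and above the diagonal suffice. A deterministic \<open>u\<close> satisfies this.
  The constant \<open>indep_var\<close> requires both variables to take values in one type, so \<open>independent\<close>
  spells out its characterisation \<open>indep_var_eq\<close> for different types.\<close>

definition independent ::
  "'a measure \<Rightarrow> 'c measure \<Rightarrow> ('a \<Rightarrow> 'c) \<Rightarrow> 'd measure \<Rightarrow> ('a \<Rightarrow> 'd) \<Rightarrow> bool" where
  "independent M S U T V \<longleftrightarrow>
     U \<in> measurable M S \<and> V \<in> measurable M T \<and>
     prob_space.indep_set M {U -` B \<inter> space M |B. B \<in> sets S} {V -` B \<inter> space M |B. B \<in> sets T}"

definition vec_indep_of_matrix ::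
  "'a measure \<Rightarrow> nat \<Rightarrow> ('a \<Rightarrow> real vec) \<Rightarrow> ('a \<Rightarrow> real mat) \<Rightarrow> bool" where
  "vec_indep_of_matrix M n u Y \<longleftrightarrow>
     independent M
       (\<Pi>\<^sub>M i\<in>{..<n}. borel) (\<lambda>\<omega>. \<lambda>i\<in>{..<n}. u \<omega> $ i)
       (\<Pi>\<^sub>M ij\<in>upper_indices n. borel) (\<lambda>\<omega>. \<lambda>ij\<in>upper_indices n. Y \<omega> $$ ij)"

text \<open>The characteristic polynomial expresses that the eigenvalues, counted with multiplicity, are
  \<open>\<theta>, 0, \<dots>, 0\<close>. Hence \<open>B = \<theta> u u\<^sup>T\<close>, so independence of \<open>u\<close> from another matrix
  entails that of \<open>B\<close>.\<close>

definition rank_one_spike :: "nat \<Rightarrow> real \<Rightarrow> real mat \<Rightarrow> real vec \<Rightarrow> bool" where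
  "rank_one_spike n \<theta> B u \<longleftrightarrow>
     B \<in> carrier_mat n n \<and> symmetric B \<and>
     char_poly B = [:- \<theta>, 1:] * [:0, 1:] ^ (n - 1) \<and>
     eigenvector B u \<theta> \<and> u \<bullet> u = 1"

definition ordered_orthonormal_eigenbasis ::
  "nat \<Rightarrow> real mat \<Rightarrow> (nat \<Rightarrow> real) \<Rightarrow> (nat \<Rightarrow> real vec) \<Rightarrow> bool" where
  "ordered_orthonormal_eigenbasis n B l f \<longleftrightarrow>
     (\<forall>i<n. eigenvector B (f i) (l i)) \<and>
     (\<forall>i<n. \<forall>j<n. f i \<bullet> f j = (if i = j then 1 else 0)) \<and>
     (\<forall>i j. i \<le> j \<and> j < n \<longrightarrow> l j \<le> l i)"

definition spectral_window :: "nat \<Rightarrow> (nat \<Rightarrow> real) \<Rightarrow> real \<Rightarrow> real \<Rightarrow> nat set" where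
  "spectral_window n l x e = {i. i < n \<and> \<bar>l i - x\<bar> \<le> e}"

text \<open>For an empty window the value is 0, by division by zero. The value depends on the eigenbasis
  only through the spectral projection onto \<open>[x - e, x + e]\<close>, so it is a Borel function of the
  matrix and \<open>u\<close> even if the eigenvectors are not chosen measurably.\<close>

definition window_average ::
  "nat \<Rightarrow> (nat \<Rightarrow> real) \<Rightarrow> (nat \<Rightarrow> real vec) \<Rightarrow> real vec \<Rightarrow> real \<Rightarrow> real \<Rightarrow> real" where
  "window_average n l f u x e =
     real n / real (card (spectral_window n l x e)) *
       (\<Sum>i\<in>spectral_window n l x e. \<bar>f i \<bullet> u\<bar>\<^sup>2)"

end

theory Submission
  imports Defs "HOL-Real_Asymp.Real_Asymp" "Jordan_Normal_Form.Schur_Decomposition"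
begin

text \<open>
  Let \<open>H = n\<^sup>-\<^sup>1\<^sup>/\<^sup>2 X\<close>, \<open>G(z) = (H - z)\<^sup>-\<^sup>1\<close> and \<open>F(z) = v\<^sup>T G(z) v\<close>. By the resolvent identity the overlaps
  satisfy \<open>\<Sum>\<^sub>i \<langle>\<phi>\<^sub>i, v\<rangle>\<^sup>2 / (\<lambda>\<^sub>i - z) = F(z) / (1 + \<theta> F(z))\<close>, and the traces of the resolvents of \<open>H\<close> and \<open>W\<close>
  differ by at most \<open>\<bar>\<theta>\<bar> / (Im z)\<^sup>2\<close>. At \<open>z = x + \<epsilon> w\<close> with \<open>w\<close> fixed in the upper half plane, both \<open>F(z)\<close> and
  the normalised trace of \<open>G(z)\<close> converge in probability to the boundary value
  \<open>m = (- x + i (4 - x\<^sup>2)\<^sup>1\<^sup>/\<^sup>2) / 2\<close> of the semicircle transform. Hence all Poisson integrals at scale \<open>\<epsilon>\<close> of the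
  spectral measure and of the overlap measure converge to the constants \<open>Im m\<close> and
  \<open>Im (m / (1 + \<theta> m)) = Im m / (\<theta>\<^sup>2 - \<theta> x + 1)\<close>. Approximating the indicator of the window by Poisson
  kernels, the masses of the window under the two measures have this ratio in the limit.

  The convergence of the trace follows from the self-consistent equation \<open>1 + z s + s\<^sup>2 \<approx> 0\<close>, by Schur
  complements. For \<open>F\<close> one sums \<open>-(z + s) (G v)\<^sub>i \<approx> v\<^sub>i - r\<^sub>i\<close> against \<open>v\<^sub>i\<close>, where \<open>r\<^sub>i\<close> is linear in row \<open>i\<close>; the
  cross moments of \<open>r\<^sub>i\<close> and \<open>r\<^sub>j\<close> are small because removing the other index makes one factor centred.
  The resulting moment bound for a minor involves minors with two fewer rows, and each iteration
  gains a power of \<open>n\<^sup>-\<^sup>\<delta>\<close>, so that boundedly many iterations beat the trivial bound \<open>1 / Im z\<close>.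
\<close>

section \<open>Resolvents and Schur complements\<close>

text \<open>Fluctuations are estimated through second moments only, so each gains one factor
  \<open>rho = 1 / (sqrt n * Im z)\<close>, eventually at most n^(-\<delta>). The price is
  circularity: by the Ward identity the squares in every bound for \<open>F\<close> add up to
  \<open>Im F / Im z\<close>, hence the bootstrap of the expected \<open>Im F\<close> over minors.
  The bootstrap divides by \<open>z + s\<close>, which is bounded below only where the trace is near
  \<open>m\<close>. Elsewhere just \<open>|F| <= 1 / Im z\<close> is available, so the exceptional
  event must have probability at most \<open>Im z\<close>. The first moment bound for the trace does
  not give this; the bounded difference inequality does. For a prescribed accuracy the window is
  compared with a fixed finite set of Poisson kernels, so finitely many points \<open>w\<close>
  suffice and no union bound over a growing grid enters. A random spike vector is frozen by
  independence, which is why the rate for the form has to be uniform over unit vectors.\<close>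

text \<open>Extending by zero outside \<open>S\<close> makes the resolvent of a submatrix unique.\<close>

definition is_resolvent ::
  "('i \<Rightarrow> 'i \<Rightarrow> real) \<Rightarrow> complex \<Rightarrow> 'i set \<Rightarrow> ('i \<Rightarrow> 'i \<Rightarrow> complex) \<Rightarrow> bool" where
  "is_resolvent H z S G \<longleftrightarrow>
     (\<forall>i j. i \<notin> S \<or> j \<notin> S \<longrightarrow> G i j = 0) \<and>
     (\<forall>i\<in>S. \<forall>j\<in>S. (\<Sum>k\<in>S. of_real (H i k) * G k j) - z * G i j = (if i = j then 1 else 0))"

definition resolvent :: "('i \<Rightarrow> 'i \<Rightarrow> real) \<Rightarrow> complex \<Rightarrow> 'i set \<Rightarrow> 'i \<Rightarrow> 'i \<Rightarrow> complex" where
  "resolvent H z S = (THE G. is_resolvent H z S G)"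

definition res_vec :: "('i \<Rightarrow> 'i \<Rightarrow> real) \<Rightarrow> complex \<Rightarrow> 'i set \<Rightarrow> ('i \<Rightarrow> real) \<Rightarrow> 'i \<Rightarrow> complex" where
  "res_vec H z S u k = (\<Sum>l\<in>S. resolvent H z S k l * of_real (u l))"

text \<open>Bilinear rather than sesquilinear. The vector \<open>u\<close> is real, so the two agree
  and \<open>ward\<close> controls the imaginary part.\<close>

definition res_form :: "('i \<Rightarrow> 'i \<Rightarrow> real) \<Rightarrow> complex \<Rightarrow> 'i set \<Rightarrow> ('i \<Rightarrow> real) \<Rightarrow> complex" where
  "res_form H z S u = (\<Sum>k\<in>S. of_real (u k) * res_vec H z S u k)"

definition res_trace :: "('i \<Rightarrow> 'i \<Rightarrow> real) \<Rightarrow> complex \<Rightarrow> 'i set \<Rightarrow> complex" where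
  "res_trace H z S = (\<Sum>k\<in>S. resolvent H z S k k)"

section \<open>Ward identity, existence and uniqueness of the resolvent\<close>

locale symmetric_resolvent =
  fixes H :: "'i \<Rightarrow> 'i \<Rightarrow> real" and z :: complex
  assumes sym: "H i j = H j i" and Im_z: "Im z > 0"
begin

lemma Im_hermitian_form: "Im (\<Sum>i\<in>S. cnj (c i) * (\<Sum>k\<in>S. of_real (H i k) * c k)) = 0"
proof -
  let ?T = "\<Sum>i\<in>S. cnj (c i) * (\<Sum>k\<in>S. of_real (H i k) * c k)"
  have "cnj ?T = (\<Sum>i\<in>S. \<Sum>k\<in>S. c i * (of_real (H i k) * cnj (c k)))"
    by (simp add: sum_distrib_left)
  also have "\<dots> = (\<Sum>k\<in>S. \<Sum>i\<in>S. c i * (of_real (H i k) * cnj (c k)))"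
    by (rule sum.swap)
  also have "\<dots> = ?T"
    unfolding sum_distrib_left
    by (intro sum.cong refl) (simp add: sym mult_ac)
  finally have "cnj ?T = ?T" .
  then show ?thesis by (metis Reals_cnj_iff complex_is_Real_iff)
qed

text \<open>Pair the equation \<open>(H - z) c = v\<close> with the conjugate of \<open>c\<close>.
  The Hermitian part is real, so the imaginary part comes from \<open>z\<close> times the squared
  norm alone. All later sums of squares of resolvent entries are evaluated by this identity.\<close>

lemma ward:
  assumes "\<And>i. i \<in> S \<Longrightarrow> (\<Sum>k\<in>S. of_real (H i k) * c k) - z * c i = of_real (v i)"
  shows "Im (\<Sum>i\<in>S. of_real (v i) * c i) = Im z * (\<Sum>i\<in>S. (cmod (c i))\<^sup>2)"
proof -
  have "(\<Sum>i\<in>S. cnj (c i) * of_real (v i))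
      = (\<Sum>i\<in>S. cnj (c i) * (\<Sum>k\<in>S. of_real (H i k) * c k)) - (\<Sum>i\<in>S. cnj (c i) * (z * c i))"
    unfolding sum_subtractf[symmetric]
    by (intro sum.cong refl) (simp add: assms[symmetric] algebra_simps)
  then have "Im (\<Sum>i\<in>S. cnj (c i) * of_real (v i)) = - Im (\<Sum>i\<in>S. cnj (c i) * (z * c i))"
    using Im_hermitian_form[of c S] by simp
  also have "(\<Sum>i\<in>S. cnj (c i) * (z * c i)) = z * of_real (\<Sum>i\<in>S. (cmod (c i))\<^sup>2)"
    by (simp add: sum_distrib_left complex_norm_square mult_ac del: of_real_power)
  also have "Im (\<Sum>i\<in>S. cnj (c i) * of_real (v i)) = - Im (\<Sum>i\<in>S. of_real (v i) * c i)"
    by (simp add: sum_negf[symmetric] mult_ac)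
  finally show ?thesis by simp
qed

lemma kernel_trivial:
  assumes "finite S" "\<And>i. i \<in> S \<Longrightarrow> (\<Sum>k\<in>S. of_real (H i k) * c k) - z * c i = 0" "i \<in> S"
  shows "c i = 0"
proof -
  have "Im z * (\<Sum>i\<in>S. (cmod (c i))\<^sup>2) = 0"
    using ward[of S c "\<lambda>_. 0"] assms(2) by simp
  then have "(\<Sum>i\<in>S. (cmod (c i))\<^sup>2) = 0" using Im_z by simp
  then show ?thesis using assms by (simp add: sum_nonneg_eq_0_iff)
qed

lemma is_resolvent_unique:
  assumes "finite S" "is_resolvent H z S G" "is_resolvent H z S G'"
  shows "G = G'"
proof (intro ext)
  fix i j
  show "G i j = G' i j"
  proof (cases "i \<in> S \<and> j \<in> S")
    case True
    have "(\<Sum>k\<in>S. of_real (H a k) * (G k j - G' k j)) - z * (G a j - G' a j) = 0" if "a \<in> S" for a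
    proof -
      have "(\<Sum>k\<in>S. of_real (H a k) * G k j) - z * G a j = (\<Sum>k\<in>S. of_real (H a k) * G' k j) - z * G' a j"
        using assms True that unfolding is_resolvent_def by simp
      then show ?thesis by (simp add: algebra_simps sum_subtractf)
    qed
    from kernel_trivial[OF assms(1) this, of i] True show ?thesis by simp
  next
    case False
    then show ?thesis using assms unfolding is_resolvent_def by metis
  qed
qed

lemma is_resolvent_solves:
  assumes "finite S" "is_resolvent H z S G" "a \<in> S"
  shows "(\<Sum>k\<in>S. of_real (H a k) * (\<Sum>l\<in>S. G k l * v l)) - z * (\<Sum>l\<in>S. G a l * v l) = v a"
proof -
  have "(\<Sum>k\<in>S. of_real (H a k) * (\<Sum>l\<in>S. G k l * v l))
      = (\<Sum>l\<in>S. \<Sum>k\<in>S. of_real (H a k) * (G k l * v l))"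
    unfolding sum_distrib_left by (rule sum.swap)
  also have "\<dots> = (\<Sum>l\<in>S. (\<Sum>k\<in>S. of_real (H a k) * G k l) * v l)"
    by (simp add: sum_distrib_right mult.assoc)
  finally have 1: "(\<Sum>k\<in>S. of_real (H a k) * (\<Sum>l\<in>S. G k l * v l)) = \<dots>" .
  have 2: "z * (\<Sum>l\<in>S. G a l * v l) = (\<Sum>l\<in>S. z * G a l * v l)"
    by (simp add: sum_distrib_left mult.assoc)
  have "(\<Sum>k\<in>S. of_real (H a k) * (\<Sum>l\<in>S. G k l * v l)) - z * (\<Sum>l\<in>S. G a l * v l)
      = (\<Sum>l\<in>S. ((\<Sum>k\<in>S. of_real (H a k) * G k l) - z * G a l) * v l)"
    unfolding 1 2 by (simp only: sum_subtractf[symmetric] left_diff_distrib)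
  also have "\<dots> = (\<Sum>l\<in>S. if a = l then v l else 0)"
    using assms(2,3) unfolding is_resolvent_def by (intro sum.cong refl) simp
  also have "\<dots> = v a" using assms(1,3) by simp
  finally show ?thesis .
qed

text \<open>Block inversion, one index at a time. The resolvent grows by the rank-one matrix
  \<open>g p p^T\<close>, where \<open>g\<close> is the inverse Schur complement. Since
  \<open>Im q\<close> is nonnegative, the Schur complement has imaginary part at most
  \<open>- Im z\<close> and is invertible.\<close>

lemma schur_extension:
  assumes "finite S" "is_resolvent H z S G" "\<And>k l. G k l = G l k" "i \<notin> S"
  defines "c \<equiv> \<lambda>k. \<Sum>l\<in>S. G k l * of_real (H i l)"
  defines "q \<equiv> \<Sum>k\<in>S. of_real (H i k) * c k"
  defines "g \<equiv> 1 / (of_real (H i i) - z - q)"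
  defines "p \<equiv> \<lambda>k. if k = i then 1 else - c k"
  shows "Im q = Im z * (\<Sum>k\<in>S. (cmod (c k))\<^sup>2)"
    and "is_resolvent H z (insert i S) (\<lambda>k l. G k l + g * p k * p l)"
proof -
  have c0: "c k = 0" if "k \<notin> S" for k
    using assms(2) that unfolding is_resolvent_def c_def by simp
  have G0: "G k l = 0" if "k \<notin> S \<or> l \<notin> S" for k l
    using assms(2) that unfolding is_resolvent_def by simp
  have ceq: "(\<Sum>k\<in>S. of_real (H a k) * c k) - z * c a = of_real (H i a)" if "a \<in> S" for a
    unfolding c_def using is_resolvent_solves[OF assms(1,2) that] .
  show Imq: "Im q = Im z * (\<Sum>k\<in>S. (cmod (c k))\<^sup>2)"
    unfolding q_def by (rule ward) (use ceq in simp)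
  have "Im z * (\<Sum>k\<in>S. (cmod (c k))\<^sup>2) \<ge> 0" using Im_z by (simp add: sum_nonneg)
  moreover have "Im (of_real (H i i) - z - q) = - Im z - Im q" by simp
  ultimately have "Im (of_real (H i i) - z - q) < 0"
    using Imq Im_z by linarith
  then have d0: "of_real (H i i) - z - q \<noteq> 0" by auto
  then have gd: "g * (of_real (H i i) - z - q) = 1" by (simp add: g_def)
  \<comment> \<open>The vector \<open>p\<close> solves \<open>(H - z) p = d e_i\<close> with
    \<open>d\<close> the Schur complement, so the correction \<open>g p p^T\<close> changes row
    \<open>i\<close> only.\<close>
  have Hp: "(\<Sum>k\<in>insert i S. of_real (H a k) * p k) - z * p a = (if a = i then of_real (H i i) - z - q else 0)"
    if "a \<in> insert i S" for a
  proof -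
    have "(\<Sum>k\<in>S. of_real (H a k) * p k) = - (\<Sum>k\<in>S. of_real (H a k) * c k)"
      unfolding sum_negf[symmetric] using assms(4) by (intro sum.cong refl) (auto simp: p_def)
    then have *: "(\<Sum>k\<in>insert i S. of_real (H a k) * p k) = of_real (H a i) - (\<Sum>k\<in>S. of_real (H a k) * c k)"
      using assms(1,4) by (simp add: p_def)
    show ?thesis
      unfolding * using ceq[of a] that assms(4) by (auto simp: p_def q_def sym[of a i] algebra_simps)
  qed
  show "is_resolvent H z (insert i S) (\<lambda>k l. G k l + g * p k * p l)"
    unfolding is_resolvent_def
  proof (intro conjI allI impI ballI)
    fix k l assume "k \<notin> insert i S \<or> l \<notin> insert i S"
    then show "G k l + g * p k * p l = 0" by (auto simp: p_def c0 G0)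
  next
    fix a b assume a: "a \<in> insert i S" and b: "b \<in> insert i S"
    have "(\<Sum>k\<in>insert i S. of_real (H a k) * (G k b + g * p k * p b)) - z * (G a b + g * p a * p b)
       = ((\<Sum>k\<in>insert i S. of_real (H a k) * G k b) - z * G a b)
         + g * p b * ((\<Sum>k\<in>insert i S. of_real (H a k) * p k) - z * p a)"
      by (simp add: algebra_simps sum.distrib sum_distrib_left)
    also have "(\<Sum>k\<in>insert i S. of_real (H a k) * G k b) = (\<Sum>k\<in>S. of_real (H a k) * G k b)"
      using assms(1,4) by (simp add: G0)
    also have "(\<Sum>k\<in>S. of_real (H a k) * G k b) - z * G a b =
        (if a = i then (if b = i then 0 else c b) else if a = b then 1 else 0)"
    proof (cases "a = i")
      case True
      have "(\<Sum>k\<in>S. of_real (H i k) * G k b) = c b"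
        unfolding c_def by (intro sum.cong refl) (simp add: assms(3)[of b] mult_ac)
      then show ?thesis using True assms(4) c0 G0 by auto
    next
      case False
      then have "a \<in> S" using a by simp
      then have "(\<Sum>k\<in>S. of_real (H a k) * G k b) - z * G a b = (if a = b then 1 else 0)" if "b \<in> S"
        using that assms(2) unfolding is_resolvent_def by blast
      then show ?thesis using False b assms(4) G0 by (cases "b = i") auto
    qed
    finally show "(\<Sum>k\<in>insert i S. of_real (H a k) * (G k b + g * p k * p b)) - z * (G a b + g * p a * p b)
        = (if a = b then 1 else 0)"
      using Hp[OF a] gd by (auto simp: p_def mult_ac)
  qed
qed

text \<open>Adding indices one by one yields existence together with symmetry; symmetry is carried
  along because the extension step consumes it.\<close>

lemma resolvent_exists: "finite S \<Longrightarrow> \<exists>G. is_resolvent H z S G \<and> (\<forall>k l. G k l = G l k)"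
proof (induction S rule: finite_induct)
  case empty
  show ?case by (rule exI[of _ "\<lambda>_ _. 0"]) (simp add: is_resolvent_def)
next
  case (insert i S)
  then obtain G where G: "is_resolvent H z S G" "\<And>k l. G k l = G l k" by blast
  show ?case
    by (rule exI, rule conjI, rule schur_extension(2)[OF insert.hyps(1) G insert.hyps(2)])
       (simp add: G(2) mult_ac)
qed

lemma
  assumes "finite S"
  shows is_resolvent_resolvent: "is_resolvent H z S (resolvent H z S)"
    and resolvent_sym: "resolvent H z S k l = resolvent H z S l k"
proof -
  obtain G where G: "is_resolvent H z S G" "\<And>k l. G k l = G l k"
    using resolvent_exists[OF assms] by blast
  then have "resolvent H z S = G"
    unfolding resolvent_def using is_resolvent_unique[OF assms] by blast
  then show "is_resolvent H z S (resolvent H z S)" "resolvent H z S k l = resolvent H z S l k"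
    using G by auto
qed

lemma resolventI: "finite S \<Longrightarrow> is_resolvent H z S G \<Longrightarrow> resolvent H z S = G"
  using is_resolvent_unique is_resolvent_resolvent by blast

lemma resolvent_outside: "finite S \<Longrightarrow> k \<notin> S \<or> l \<notin> S \<Longrightarrow> resolvent H z S k l = 0"
  using is_resolvent_resolvent unfolding is_resolvent_def by blast

lemma res_vec_outside: "finite S \<Longrightarrow> k \<notin> S \<Longrightarrow> res_vec H z S u k = 0"
  by (simp add: res_vec_def resolvent_outside)

lemma res_vec_eq:
  assumes "finite S" "a \<in> S"
  shows "(\<Sum>k\<in>S. of_real (H a k) * res_vec H z S u k) - z * res_vec H z S u a = of_real (u a)"
  unfolding res_vec_def by (rule is_resolvent_solves[OF assms(1) is_resolvent_resolvent[OF assms(1)] assms(2)])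

lemma Im_res_form:
  "finite S \<Longrightarrow> Im (res_form H z S u) = Im z * (\<Sum>k\<in>S. (cmod (res_vec H z S u k))\<^sup>2)"
  unfolding res_form_def by (rule ward) (rule res_vec_eq)

lemma Im_res_form_nonneg: "finite S \<Longrightarrow> Im (res_form H z S u) \<ge> 0"
  using Im_z by (simp add: Im_res_form sum_nonneg)

text \<open>Ward gives \<open>Im z * Y <= |F|\<close> and Cauchy-Schwarz gives
  \<open>|F| <= sqrt V * sqrt Y\<close>. Cancelling \<open>sqrt Y\<close> bounds \<open>Y\<close>,
  and feeding this back bounds \<open>F\<close>.\<close>

lemma
  assumes "finite S"
  shows res_vec_bound: "(\<Sum>k\<in>S. (cmod (res_vec H z S u k))\<^sup>2) \<le> (\<Sum>k\<in>S. (u k)\<^sup>2) / (Im z)\<^sup>2"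
    and res_form_bound: "cmod (res_form H z S u) \<le> (\<Sum>k\<in>S. (u k)\<^sup>2) / Im z"
proof -
  define Y where "Y = (\<Sum>k\<in>S. (cmod (res_vec H z S u k))\<^sup>2)"
  define V where "V = (\<Sum>k\<in>S. (u k)\<^sup>2)"
  have Y0: "Y \<ge> 0" and V0: "V \<ge> 0" unfolding Y_def V_def by (simp_all add: sum_nonneg)
  have "cmod (res_form H z S u) \<le> (\<Sum>k\<in>S. \<bar>u k\<bar> * cmod (res_vec H z S u k))"
    unfolding res_form_def by (rule sum_norm_le) (simp add: norm_mult)
  also have "\<dots> \<le> L2_set u S * L2_set (\<lambda>k. cmod (res_vec H z S u k)) S"
    using L2_set_mult_ineq[of u "\<lambda>k. cmod (res_vec H z S u k)" S] by simp
  finally have CS: "cmod (res_form H z S u) \<le> sqrt V * sqrt Y" by (simp add: L2_set_def Y_def V_def)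
  have "Im z * Y \<le> sqrt V * sqrt Y"
    using CS abs_Im_le_cmod[of "res_form H z S u"] Im_res_form[OF assms, of u] by (simp add: Y_def)
  then have *: "(Im z * sqrt Y) * sqrt Y \<le> sqrt V * sqrt Y" using Y0 by (simp add: mult.assoc)
  have "Im z * sqrt Y \<le> sqrt V"
  proof (cases "Y = 0")
    case True
    then show ?thesis using V0 by simp
  next
    case False
    then show ?thesis using Y0 by (intro mult_right_le_imp_le[OF *]) simp
  qed
  then have sY: "sqrt Y \<le> sqrt V / Im z" using Im_z by (simp add: field_simps)
  then have "(sqrt Y)\<^sup>2 \<le> (sqrt V / Im z)\<^sup>2" by (intro power_mono) (simp_all add: Y0)
  then show "Y \<le> V / (Im z)\<^sup>2" using Y0 V0 by (simp add: power_divide)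
  have "sqrt V * sqrt Y \<le> sqrt V * (sqrt V / Im z)" by (intro mult_left_mono sY) (simp add: V0)
  also have "\<dots> = V / Im z" using V0 by simp
  finally show "cmod (res_form H z S u) \<le> V / Im z" using CS by simp
qed

lemma resolvent_insert:
  assumes "finite S" "i \<notin> S"
  defines "c \<equiv> res_vec H z S (H i)"
  defines "g \<equiv> 1 / (of_real (H i i) - z - res_form H z S (H i))"
  defines "p \<equiv> \<lambda>k. if k = i then 1 else - c k"
  shows "resolvent H z (insert i S) k l = resolvent H z S k l + g * p k * p l"
  using resolventI[OF _ schur_extension(2)[OF assms(1) is_resolvent_resolvent[OF assms(1)]
      resolvent_sym[OF assms(1)] assms(2)]] assms
  by (simp add: res_vec_def res_form_def)

end

text \<open>Row \<open>i\<close> is paired with the resolvent of the minor without \<open>i\<close>,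
  which does not involve that row. Conditionally on the minor this is therefore a centred linear
  form; it is the remainder r_i of the overview.\<close>

definition res_row :: "('i \<Rightarrow> 'i \<Rightarrow> real) \<Rightarrow> complex \<Rightarrow> 'i set \<Rightarrow> ('i \<Rightarrow> real) \<Rightarrow> 'i \<Rightarrow> complex" where
  "res_row H z S u i = (\<Sum>k\<in>S - {i}. of_real (H i k) * res_vec H z (S - {i}) u k)"

lemma resolvent_cong:
  assumes "\<And>k l. k \<in> S \<Longrightarrow> l \<in> S \<Longrightarrow> H k l = H' k l"
  shows "resolvent H z S = resolvent H' z S"
proof -
  have "is_resolvent H z S = is_resolvent H' z S"
    unfolding is_resolvent_def fun_eq_iff using assms by (simp cong: sum.cong)
  then show ?thesis unfolding resolvent_def by simp
qed

lemma res_vec_cong: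
  assumes "\<And>k l. k \<in> S \<Longrightarrow> l \<in> S \<Longrightarrow> H k l = H' k l" "\<And>k. k \<in> S \<Longrightarrow> u k = u' k"
  shows "res_vec H z S u k = res_vec H' z S u' k"
  unfolding res_vec_def using assms(2) by (simp add: resolvent_cong[of S H H', OF assms(1)])

section \<open>Diagonal entries, traces and the removal of one index\<close>

context symmetric_resolvent
begin

lemma res_vec_unit: "finite S \<Longrightarrow> l \<in> S \<Longrightarrow> res_vec H z S (\<lambda>j. if j = l then 1 else 0) k = resolvent H z S k l"
  by (simp add: res_vec_def if_distrib[of of_real] if_distrib[of "(*) _"] cong: if_cong)

lemma res_form_unit:
  "finite S \<Longrightarrow> l \<in> S \<Longrightarrow> res_form H z S (\<lambda>j. if j = l then 1 else 0) = resolvent H z S l l"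
  unfolding res_form_def by (simp add: res_vec_unit if_distrib[of of_real] if_distrib[of "\<lambda>x. x * _"] cong: if_cong)

lemma sum_norm_column:
  assumes "finite S" "l \<in> S"
  shows "(\<Sum>k\<in>S. (cmod (resolvent H z S k l))\<^sup>2) = Im (resolvent H z S l l) / Im z"
  using Im_res_form[OF assms(1), of "\<lambda>j. if j = l then 1 else 0"] Im_z assms
  by (simp add: res_form_unit res_vec_unit)

lemma Im_resolvent_diag_nonneg: "finite S \<Longrightarrow> l \<in> S \<Longrightarrow> 0 \<le> Im (resolvent H z S l l)"
  using Im_res_form_nonneg[of S "\<lambda>j. if j = l then 1 else 0"] by (simp add: res_form_unit)

lemma norm_resolvent_diag_sq:
  assumes "finite S" "l \<in> S"
  shows "(cmod (resolvent H z S l l))\<^sup>2 \<le> Im (resolvent H z S l l) / Im z"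
  unfolding sum_norm_column[OF assms, symmetric]
  by (rule member_le_sum[of l S "\<lambda>k. (cmod (resolvent H z S k l))\<^sup>2"]) (use assms in auto)

lemma norm_resolvent_diag:
  assumes "finite S" "l \<in> S"
  shows "cmod (resolvent H z S l l) \<le> 1 / Im z"
proof -
  have "(\<Sum>k\<in>S. (if k = l then 1 else 0 :: real)\<^sup>2) = (\<Sum>k\<in>S. if k = l then 1 else 0)"
    by (intro sum.cong) auto
  also have "\<dots> = 1" using assms by simp
  finally show ?thesis
    using res_form_bound[OF assms(1), of "\<lambda>j. if j = l then 1 else 0"] assms
    by (simp add: res_form_unit)
qed

lemma Im_res_trace: "Im (res_trace H z S) = (\<Sum>k\<in>S. Im (resolvent H z S k k))"
  by (simp add: res_trace_def)

lemma Im_res_trace_nonneg: "finite S \<Longrightarrow> 0 \<le> Im (res_trace H z S)"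
  unfolding Im_res_trace by (intro sum_nonneg Im_resolvent_diag_nonneg)

lemma norm_res_trace: "finite S \<Longrightarrow> cmod (res_trace H z S) \<le> card S / Im z"
  unfolding res_trace_def using sum_norm_bound[of S "\<lambda>k. resolvent H z S k k" "1 / Im z"] norm_resolvent_diag
  by simp

lemma sum_norm_resolvent:
  "finite S \<Longrightarrow> (\<Sum>l\<in>S. \<Sum>k\<in>S. (cmod (resolvent H z S k l))\<^sup>2) = Im (res_trace H z S) / Im z"
  by (simp add: sum_norm_column Im_res_trace sum_divide_distrib)

lemma sum_norm_diag_sq:
  "finite S \<Longrightarrow> (\<Sum>l\<in>S. (cmod (resolvent H z S l l))\<^sup>2) \<le> Im (res_trace H z S) / Im z"
  unfolding Im_res_trace sum_divide_distrib by (intro sum_mono norm_resolvent_diag_sq)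

context
  fixes S :: "'i set" and i :: 'i assumes fin: "finite S" and i: "i \<in> S"
begin

private lemma ins: "insert i S = S" using i by blast

private lemma finT: "finite (S - {i})" using fin by simp

lemma Im_schur_form:
  "Im (res_form H z (S - {i}) (H i)) = Im z * (\<Sum>k\<in>S - {i}. (cmod (res_vec H z (S - {i}) (H i) k))\<^sup>2)"
  using Im_res_form[OF finT] .

lemma schur_nonzero: "of_real (H i i) - z - res_form H z (S - {i}) (H i) \<noteq> 0"
proof -
  have "Im (of_real (H i i) - z - res_form H z (S - {i}) (H i)) < 0"
    using Im_res_form_nonneg[OF finT, of "H i"] Im_z by simp
  then show ?thesis by (metis less_irrefl zero_complex.sel(2))
qed

lemma resolvent_diag:
  "resolvent H z S i i = 1 / (of_real (H i i) - z - res_form H z (S - {i}) (H i))"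
  using resolvent_insert[OF finT, of i i i] fin
  by (simp add: ins resolvent_outside)

lemma resolvent_diag_mult:
  "resolvent H z S i i * (of_real (H i i) - z - res_form H z (S - {i}) (H i)) = 1"
  using schur_nonzero by (simp add: resolvent_diag)

text \<open>The modulus of the Schur complement is at least minus its imaginary part, which Ward
  computes exactly. Compared with \<open>|G_ii| <= 1 / Im z\<close>, the extra factor
  \<open>1 + |c|^2\<close> allows a diagonal entry to absorb a sum of squares.\<close>

lemma norm_resolvent_diag_schur:
  "cmod (resolvent H z S i i) * (Im z * (1 + (\<Sum>k\<in>S - {i}. (cmod (res_vec H z (S - {i}) (H i) k))\<^sup>2))) \<le> 1"
proof -
  let ?d = "of_real (H i i) - z - res_form H z (S - {i}) (H i)"
  have "Im z * (1 + (\<Sum>k\<in>S - {i}. (cmod (res_vec H z (S - {i}) (H i) k))\<^sup>2)) = - Im ?d"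
    by (simp add: Im_schur_form ring_distribs)
  also have "\<dots> \<le> cmod ?d" using abs_Im_le_cmod[of ?d] by linarith
  finally have "cmod (resolvent H z S i i) * (Im z * (1 + (\<Sum>k\<in>S - {i}. (cmod (res_vec H z (S - {i}) (H i) k))\<^sup>2)))
      \<le> cmod (resolvent H z S i i) * cmod ?d"
    by (rule mult_left_mono) simp
  also have "\<dots> = cmod (resolvent H z S i i * ?d)" by (simp add: norm_mult)
  also have "\<dots> = 1" unfolding resolvent_diag_mult by simp
  finally show ?thesis .
qed

lemma resolvent_remove:
  "resolvent H z S k l = resolvent H z (S - {i}) k l + resolvent H z S i i *
      (if k = i then 1 else - res_vec H z (S - {i}) (H i) k) *
      (if l = i then 1 else - res_vec H z (S - {i}) (H i) l)"
  using resolvent_insert[OF finT, of i k l] resolvent_diag by (simp add: ins)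

text \<open>By the rank-one formula the difference is \<open>G_ii\<close> times 1 plus the sum of
  the \<open>c_k^2\<close>, exactly what \<open>norm_resolvent_diag_schur\<close> absorbs. The bound
  is deterministic and replaces eigenvalue interlacing.\<close>

lemma norm_res_trace_diff: "cmod (res_trace H z S - res_trace H z (S - {i})) \<le> 1 / Im z"
proof -
  let ?g = "resolvent H z S i i" and ?c = "res_vec H z (S - {i}) (H i)"
  have "res_trace H z S = ?g + (\<Sum>k\<in>S - {i}. resolvent H z S k k)"
    unfolding res_trace_def using fin i by (simp add: sum.remove)
  also have "(\<Sum>k\<in>S - {i}. resolvent H z S k k) = (\<Sum>k\<in>S - {i}. resolvent H z (S - {i}) k k + ?g * (?c k)\<^sup>2)"
    by (intro sum.cong refl, subst resolvent_remove) (simp add: power2_eq_square)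
  finally have "res_trace H z S - res_trace H z (S - {i}) = ?g * (1 + (\<Sum>k\<in>S - {i}. (?c k)\<^sup>2))"
    by (simp add: res_trace_def sum.distrib sum_distrib_left algebra_simps)
  then have "cmod (res_trace H z S - res_trace H z (S - {i})) = cmod ?g * cmod (1 + (\<Sum>k\<in>S - {i}. (?c k)\<^sup>2))"
    by (simp add: norm_mult)
  also have "cmod (1 + (\<Sum>k\<in>S - {i}. (?c k)\<^sup>2)) \<le> 1 + (\<Sum>k\<in>S - {i}. (cmod (?c k))\<^sup>2)"
    by (rule norm_triangle_le) (auto intro!: sum_norm_le simp: norm_power)
  finally have "cmod (res_trace H z S - res_trace H z (S - {i})) * Im z
      \<le> cmod ?g * (1 + (\<Sum>k\<in>S - {i}. (cmod (?c k))\<^sup>2)) * Im z"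
    using Im_z by (simp add: mult_left_mono)
  also have "\<dots> \<le> 1" using norm_resolvent_diag_schur by (simp add: mult_ac)
  finally show ?thesis using Im_z by (simp add: field_simps)
qed

lemma res_row_eq: "res_row H z S u i = (\<Sum>k\<in>S - {i}. res_vec H z (S - {i}) (H i) k * of_real (u k))"
proof -
  have "res_row H z S u i = (\<Sum>k\<in>S - {i}. \<Sum>l\<in>S - {i}. of_real (H i k) * (resolvent H z (S - {i}) k l * of_real (u l)))"
    by (simp add: res_row_def res_vec_def sum_distrib_left)
  also have "\<dots> = (\<Sum>l\<in>S - {i}. \<Sum>k\<in>S - {i}. resolvent H z (S - {i}) l k * of_real (H i k) * of_real (u l))"
    by (subst sum.swap) (simp add: resolvent_sym[OF finT] mult_ac)
  finally show ?thesis by (simp add: res_vec_def sum_distrib_right)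
qed

lemma res_vec_remove:
  "res_vec H z S u k = res_vec H z (S - {i}) u k + resolvent H z S i i *
      (if k = i then 1 else - res_vec H z (S - {i}) (H i) k) * (of_real (u i) - res_row H z S u i)"
proof -
  let ?g = "resolvent H z S i i" and ?c = "res_vec H z (S - {i}) (H i)"
  let ?p = "\<lambda>l. if l = i then 1 else - ?c l"
  have "(\<Sum>l\<in>S. ?p l * of_real (u l)) = of_real (u i) + (\<Sum>l\<in>S - {i}. - (?c l * of_real (u l)))"
    using fin i by (subst sum.remove[of S i]) auto
  then have 1: "(\<Sum>l\<in>S. ?p l * of_real (u l)) = of_real (u i) - res_row H z S u i"
    by (simp add: res_row_eq sum_negf)
  have 2: "(\<Sum>l\<in>S. resolvent H z (S - {i}) k l * of_real (u l)) = res_vec H z (S - {i}) u k"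
    unfolding res_vec_def using fin i by (subst sum.remove[of S i]) (auto simp: resolvent_outside)
  have "res_vec H z S u k = (\<Sum>l\<in>S. resolvent H z S k l * of_real (u l))"
    by (rule res_vec_def)
  also have "\<dots> = (\<Sum>l\<in>S. (resolvent H z (S - {i}) k l + ?g * ?p k * ?p l) * of_real (u l))"
    by (intro sum.cong refl arg_cong2[of _ _ _ _ "(*)"] resolvent_remove)
  also have "\<dots> = (\<Sum>l\<in>S. resolvent H z (S - {i}) k l * of_real (u l)) + ?g * ?p k * (\<Sum>l\<in>S. ?p l * of_real (u l))"
    unfolding sum_distrib_left sum.distrib[symmetric] by (intro sum.cong refl) (simp only: ring_distribs mult.assoc)
  finally show ?thesis unfolding 1 2 .
qed

text \<open>The starting point of the isotropic law: entry \<open>i\<close> of \<open>G u\<close>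
  splits into a diagonal entry, treated by the trace law, and a term linear in row
  \<open>i\<close>.\<close>

lemma res_vec_diag: "res_vec H z S u i = resolvent H z S i i * (of_real (u i) - res_row H z S u i)"
  using res_vec_remove[of u i] by (simp add: res_vec_outside[OF finT])

end

text \<open>Isolates what row \<open>j\<close> contributes to the remainder of row \<open>i\<close>.
  The first summand does not see row \<open>j\<close>; the second is a product of an entry of a
  minor and the coupling of the two rows.\<close>

lemma res_row_remove:
  assumes "finite S" "i \<in> S" "j \<in> S" "i \<noteq> j"
  shows "res_row H z S u i = res_row H z (S - {j}) u i + res_vec H z (S - {i}) u j *
     (of_real (H i j) - (\<Sum>k\<in>S - {i, j}. of_real (H i k) * res_vec H z (S - {i, j}) (H j) k))"
proof -
  have j: "j \<in> S - {i}" and fin: "finite (S - {i})" using assms by auto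
  have e: "S - {i} - {j} = S - {i, j}" "S - {j} - {i} = S - {i, j}" by auto
  let ?g = "resolvent H z (S - {i}) j j" and ?c = "res_vec H z (S - {i, j}) (H j)"
  let ?w = "of_real (u j) - res_row H z (S - {i}) u j"
  have "res_row H z S u i = of_real (H i j) * res_vec H z (S - {i}) u j
      + (\<Sum>k\<in>S - {i, j}. of_real (H i k) * res_vec H z (S - {i}) u k)"
    unfolding res_row_def using fin j by (subst sum.remove[of _ j]) (auto simp: e)
  also have "(\<Sum>k\<in>S - {i, j}. of_real (H i k) * res_vec H z (S - {i}) u k)
     = (\<Sum>k\<in>S - {i, j}. of_real (H i k) * (res_vec H z (S - {i, j}) u k + ?g * (- ?c k) * ?w))"
    by (intro sum.cong refl, subst res_vec_remove[OF fin j]) (auto simp: e)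
  also have "\<dots> = (\<Sum>k\<in>S - {i, j}. of_real (H i k) * res_vec H z (S - {i, j}) u k)
     - ?g * ?w * (\<Sum>k\<in>S - {i, j}. of_real (H i k) * ?c k)"
    unfolding sum_distrib_left sum_subtractf[symmetric] by (intro sum.cong refl) (simp add: algebra_simps)
  also have "?g * ?w = res_vec H z (S - {i}) u j" by (rule res_vec_diag[OF fin j, symmetric])
  also have "(\<Sum>k\<in>S - {i, j}. of_real (H i k) * res_vec H z (S - {i, j}) u k) = res_row H z (S - {j}) u i"
    by (simp add: res_row_def e)
  finally show ?thesis by (simp add: algebra_simps)
qed

end

text \<open>The definite description says nothing about measurability, but
  \<open>resolvent_insert\<close> exhibits each entry as a rational expression in entries of smaller
  resolvents.\<close>

lemma measurable_resolvent:
  assumes "finite S" "\<And>x. symmetric_resolvent (H x) z" "\<And>k l. k \<in> S \<Longrightarrow> l \<in> S \<Longrightarrow> (\<lambda>x. H x k l) \<in> borel_measurable M"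
  shows "(\<lambda>x. resolvent (H x) z S k l) \<in> borel_measurable M"
  using assms(1,3)
proof (induction S arbitrary: k l rule: finite_induct)
  case empty
  have "resolvent (H x) z {} k l = 0" for x
    using symmetric_resolvent.resolvent_outside[OF assms(2), of "{}"] by simp
  then show ?case by simp
next
  case (insert i S)
  have [measurable]: "(\<lambda>x. resolvent (H x) z S k l) \<in> borel_measurable M" for k l
    using insert by simp
  have H[measurable]: "\<And>k l. k \<in> insert i S \<Longrightarrow> l \<in> insert i S \<Longrightarrow> (\<lambda>x. H x k l) \<in> borel_measurable M"
    by (rule insert.prems)
  have 1[measurable]: "(\<lambda>x. res_vec (H x) z S (H x i) k) \<in> borel_measurable M" for k
    unfolding res_vec_def
    by (intro borel_measurable_sum borel_measurable_times borel_measurable_of_real H) auto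
  have 2[measurable]: "(\<lambda>x. res_form (H x) z S (H x i)) \<in> borel_measurable M"
    unfolding res_form_def
    by (intro borel_measurable_sum borel_measurable_times borel_measurable_of_real H 1) auto
  have 3[measurable]: "(\<lambda>x. complex_of_real (H x i i)) \<in> borel_measurable M"
    using H[of i i] by simp
  show ?case
    unfolding symmetric_resolvent.resolvent_insert[OF assms(2) insert.hyps]
    by (auto intro!: borel_measurable_add borel_measurable_times borel_measurable_divide borel_measurable_diff 1 2 3)
qed

section \<open>Resampling in product spaces\<close>

text \<open>Integrating over \<open>y\<close> with \<open>x\<close> fixed is conditional expectation
  given the coordinates outside \<open>J\<close>.\<close>

definition resample :: "'k set \<Rightarrow> ('k \<Rightarrow> 'a) \<Rightarrow> ('k \<Rightarrow> 'a) \<Rightarrow> 'k \<Rightarrow> 'a" where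
  "resample J x y = (\<lambda>k. if k \<in> J then y k else x k)"

locale iid_product = prob_space \<mu> for \<mu> :: "real measure" +
  fixes K :: "'k set"
  assumes finite_K: "finite K" and sets_mu[measurable_cong]: "sets \<mu> = sets borel"
begin

definition P :: "('k \<Rightarrow> real) measure" where "P = (\<Pi>\<^sub>M k\<in>K. \<mu>)"

sublocale P: prob_space P
  unfolding P_def by (rule prob_space_PiM) (rule prob_space_axioms)

sublocale PP: pair_prob_space P P ..

sublocale prod: product_sigma_finite "\<lambda>_::'k. \<mu>" ..

lemma space_mu[simp]: "space \<mu> = UNIV"
  using sets_eq_imp_space_eq[OF sets_mu] by simp

lemma measurable_coord[measurable]: "k \<in> K \<Longrightarrow> (\<lambda>x. x k) \<in> borel_measurable P"
  unfolding P_def by measurable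

lemma measurable_coord_mu: "k \<in> K \<Longrightarrow> (\<lambda>x. x k) \<in> P \<rightarrow>\<^sub>M \<mu>"
  unfolding P_def by (rule measurable_component_singleton)

lemma resample_space: "x \<in> space P \<Longrightarrow> y \<in> space P \<Longrightarrow> resample J x y \<in> space P"
  by (auto simp: P_def space_PiM resample_def PiE_def extensional_def)

lemma measurable_resample[measurable]: "(\<lambda>(x, y). resample J x y) \<in> P \<Otimes>\<^sub>M P \<rightarrow>\<^sub>M P"
proof -
  have "(\<lambda>p. resample J (fst p) (snd p)) \<in> P \<Otimes>\<^sub>M P \<rightarrow>\<^sub>M (\<Pi>\<^sub>M k\<in>K. \<mu>)"
  proof (rule measurable_PiM_single')
    fix k assume k: "k \<in> K"
    show "(\<lambda>p. resample J (fst p) (snd p) k) \<in> P \<Otimes>\<^sub>M P \<rightarrow>\<^sub>M \<mu>"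
      using measurable_compose[OF measurable_fst measurable_coord_mu[OF k], of P]
        measurable_compose[OF measurable_snd measurable_coord_mu[OF k], of P]
      by (simp add: resample_def)
  next
    show "(\<lambda>p. resample J (fst p) (snd p)) \<in> space (P \<Otimes>\<^sub>M P) \<rightarrow> (\<Pi>\<^sub>E k\<in>K. space \<mu>)"
      by (auto simp: space_pair_measure P_def space_PiM resample_def PiE_def extensional_def)
  qed
  then show ?thesis by (simp add: P_def case_prod_beta')
qed

text \<open>Checked on boxes: the preimage of a box is a product of two boxes, and in each
  coordinate one of the two factors is the whole line.\<close>

lemma distr_resample: "distr (P \<Otimes>\<^sub>M P) P (\<lambda>(x, y). resample J x y) = P"
proof -
  have "distr (P \<Otimes>\<^sub>M P) P (\<lambda>(x, y). resample J x y) = (\<Pi>\<^sub>M k\<in>K. \<mu>)"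
  proof (rule prod.PiM_eqI[OF finite_K])
    show "sets (distr (P \<Otimes>\<^sub>M P) P (\<lambda>(x, y). resample J x y)) = sets (\<Pi>\<^sub>M k\<in>K. \<mu>)" by (simp add: P_def)
  next
    fix A :: "'k \<Rightarrow> real set" assume A: "\<And>k. k \<in> K \<Longrightarrow> A k \<in> sets \<mu>"
    let ?B = "Pi\<^sub>E K (\<lambda>k. if k \<in> J then UNIV else A k)" and ?C = "Pi\<^sub>E K (\<lambda>k. if k \<in> J then A k else UNIV)"
    have [measurable]: "?B \<in> sets P" "?C \<in> sets P" "Pi\<^sub>E K A \<in> sets P"
      unfolding P_def using A finite_K
      by (auto intro!: sets_PiM_I_finite)
    have "(\<lambda>(x, y). resample J x y) -` Pi\<^sub>E K A \<inter> space (P \<Otimes>\<^sub>M P) = ?B \<times> ?C"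
      by (auto simp: space_pair_measure P_def space_PiM resample_def PiE_def extensional_def Pi_def split: if_splits)
    then have "emeasure (distr (P \<Otimes>\<^sub>M P) P (\<lambda>(x, y). resample J x y)) (Pi\<^sub>E K A) = emeasure (P \<Otimes>\<^sub>M P) (?B \<times> ?C)"
      by (simp add: emeasure_distr)
    also have "\<dots> = emeasure P ?B * emeasure P ?C"
      by (intro P.emeasure_pair_measure_Times) auto
    also have "emeasure P ?B = (\<Prod>k\<in>K. if k \<in> J then 1 else emeasure \<mu> (A k))"
      unfolding P_def using A finite_K sets.top[of \<mu>] emeasure_space_1
      by (subst prod.emeasure_PiM) (auto intro!: prod.cong)
    also have "emeasure P ?C = (\<Prod>k\<in>K. if k \<in> J then emeasure \<mu> (A k) else 1)"
      unfolding P_def using A finite_K sets.top[of \<mu>] emeasure_space_1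
      by (subst prod.emeasure_PiM) (auto intro!: prod.cong)
    also have "(\<Prod>k\<in>K. if k \<in> J then 1 else emeasure \<mu> (A k)) * (\<Prod>k\<in>K. if k \<in> J then emeasure \<mu> (A k) else 1)
      = (\<Prod>k\<in>K. emeasure \<mu> (A k))"
      unfolding prod.distrib[symmetric] by (intro prod.cong) auto
    finally show "emeasure (distr (P \<Otimes>\<^sub>M P) P (\<lambda>(x, y). resample J x y)) (Pi\<^sub>E K A) = (\<Prod>k\<in>K. emeasure \<mu> (A k))" .
  qed
  then show ?thesis by (simp add: P_def)
qed

text \<open>The tower property, obtained from Fubini and the invariance of \<open>P\<close> under
  resampling.\<close>

lemma integral_resample:
  fixes f :: "('k \<Rightarrow> real) \<Rightarrow> 'b::{banach, second_countable_topology}"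
  assumes "integrable P f"
  shows "integral\<^sup>L P f = (\<integral>x. (\<integral>y. f (resample J x y) \<partial>P) \<partial>P)"
proof -
  have m: "f \<in> borel_measurable P" using assms by simp
  have "integrable (distr (P \<Otimes>\<^sub>M P) P (\<lambda>(x, y). resample J x y)) f" using assms by (simp add: distr_resample)
  then have i: "integrable (P \<Otimes>\<^sub>M P) (\<lambda>(x, y). f (resample J x y))"
    using m by (subst (asm) integrable_distr_eq) (simp_all add: case_prod_beta')
  have "integral\<^sup>L P f = integral\<^sup>L (distr (P \<Otimes>\<^sub>M P) P (\<lambda>(x, y). resample J x y)) f"
    by (simp add: distr_resample)
  also have "\<dots> = (\<integral>p. f ((\<lambda>(x, y). resample J x y) p) \<partial>(P \<Otimes>\<^sub>M P))"
    by (rule integral_distr) (simp_all add: m)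
  also have "\<dots> = (\<integral>x. (\<integral>y. f (resample J x y) \<partial>P) \<partial>P)"
    using PP.integral_fst'[OF i] by (simp add: case_prod_beta')
  finally show ?thesis .
qed

text \<open>Conditional moment bounds yield integrability and the unconditional bound at once. Since
  \<open>f\<close> is nonnegative, Tonelli applies before integrability is known.\<close>

lemma integrable_resample_bound:
  fixes f g :: "('k \<Rightarrow> real) \<Rightarrow> real"
  assumes m: "f \<in> borel_measurable P" and nonneg: "\<And>x. x \<in> space P \<Longrightarrow> 0 \<le> f x"
    and g: "integrable P g"
    and int: "\<And>x. x \<in> space P \<Longrightarrow> integrable P (\<lambda>y. f (resample J x y))"
    and le: "\<And>x. x \<in> space P \<Longrightarrow> (\<integral>y. f (resample J x y) \<partial>P) \<le> g x"
  shows "integrable P f" and "integral\<^sup>L P f \<le> integral\<^sup>L P g"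
proof -
  have g0: "0 \<le> g x" if "x \<in> space P" for x
    by (rule order_trans[OF _ le[OF that]], rule integral_nonneg_AE, rule AE_I2) (intro nonneg resample_space that)
  have "(\<integral>\<^sup>+x. ennreal (f x) \<partial>P) = (\<integral>\<^sup>+x. ennreal (f x) \<partial>distr (P \<Otimes>\<^sub>M P) P (\<lambda>(x, y). resample J x y))"
    by (simp add: distr_resample)
  also have "\<dots> = (\<integral>\<^sup>+p. ennreal (f (resample J (fst p) (snd p))) \<partial>(P \<Otimes>\<^sub>M P))"
    by (subst nn_integral_distr) (use m in \<open>auto simp: case_prod_beta'\<close>)
  also have "\<dots> = (\<integral>\<^sup>+x. (\<integral>\<^sup>+y. ennreal (f (resample J x y)) \<partial>P) \<partial>P)"
    by (subst P.nn_integral_fst[symmetric])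
       (use measurable_compose[OF measurable_resample m, of J] in \<open>auto simp: case_prod_beta'\<close>)
  also have "\<dots> \<le> (\<integral>\<^sup>+x. ennreal (g x) \<partial>P)"
  proof (rule nn_integral_mono)
    fix x assume x: "x \<in> space P"
    have "(\<integral>\<^sup>+y. ennreal (f (resample J x y)) \<partial>P) = ennreal (\<integral>y. f (resample J x y) \<partial>P)"
      by (rule nn_integral_eq_integral[OF int[OF x]]) (auto simp: nonneg resample_space x)
    also have "\<dots> \<le> ennreal (g x)" by (rule ennreal_leI[OF le[OF x]])
    finally show "(\<integral>\<^sup>+y. ennreal (f (resample J x y)) \<partial>P) \<le> ennreal (g x)" .
  qed
  also have "\<dots> = ennreal (integral\<^sup>L P g)"
    by (rule nn_integral_eq_integral[OF g]) (auto simp: g0)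
  finally have le': "(\<integral>\<^sup>+x. ennreal (f x) \<partial>P) \<le> ennreal (integral\<^sup>L P g)" .
  show "integrable P f"
  proof (rule integrableI_bounded[OF m])
    have "(\<integral>\<^sup>+x. ennreal (norm (f x)) \<partial>P) = (\<integral>\<^sup>+x. ennreal (f x) \<partial>P)"
      by (intro nn_integral_cong) (simp add: nonneg)
    then show "(\<integral>\<^sup>+x. ennreal (norm (f x)) \<partial>P) < \<infinity>"
      using le' by (metis ennreal_less_top infinity_ennreal_def le_less_trans)
  qed
  then have "(\<integral>\<^sup>+x. ennreal (f x) \<partial>P) = ennreal (integral\<^sup>L P f)"
    by (rule nn_integral_eq_integral) (auto simp: nonneg)
  moreover have "0 \<le> integral\<^sup>L P g" by (intro integral_nonneg_AE AE_I2 g0)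
  ultimately show "integral\<^sup>L P f \<le> integral\<^sup>L P g"
    using le' by (simp add: ennreal_le_iff)
qed

lemma integral_coord:
  fixes h :: "real \<Rightarrow> 'b::{banach, second_countable_topology}"
  assumes "k \<in> K" and [measurable]: "h \<in> borel_measurable borel"
  shows "(\<integral>x. h (x k) \<partial>P) = integral\<^sup>L \<mu> h"
    and "integrable P (\<lambda>x. h (x k)) \<longleftrightarrow> integrable \<mu> h"
proof -
  have d: "distr P \<mu> (\<lambda>x. x k) = \<mu>"
    unfolding P_def by (rule distr_PiM_component) (rule prob_space_axioms, rule assms)
  have c: "(\<lambda>x. x k) \<in> P \<rightarrow>\<^sub>M \<mu>" by (rule measurable_coord_mu[OF assms(1)])
  have h: "h \<in> borel_measurable \<mu>"
    using assms(2) by (simp add: measurable_cong_sets[OF sets_mu refl])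
  show "(\<integral>x. h (x k) \<partial>P) = integral\<^sup>L \<mu> h" using integral_distr[OF c h] by (simp add: d)
  show "integrable P (\<lambda>x. h (x k)) \<longleftrightarrow> integrable \<mu> h" using integrable_distr_eq[OF c h] by (simp add: d)
qed

end

section \<open>Second moments of linear and quadratic forms\<close>

locale iid_moments = iid_product \<mu> K for \<mu> :: "real measure" and K :: "'k set" +
  fixes \<kappa> :: real
  assumes int4: "integrable \<mu> (\<lambda>x. x ^ 4)" and mean: "integral\<^sup>L \<mu> (\<lambda>x. x) = 0"
    and var: "integral\<^sup>L \<mu> (\<lambda>x. x\<^sup>2) = 1" and kappa: "integral\<^sup>L \<mu> (\<lambda>x. x ^ 4) = \<kappa>"
begin

lemma kappa_nonneg: "\<kappa> \<ge> 0"
  unfolding kappa[symmetric] by (intro integral_nonneg_AE AE_I2) simp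

lemma integrable_dominated4:
  assumes "k \<in> K" "f \<in> borel_measurable P" "\<And>x. \<bar>f x\<bar> \<le> 1 + x k ^ 4"
  shows "integrable P f"
proof -
  have "integrable P (\<lambda>x. 1 + x k ^ 4)"
    using integral_coord(2)[OF assms(1), of "\<lambda>x. x ^ 4"] int4 by simp
  then show ?thesis
    by (rule Bochner_Integration.integrable_bound) (use assms in auto)
qed

lemma coord_moments:
  assumes "k \<in> K"
  shows "integrable P (\<lambda>x. x k)" "integrable P (\<lambda>x. (x k)\<^sup>2)" "integrable P (\<lambda>x. x k ^ 4)"
    "(\<integral>x. x k \<partial>P) = 0" "(\<integral>x. (x k)\<^sup>2 \<partial>P) = 1" "(\<integral>x. x k ^ 4 \<partial>P) = \<kappa>"
proof -
  note [measurable] = measurable_coord[OF assms]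
  \<comment> \<open>This is \<open>(s - 1/2)^2 >= 0\<close>. Applied to the square of
    \<open>t\<close> it dominates the second moment by the fourth; applied once more to the modulus
    of \<open>t\<close> it dominates the first.\<close>
  have le: "s \<le> s\<^sup>2 + 1 / 4" for s :: real
    using zero_le_power2[of "s - 1 / 2"] by (simp add: power2_eq_square algebra_simps)
  have t4: "(t\<^sup>2)\<^sup>2 = t ^ 4" for t :: real by (simp flip: power_mult)
  have 2: "\<bar>t\<^sup>2\<bar> \<le> 1 + t ^ 4" for t :: real
    using le[of "t\<^sup>2"] by (simp add: t4)
  have 1: "\<bar>t\<bar> \<le> 1 + t ^ 4" for t :: real
    using le[of "\<bar>t\<bar>"] le[of "t\<^sup>2"] by (simp add: t4)
  show "integrable P (\<lambda>x. x k)" "integrable P (\<lambda>x. (x k)\<^sup>2)" "integrable P (\<lambda>x. x k ^ 4)"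
    by (rule integrable_dominated4[OF assms]; measurable; use 1 2 in simp)+
  show "(\<integral>x. x k \<partial>P) = 0" "(\<integral>x. (x k)\<^sup>2 \<partial>P) = 1" "(\<integral>x. x k ^ 4 \<partial>P) = \<kappa>"
    using integral_coord(1)[OF assms, of "\<lambda>x. x"] integral_coord(1)[OF assms, of "\<lambda>x. x\<^sup>2"]
      integral_coord(1)[OF assms, of "\<lambda>x. x ^ 4"] mean var kappa by simp_all
qed

lemma coord_products:
  assumes "k \<in> K" "l \<in> K"
  shows "integrable P (\<lambda>x. x k * x l)" "(\<integral>x. x k * x l \<partial>P) = (if k = l then 1 else 0)"
proof -
  note [measurable] = measurable_coord[OF assms(1)] measurable_coord[OF assms(2)]
  have "integrable P (\<lambda>x. (x k)\<^sup>2 + (x l)\<^sup>2)" using coord_moments assms by simp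
  then show i: "integrable P (\<lambda>x. x k * x l)"
  proof (rule Bochner_Integration.integrable_bound)
    show "AE x in P. norm (x k * x l) \<le> norm ((x k)\<^sup>2 + (x l)\<^sup>2)"
    proof (rule AE_I2)
      fix x :: "'k \<Rightarrow> real"
      show "norm (x k * x l) \<le> norm ((x k)\<^sup>2 + (x l)\<^sup>2)"
        using sum_squares_bound[of "\<bar>x k\<bar>" "\<bar>x l\<bar>"] mult_nonneg_nonneg[of "\<bar>x k\<bar>" "\<bar>x l\<bar>"]
        unfolding real_norm_def abs_mult power2_abs by linarith
    qed
  qed measurable
  show "(\<integral>x. x k * x l \<partial>P) = (if k = l then 1 else 0)"
  proof (cases "k = l")
    case True
    then show ?thesis using coord_moments(5)[OF assms(1)] by (simp add: power2_eq_square)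
  next
    case False
    \<comment> \<open>Distinct coordinates: resampling coordinate \<open>k\<close> alone already
      averages the product to zero.\<close>
    then have "(\<integral>y. resample {k} x y k * resample {k} x y l \<partial>P) = 0" for x
      using coord_moments(4)[OF assms(1)] by (simp add: resample_def)
    then show ?thesis using False by (subst integral_resample[OF i, of "{k}"]) simp
  qed
qed

text \<open>The injection \<open>e\<close> lets the sum run over the columns of one matrix row while
  the variables are coordinates of the product space.\<close>

lemma linear_form_real:
  assumes "finite T" "inj_on e T" "e ` T \<subseteq> K"
  shows "integrable P (\<lambda>y. c + (\<Sum>k\<in>T. b k * y (e k)))"
    and "(\<integral>y. c + (\<Sum>k\<in>T. b k * y (e k)) \<partial>P) = (c :: real)"
    and "integrable P (\<lambda>y. (c + (\<Sum>k\<in>T. b k * y (e k)))\<^sup>2)"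
    and "(\<integral>y. (c + (\<Sum>k\<in>T. b k * y (e k)))\<^sup>2 \<partial>P) = c\<^sup>2 + (\<Sum>k\<in>T. (b k)\<^sup>2)"
proof -
  have e: "e k \<in> K" if "k \<in> T" for k using assms that by auto
  have eq: "(e k = e l) = (k = l)" if "k \<in> T" "l \<in> T" for k l
    using assms(2) that by (auto dest: inj_onD)
  show "integrable P (\<lambda>y. c + (\<Sum>k\<in>T. b k * y (e k)))"
    "(\<integral>y. c + (\<Sum>k\<in>T. b k * y (e k)) \<partial>P) = c"
    using coord_moments[OF e] by (simp_all add: P.prob_space)
  have ex: "(\<lambda>y. (c + (\<Sum>k\<in>T. b k * y (e k)))\<^sup>2) = (\<lambda>y. c\<^sup>2 + (\<Sum>k\<in>T. (2 * c * b k) * y (e k))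
     + (\<Sum>k\<in>T. \<Sum>l\<in>T. (b k * b l) * (y (e k) * y (e l))))"
    by (rule ext) (simp add: power2_sum power2_eq_square[of "sum _ _"] sum_product sum_distrib_left mult_ac add_ac)
  show "integrable P (\<lambda>y. (c + (\<Sum>k\<in>T. b k * y (e k)))\<^sup>2)"
    unfolding ex using coord_moments[OF e] coord_products[OF e e] by simp
  have "(\<integral>y. (c + (\<Sum>k\<in>T. b k * y (e k)))\<^sup>2 \<partial>P)
    = c\<^sup>2 + (\<Sum>k\<in>T. \<Sum>l\<in>T. (b k * b l) * (if e k = e l then 1 else 0))"
    unfolding ex using coord_moments[OF e] coord_products[OF e e] by (simp add: P.prob_space)
  also have "(\<Sum>k\<in>T. \<Sum>l\<in>T. (b k * b l) * (if e k = e l then 1 else 0)) = (\<Sum>k\<in>T. \<Sum>l\<in>T. if k = l then b k * b l else 0)"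
    by (intro sum.cong refl) (simp add: eq)
  also have "\<dots> = (\<Sum>k\<in>T. (b k)\<^sup>2)" using assms(1) by (simp add: power2_eq_square)
  finally show "(\<integral>y. (c + (\<Sum>k\<in>T. b k * y (e k)))\<^sup>2 \<partial>P) = c\<^sup>2 + (\<Sum>k\<in>T. (b k)\<^sup>2)" .
qed

lemma linear_form:
  fixes b :: "'j \<Rightarrow> complex" and c :: complex
  assumes "finite T" "inj_on e T" "e ` T \<subseteq> K"
  shows "integrable P (\<lambda>y. c + (\<Sum>k\<in>T. b k * of_real (y (e k))))"
    and "(\<integral>y. c + (\<Sum>k\<in>T. b k * of_real (y (e k))) \<partial>P) = c"
    and "integrable P (\<lambda>y. (cmod (c + (\<Sum>k\<in>T. b k * of_real (y (e k)))))\<^sup>2)"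
    and "(\<integral>y. (cmod (c + (\<Sum>k\<in>T. b k * of_real (y (e k)))))\<^sup>2 \<partial>P) = (cmod c)\<^sup>2 + (\<Sum>k\<in>T. (cmod (b k))\<^sup>2)"
proof -
  have e: "e k \<in> K" if "k \<in> T" for k using assms that by auto
  have i: "integrable P (\<lambda>y. complex_of_real (y (e k)))" "(\<integral>y. complex_of_real (y (e k)) \<partial>P) = 0" if "k \<in> T" for k
    using coord_moments(1,4)[OF e[OF that]] by simp_all
  show "integrable P (\<lambda>y. c + (\<Sum>k\<in>T. b k * of_real (y (e k))))"
    "(\<integral>y. c + (\<Sum>k\<in>T. b k * of_real (y (e k))) \<partial>P) = c"
    using i by (simp_all add: P.prob_space)
  have ex: "(\<lambda>y. (cmod (c + (\<Sum>k\<in>T. b k * of_real (y (e k)))))\<^sup>2) =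
    (\<lambda>y. (Re c + (\<Sum>k\<in>T. Re (b k) * y (e k)))\<^sup>2 + (Im c + (\<Sum>k\<in>T. Im (b k) * y (e k)))\<^sup>2)"
    by (simp add: cmod_power2)
  note lr = linear_form_real(3,4)[OF assms]
  show "integrable P (\<lambda>y. (cmod (c + (\<Sum>k\<in>T. b k * of_real (y (e k)))))\<^sup>2)"
    unfolding ex using lr by simp
  show "(\<integral>y. (cmod (c + (\<Sum>k\<in>T. b k * of_real (y (e k)))))\<^sup>2 \<partial>P) = (cmod c)\<^sup>2 + (\<Sum>k\<in>T. (cmod (b k))\<^sup>2)"
    unfolding ex using lr by (simp add: cmod_power2 sum.distrib)
qed

lemma sum_insert_square:
  assumes "finite T" "i \<notin> T"
  shows "(\<Sum>k\<in>insert i T. \<Sum>l\<in>insert i T. D k l :: 'c :: comm_monoid_add)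
    = (\<Sum>k\<in>T. \<Sum>l\<in>T. D k l) + ((\<Sum>l\<in>T. D i l) + (\<Sum>k\<in>T. D k i)) + D i i"
  using assms by (simp add: sum.distrib add_ac)

text \<open>Variance bound by the Hilbert-Schmidt norm. Splitting off the last variable
  \<open>y\<close> leaves \<open>Q + 2 L y + B_ii (y^2 - 1)\<close>, where \<open>Q\<close> and
  \<open>L\<close> do not depend on \<open>y\<close>; conditionally this costs
  \<open>8 L^2 + 2 \<kappa> B_ii^2\<close>, and the second moment of \<open>L\<close> is the sum of
  squares of row \<open>i\<close>.\<close>

lemma quadratic_form_real:
  fixes B :: "'j \<Rightarrow> 'j \<Rightarrow> real"
  assumes "finite T" "inj_on e T" "e ` T \<subseteq> K" "\<And>k l. B k l = B l k"
  shows "integrable P (\<lambda>y. (\<Sum>k\<in>T. \<Sum>l\<in>T. B k l * (y (e k) * y (e l) - (if k = l then 1 else 0)))\<^sup>2) \<and>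
    (\<integral>y. (\<Sum>k\<in>T. \<Sum>l\<in>T. B k l * (y (e k) * y (e l) - (if k = l then 1 else 0)))\<^sup>2 \<partial>P)
      \<le> (8 + 2 * \<kappa>) * (\<Sum>k\<in>T. \<Sum>l\<in>T. (B k l)\<^sup>2)"
  using assms(1-3)
proof (induction T rule: finite_induct)
  case empty
  then show ?case by simp
next
  case (insert i T)
  define Q where "Q = (\<lambda>y. \<Sum>k\<in>T. \<Sum>l\<in>T. B k l * (y (e k) * y (e l) - (if k = l then 1 else 0)))"
  define L where "L = (\<lambda>y. \<Sum>l\<in>T. B i l * y (e l))"
  have ei: "e i \<in> K" and eT: "e ` T \<subseteq> K" and injT: "inj_on e T" using insert.prems by auto
  have eK: "e k \<in> K" if "k \<in> T" for k using that eT by auto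
  note [measurable] = measurable_coord[OF ei] measurable_coord[OF eK]
  have ne: "e l \<noteq> e i" if "l \<in> T" for l using insert that by (auto simp: inj_on_def)
  have IH: "integrable P (\<lambda>y. (Q y)\<^sup>2)" "(\<integral>y. (Q y)\<^sup>2 \<partial>P) \<le> (8 + 2 * \<kappa>) * (\<Sum>k\<in>T. \<Sum>l\<in>T. (B k l)\<^sup>2)"
    using insert.IH[OF injT eT] by (simp_all add: Q_def)
  have L: "integrable P (\<lambda>y. (L y)\<^sup>2)" "(\<integral>y. (L y)\<^sup>2 \<partial>P) = (\<Sum>l\<in>T. (B i l)\<^sup>2)"
    using linear_form_real(3,4)[OF insert.hyps(1) injT eT, of 0 "B i"] by (simp_all add: L_def)
  have sw: "B k i = B i k" if "k \<in> T" for k by (rule assms(4))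
  have dec: "(\<Sum>k\<in>insert i T. \<Sum>l\<in>insert i T. B k l * (y (e k) * y (e l) - (if k = l then 1 else 0)))
     = Q y + 2 * L y * y (e i) + B i i * ((y (e i))\<^sup>2 - 1)" for y
  proof -
    have r: "(\<Sum>l\<in>T. B i l * (y (e i) * y (e l) - (if i = l then 1 else 0))) = L y * y (e i)"
      unfolding L_def sum_distrib_right using insert.hyps(2) by (intro sum.cong) auto
    have c: "(\<Sum>k\<in>T. B k i * (y (e k) * y (e i) - (if k = i then 1 else 0))) = L y * y (e i)"
      unfolding L_def sum_distrib_right using insert.hyps(2) by (intro sum.cong) (auto simp: sw)
    show ?thesis
      unfolding sum_insert_square[OF insert.hyps] r c by (simp add: Q_def power2_eq_square)
  qed
  let ?f = "\<lambda>y. (Q y + 2 * L y * y (e i) + B i i * ((y (e i))\<^sup>2 - 1))\<^sup>2"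
  let ?g = "\<lambda>y. (Q y)\<^sup>2 + 8 * (L y)\<^sup>2 + 2 * \<kappa> * (B i i)\<^sup>2"
  have m: "?f \<in> borel_measurable P" unfolding Q_def L_def by measurable
  have g: "integrable P ?g" using IH(1) L(1) by simp
  have inner: "integrable P (\<lambda>y. ?f (resample {e i} x y)) \<and> (\<integral>y. ?f (resample {e i} x y) \<partial>P) \<le> ?g x" if x: "x \<in> space P" for x
  proof -
    have "Q (resample {e i} x y) = Q x" "L (resample {e i} x y) = L x" for y
      unfolding Q_def L_def resample_def using ne by (auto intro!: sum.cong)
    then have f: "(\<lambda>y. ?f (resample {e i} x y)) = (\<lambda>y. (Q x + 2 * L x * y (e i) + B i i * ((y (e i))\<^sup>2 - 1))\<^sup>2)"
      by (simp add: resample_def)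
    \<comment> \<open>The products with \<open>Q\<close> are kept exactly because they average to
      zero; only the remaining cross term is estimated. Hence \<open>Q^2\<close> keeps coefficient 1
      and the constant does not grow along the induction.\<close>
    let ?h = "\<lambda>y. (Q x)\<^sup>2 + 4 * Q x * L x * y (e i) + 2 * Q x * B i i * ((y (e i))\<^sup>2 - 1) + 8 * (L x)\<^sup>2 * (y (e i))\<^sup>2
       + 2 * (B i i)\<^sup>2 * (y (e i) ^ 4 - 2 * (y (e i))\<^sup>2 + 1)"
    have h: "integrable P ?h" "(\<integral>y. ?h y \<partial>P) = (Q x)\<^sup>2 + 8 * (L x)\<^sup>2 + 2 * (B i i)\<^sup>2 * (\<kappa> - 1)"
      using coord_moments[OF ei] by (simp_all add: P.prob_space)
    have le: "(q + 2 * l * t + b * (t\<^sup>2 - 1))\<^sup>2 \<le> q\<^sup>2 + 4 * q * l * t + 2 * q * b * (t\<^sup>2 - 1) + 8 * l\<^sup>2 * t\<^sup>2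
       + 2 * b\<^sup>2 * (t ^ 4 - 2 * t\<^sup>2 + 1)" for q l b t :: real
    proof -
      have w: "(t\<^sup>2 - 1)\<^sup>2 = t ^ 4 - 2 * t\<^sup>2 + 1"
        by (simp add: power2_diff flip: power_mult)
      have "(q + a + c)\<^sup>2 \<le> q\<^sup>2 + 2 * q * a + 2 * q * c + 2 * a\<^sup>2 + 2 * c\<^sup>2" for a c
        using sum_squares_bound[of a c] by (simp add: power2_sum algebra_simps)
      from this[of "2 * l * t" "b * (t\<^sup>2 - 1)"] show ?thesis
        by (simp add: power_mult_distrib w mult_ac)
    qed
    have i: "integrable P (\<lambda>y. (Q x + 2 * L x * y (e i) + B i i * ((y (e i))\<^sup>2 - 1))\<^sup>2)"
    proof (rule Bochner_Integration.integrable_bound[OF h(1)])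
      show "AE y in P. norm ((Q x + 2 * L x * y (e i) + B i i * ((y (e i))\<^sup>2 - 1))\<^sup>2) \<le> norm (?h y)"
        unfolding real_norm_def abs_power2 by (rule AE_I2) (rule order_trans[OF le abs_ge_self])
    qed measurable
    have "(\<integral>y. (Q x + 2 * L x * y (e i) + B i i * ((y (e i))\<^sup>2 - 1))\<^sup>2 \<partial>P) \<le> (\<integral>y. ?h y \<partial>P)"
      by (rule integral_mono[OF i h(1) le])
    also have "\<dots> \<le> ?g x" unfolding h(2) by (simp add: algebra_simps)
    finally show ?thesis using i unfolding f by simp
  qed
  have f: "integrable P ?f" "integral\<^sup>L P ?f \<le> integral\<^sup>L P ?g"
    using integrable_resample_bound[OF m _ g, of "{e i}"] inner by simp_all
  have "integral\<^sup>L P ?f \<le> (\<integral>y. (Q y)\<^sup>2 \<partial>P) + 8 * (\<Sum>l\<in>T. (B i l)\<^sup>2) + 2 * \<kappa> * (B i i)\<^sup>2"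
    using f(2) IH(1) L by (simp add: P.prob_space)
  also have "\<dots> \<le> (8 + 2 * \<kappa>) * (\<Sum>k\<in>T. \<Sum>l\<in>T. (B k l)\<^sup>2) + 2 * ((8 + 2 * \<kappa>) * (\<Sum>l\<in>T. (B i l)\<^sup>2)) + (8 + 2 * \<kappa>) * (B i i)\<^sup>2"
    using IH(2) kappa_nonneg by (intro add_mono) (auto simp: algebra_simps sum_nonneg)
  also have "\<dots> = (8 + 2 * \<kappa>) * (\<Sum>k\<in>insert i T. \<Sum>l\<in>insert i T. (B k l)\<^sup>2)"
    unfolding sum_insert_square[OF insert.hyps] by (simp add: sw algebra_simps)
  finally show ?case using f(1) unfolding dec by simp
qed

lemma quadratic_form:
  fixes B :: "'j \<Rightarrow> 'j \<Rightarrow> complex"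
  assumes "finite T" "inj_on e T" "e ` T \<subseteq> K" "\<And>k l. B k l = B l k"
  shows "integrable P (\<lambda>y. (cmod (\<Sum>k\<in>T. \<Sum>l\<in>T. B k l * of_real (y (e k) * y (e l) - (if k = l then 1 else 0))))\<^sup>2)"
    and "(\<integral>y. (cmod (\<Sum>k\<in>T. \<Sum>l\<in>T. B k l * of_real (y (e k) * y (e l) - (if k = l then 1 else 0))))\<^sup>2 \<partial>P)
      \<le> (8 + 2 * \<kappa>) * (\<Sum>k\<in>T. \<Sum>l\<in>T. (cmod (B k l))\<^sup>2)"
proof -
  have ex: "(\<lambda>y. (cmod (\<Sum>k\<in>T. \<Sum>l\<in>T. B k l * of_real (y (e k) * y (e l) - (if k = l then 1 else 0))))\<^sup>2) =
    (\<lambda>y. (\<Sum>k\<in>T. \<Sum>l\<in>T. Re (B k l) * (y (e k) * y (e l) - (if k = l then 1 else 0)))\<^sup>2 +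
     (\<Sum>k\<in>T. \<Sum>l\<in>T. Im (B k l) * (y (e k) * y (e l) - (if k = l then 1 else 0)))\<^sup>2)"
    by (simp add: cmod_power2 del: of_real_diff of_real_mult)
  note q = quadratic_form_real[OF assms(1-3), of "\<lambda>k l. Re (B k l)"]
    quadratic_form_real[OF assms(1-3), of "\<lambda>k l. Im (B k l)"]
  show "integrable P (\<lambda>y. (cmod (\<Sum>k\<in>T. \<Sum>l\<in>T. B k l * of_real (y (e k) * y (e l) - (if k = l then 1 else 0))))\<^sup>2)"
    unfolding ex using q assms(4) by (intro Bochner_Integration.integrable_add) auto
  show "(\<integral>y. (cmod (\<Sum>k\<in>T. \<Sum>l\<in>T. B k l * of_real (y (e k) * y (e l) - (if k = l then 1 else 0))))\<^sup>2 \<partial>P)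
      \<le> (8 + 2 * \<kappa>) * (\<Sum>k\<in>T. \<Sum>l\<in>T. (cmod (B k l))\<^sup>2)"
    unfolding ex using q assms(4)
    by (subst Bochner_Integration.integral_add) (auto simp: cmod_power2 sum.distrib ring_distribs intro: add_mono)
qed

end

section \<open>The averaged law\<close>

text \<open>The coordinate that carries the entry at \<open>(i, j)\<close> and its mirror
  image.\<close>

definition up :: "nat \<Rightarrow> nat \<Rightarrow> nat \<times> nat" where
  "up i j = (min i j, max i j)"

lemma up_eq_iff: "up i j = up k l \<longleftrightarrow> (i = k \<and> j = l) \<or> (i = l \<and> j = k)"
  unfolding up_def by (auto simp: min_def max_def split: if_splits)

lemma up_commute: "up i j = up j i"
  by (simp add: up_eq_iff)

lemma up_in_upper_indices: "i < n \<Longrightarrow> j < n \<Longrightarrow> up i j \<in> upper_indices n"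
  by (auto simp: up_def upper_indices_def min_def max_def)

lemma row_subset: "i < n \<Longrightarrow> T \<subseteq> {..<n} \<Longrightarrow> up i ` T \<subseteq> upper_indices n"
  using up_in_upper_indices by blast

lemma inj_on_up: "inj_on (up i) T"
  by (auto simp: inj_on_def up_eq_iff)

lemma finite_upper_indices: "finite (upper_indices n)"
  by (rule finite_subset[of _ "{..<n} \<times> {..<n}"]) (auto simp: upper_indices_def)

definition wigner :: "nat \<Rightarrow> (nat \<times> nat \<Rightarrow> real) \<Rightarrow> nat \<Rightarrow> nat \<Rightarrow> real" where
  "wigner n x i j = x (up i j) / sqrt (real n)"

lemma wigner_sym: "wigner n x i j = wigner n x j i"
  by (simp add: wigner_def up_commute)

lemma wigner_resample:
  "up i k \<notin> J \<Longrightarrow> wigner n (resample J x y) i k = wigner n x i k"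
  "k \<in> T \<Longrightarrow> wigner n (resample (up i ` T) x y) i k = y (up i k) / sqrt (real n)"
  by (auto simp: wigner_def resample_def)

text \<open>The assumption \<open>n_large\<close> keeps the spectral scale at or above n^(-1/2),
  where the error parameter \<open>rho\<close> below is at most 1.\<close>

locale wigner_resolvent = iid_moments \<mu> "upper_indices n" \<kappa> for \<mu> :: "real measure" and n :: nat and \<kappa> :: real +
  fixes z :: complex
  assumes Im_pos: "Im z > 0" and Im_le: "Im z \<le> 1" and n_large: "real n * (Im z)\<^sup>2 \<ge> 1"
begin

abbreviation H where "H \<equiv> wigner n"

abbreviation "\<eta> \<equiv> Im z"

lemma n_pos: "n > 0"
  using n_large by (cases n) auto

lemma n_eta: "real n * \<eta> \<ge> 1"
proof -
  have "real n * \<eta>\<^sup>2 \<le> real n * \<eta>"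
    using Im_pos Im_le by (intro mult_left_mono) (auto simp: power2_eq_square mult_left_le)
  then show ?thesis using n_large by linarith
qed

sublocale res: symmetric_resolvent "H x" z for x
  by standard (simp_all add: wigner_sym Im_pos)

lemma resolvent_resample:
  assumes "\<And>k l. k \<in> S \<Longrightarrow> l \<in> S \<Longrightarrow> up k l \<notin> J"
  shows "resolvent (H (resample J x y)) z S = resolvent (H x) z S"
  by (rule resolvent_cong) (simp add: wigner_def resample_def assms)

text \<open>This expresses the independence of row \<open>i\<close> from minors without
  \<open>i\<close>: resampling that row leaves such minors unchanged.\<close>

lemma row_notin: "i \<notin> S \<Longrightarrow> k \<in> S \<Longrightarrow> l \<in> S \<Longrightarrow> up k l \<notin> up i ` T"
  by (auto simp: up_eq_iff)

lemma res_vec_resample: "i \<notin> S \<Longrightarrow> res_vec (H (resample (up i ` T) x y)) z S u k = res_vec (H x) z S u k"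
  by (simp add: res_vec_def resolvent_resample[OF row_notin])

lemma res_row_resample:
  "i \<notin> S \<Longrightarrow> k \<in> S \<Longrightarrow> res_row (H (resample (up i ` T) x y)) z S u k = res_row (H x) z S u k"
  unfolding res_row_def
  by (intro sum.cong refl) (simp add: res_vec_resample wigner_resample(1) row_notin)

lemma res_trace_resample: "i \<notin> S \<Longrightarrow> res_trace (H (resample (up i ` T) x y)) z S = res_trace (H x) z S"
  by (simp add: res_trace_def resolvent_resample[OF row_notin])

lemma measurable_H[measurable]: "i < n \<Longrightarrow> j < n \<Longrightarrow> (\<lambda>x. H x i j) \<in> borel_measurable P"
  unfolding wigner_def using measurable_coord[OF up_in_upper_indices] by simp

lemma measurable_res:
  assumes "S \<subseteq> {..<n}"
  shows "(\<lambda>x. resolvent (H x) z S k l) \<in> borel_measurable P"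
    "(\<lambda>x. res_vec (H x) z S u k) \<in> borel_measurable P"
    "(\<lambda>x. res_form (H x) z S u) \<in> borel_measurable P"
    "(\<lambda>x. res_trace (H x) z S) \<in> borel_measurable P"
proof -
  have [measurable]: "(\<lambda>x. resolvent (H x) z S k l) \<in> borel_measurable P" for k l
    using assms by (intro measurable_resolvent measurable_H) (auto intro: finite_subset res.symmetric_resolvent_axioms)
  show "(\<lambda>x. resolvent (H x) z S k l) \<in> borel_measurable P"
    "(\<lambda>x. res_vec (H x) z S u k) \<in> borel_measurable P"
    "(\<lambda>x. res_form (H x) z S u) \<in> borel_measurable P"
    "(\<lambda>x. res_trace (H x) z S) \<in> borel_measurable P"
    unfolding res_form_def res_vec_def res_trace_def by measurable
qed

lemma measurable_res_H:
  assumes "S \<subseteq> {..<n}" "i < n"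
  shows "(\<lambda>x. res_vec (H x) z S (H x i) k) \<in> borel_measurable P"
    "(\<lambda>x. res_form (H x) z S (H x i)) \<in> borel_measurable P"
proof -
  note [measurable] = measurable_res(1)[OF assms(1)]
  have [measurable]: "\<And>k. k \<in> S \<Longrightarrow> (\<lambda>x. H x i k) \<in> borel_measurable P"
    using assms by (intro measurable_H) auto
  show "(\<lambda>x. res_vec (H x) z S (H x i) k) \<in> borel_measurable P"
    "(\<lambda>x. res_form (H x) z S (H x i)) \<in> borel_measurable P"
    unfolding res_vec_def res_form_def by measurable
qed

lemma measurable_res_row:
  assumes "S \<subseteq> {..<n}" "i < n"
  shows "(\<lambda>x. res_row (H x) z S u i) \<in> borel_measurable P"
proof -
  have S: "S - {i} \<subseteq> {..<n}" using assms by auto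
  note [measurable] = measurable_res(2)[OF S]
  have [measurable]: "\<And>k. k \<in> S - {i} \<Longrightarrow> (\<lambda>x. H x i k) \<in> borel_measurable P"
    using assms by (intro measurable_H) auto
  show ?thesis unfolding res_row_def by measurable
qed

lemma row_form_resample:
  assumes "\<And>x y k. k \<in> T \<Longrightarrow> w (resample (up i ` T) x y) k = w x k"
  shows "(\<Sum>k\<in>T. of_real (H (resample (up i ` T) x y) i k) * w (resample (up i ` T) x y) k)
    = 0 + (\<Sum>k\<in>T. (w x k / complex_of_real (sqrt (real n))) * of_real (y (up i k)))"
  by (simp add: wigner_resample(2) assms mult.commute)

text \<open>Conditionally on everything outside row \<open>i\<close> the weights are constants, and
  the form has variance the sum of their squares over \<open>n\<close>. The prefactor
  \<open>\<phi>\<close> is there for products such as those in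
  \<open>coupling_moment\<close>.\<close>

lemma row_moment:
  assumes T: "T \<subseteq> {..<n}" "i < n"
    and \<phi>[measurable]: "\<phi> \<in> borel_measurable P" and \<phi>0: "\<And>x. 0 \<le> \<phi> x"
    and w[measurable]: "\<And>k. k \<in> T \<Longrightarrow> (\<lambda>x. w x k) \<in> borel_measurable P"
    and inv: "\<And>x y. \<phi> (resample (up i ` T) x y) = \<phi> x" "\<And>x y k. k \<in> T \<Longrightarrow> w (resample (up i ` T) x y) k = w x k"
    and int: "integrable P (\<lambda>x. \<phi> x * (\<Sum>k\<in>T. (cmod (w x k))\<^sup>2))"
  shows "integrable P (\<lambda>x. \<phi> x * (cmod (\<Sum>k\<in>T. of_real (H x i k) * w x k))\<^sup>2)"
    and "(\<integral>x. \<phi> x * (cmod (\<Sum>k\<in>T. of_real (H x i k) * w x k))\<^sup>2 \<partial>P)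
      \<le> (\<integral>x. \<phi> x * (\<Sum>k\<in>T. (cmod (w x k))\<^sup>2) \<partial>P) / n"
proof -
  have fT: "finite T" using T finite_subset by blast
  have eT: "up i ` T \<subseteq> upper_indices n" using T by (intro row_subset)
  have [measurable]: "\<And>k. k \<in> T \<Longrightarrow> (\<lambda>x. H x i k) \<in> borel_measurable P"
    using T by (intro measurable_H) auto
  let ?f = "\<lambda>x. \<phi> x * (cmod (\<Sum>k\<in>T. of_real (H x i k) * w x k))\<^sup>2"
  let ?g = "\<lambda>x. \<phi> x * (\<Sum>k\<in>T. (cmod (w x k))\<^sup>2) / n"
  have f: "(\<lambda>y. ?f (resample (up i ` T) x y)) =
     (\<lambda>y. \<phi> x * (cmod (0 + (\<Sum>k\<in>T. (w x k / complex_of_real (sqrt (real n))) * of_real (y (up i k)))))\<^sup>2)" for x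
    by (rule ext, subst row_form_resample[of T w]) (simp_all add: inv)
  note lf = linear_form(3,4)[OF fT inj_on_up eT]
  have 1: "integrable P (\<lambda>y. ?f (resample (up i ` T) x y))" for x
    unfolding f using lf(1) by (intro integrable_mult_right) 
  have 2: "(\<integral>y. ?f (resample (up i ` T) x y) \<partial>P) = ?g x" for x
    unfolding f integral_mult_right_zero lf(2)
    using n_pos by (simp add: norm_divide power_divide sum_divide_distrib[symmetric])
  have m: "?f \<in> borel_measurable P" by measurable
  have g: "integrable P ?g" using int by simp
  show "integrable P ?f" "integral\<^sup>L P ?f \<le> integral\<^sup>L P (\<lambda>x. \<phi> x * (\<Sum>k\<in>T. (cmod (w x k))\<^sup>2)) / n"
    using integrable_resample_bound[OF m _ g 1] \<phi>0 2 by simp_all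
qed

text \<open>The source of all cancellation in cross moments: a factor not involving row
  \<open>i\<close> times a linear form in that row.\<close>

lemma row_mean_zero:
  assumes T: "T \<subseteq> {..<n}" "i < n"
    and inv: "\<And>x y. \<phi> (resample (up i ` T) x y) = \<phi> x" "\<And>x y k. k \<in> T \<Longrightarrow> w (resample (up i ` T) x y) k = w x k"
    and int: "integrable P (\<lambda>x. \<phi> x * (\<Sum>k\<in>T. of_real (H x i k) * w x k))"
  shows "(\<integral>x. \<phi> x * (\<Sum>k\<in>T. of_real (H x i k) * w x k) \<partial>P) = (0 :: complex)"
proof -
  have fT: "finite T" using T finite_subset by blast
  have eT: "up i ` T \<subseteq> upper_indices n" using T by (intro row_subset)
  have "(\<lambda>y. \<phi> (resample (up i ` T) x y) * (\<Sum>k\<in>T. of_real (H (resample (up i ` T) x y) i k) * w (resample (up i ` T) x y) k)) =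
     (\<lambda>y. \<phi> x * (0 + (\<Sum>k\<in>T. (w x k / complex_of_real (sqrt (real n))) * of_real (y (up i k)))))" for x
    by (rule ext, subst row_form_resample[of T w]) (simp_all add: inv)
  then show ?thesis
    unfolding integral_resample[OF int, of "up i ` T"]
    by (simp only: integral_mult_right_zero linear_form(2)[OF fT inj_on_up eT]) simp
qed

lemma integrable_bounded:
  fixes f :: "_ \<Rightarrow> 'b::{banach, second_countable_topology}"
  assumes "f \<in> borel_measurable P" "\<And>x. norm (f x) \<le> C"
  shows "integrable P f"
  using assms by (intro P.integrable_const_bound[of _ C]) auto

lemma integrable_res_vec_sq:
  assumes "S \<subseteq> {..<n}"
  shows "integrable P (\<lambda>x. \<Sum>k\<in>S. (cmod (res_vec (H x) z S u k))\<^sup>2)"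
proof (rule integrable_bounded)
  note [measurable] = measurable_res(2)[OF assms]
  show "(\<lambda>x. \<Sum>k\<in>S. (cmod (res_vec (H x) z S u k))\<^sup>2) \<in> borel_measurable P" by measurable
  show "norm (\<Sum>k\<in>S. (cmod (res_vec (H x) z S u k))\<^sup>2) \<le> (\<Sum>k\<in>S. (u k)\<^sup>2) / \<eta>\<^sup>2" for x
    using res.res_vec_bound[OF finite_subset[OF assms]] by (simp add: sum_nonneg)
qed

lemma integrable_res_form:
  assumes "S \<subseteq> {..<n}"
  shows "integrable P (\<lambda>x. res_form (H x) z S u)"
  by (rule integrable_bounded[OF measurable_res(3)[OF assms] res.res_form_bound[OF finite_subset[OF assms]]]) simp

lemma integrable_res_trace:
  assumes "S \<subseteq> {..<n}"
  shows "integrable P (\<lambda>x. res_trace (H x) z S)"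
  by (rule integrable_bounded[OF measurable_res(4)[OF assms] res.norm_res_trace[OF finite_subset[OF assms]]]) simp

text \<open>The conditional variance is the sum of squares of \<open>G u\<close> on the minor, and
  Ward turns it into the imaginary part of the form.\<close>

lemma res_row_moment:
  assumes "S \<subseteq> {..<n}" "i \<in> S"
  shows "integrable P (\<lambda>x. (cmod (res_row (H x) z S u i))\<^sup>2)"
    and "(\<integral>x. (cmod (res_row (H x) z S u i))\<^sup>2 \<partial>P) \<le> (\<integral>x. Im (res_form (H x) z (S - {i}) u) \<partial>P) / (n * \<eta>)"
proof -
  have S: "S - {i} \<subseteq> {..<n}" and i: "i < n" using assms by auto
  note r = row_moment[OF S i, of "\<lambda>_. 1" "\<lambda>x. res_vec (H x) z (S - {i}) u"]
  have p: "integrable P (\<lambda>x. (cmod (res_row (H x) z S u i))\<^sup>2) \<and> (\<integral>x. (cmod (res_row (H x) z S u i))\<^sup>2 \<partial>P)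
     \<le> (\<integral>x. (\<Sum>k\<in>S - {i}. (cmod (res_vec (H x) z (S - {i}) u k))\<^sup>2) \<partial>P) / n"
    unfolding res_row_def
    using r measurable_res(2)[OF S] integrable_res_vec_sq[OF S]
    by (simp add: res_vec_resample)
  then show "integrable P (\<lambda>x. (cmod (res_row (H x) z S u i))\<^sup>2)" by simp
  have "Im (res_form (H x) z (S - {i}) u) = \<eta> * (\<Sum>k\<in>S - {i}. (cmod (res_vec (H x) z (S - {i}) u k))\<^sup>2)" for x
    using res.Im_res_form[OF finite_subset[OF S]] by simp
  then show "(\<integral>x. (cmod (res_row (H x) z S u i))\<^sup>2 \<partial>P) \<le> (\<integral>x. Im (res_form (H x) z (S - {i}) u) \<partial>P) / (n * \<eta>)"
    using p Im_pos by simp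
qed

text \<open>Deviation of the Schur complement from \<open>- (z + s)\<close>. The trace is taken over
  \<open>S\<close> itself, index \<open>i\<close> included, so that \<open>s\<close> does not depend
  on \<open>i\<close>; it is divided by \<open>n\<close> for every minor, so that all minors are
  comparable.\<close>

definition schur_error :: "nat set \<Rightarrow> nat \<Rightarrow> (nat \<times> nat \<Rightarrow> real) \<Rightarrow> complex" where
  "schur_error S i x = of_real (H x i i) - (res_form (H x) z (S - {i}) (H x i) - res_trace (H x) z S / n)"

lemma resolvent_diag_error:
  assumes "S \<subseteq> {..<n}" "i \<in> S"
  shows "resolvent (H x) z S i i * (- (z + res_trace (H x) z S / n) + schur_error S i x) = 1"
  using res.resolvent_diag_mult[OF finite_subset[OF assms(1)] assms(2), of x]
  by (simp add: schur_error_def algebra_simps)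

definition mean_Im_trace :: "nat set \<Rightarrow> real" where
  "mean_Im_trace S = (\<integral>x. Im (res_trace (H x) z S) / n \<partial>P)"

lemma mean_Im_trace_nonneg: "S \<subseteq> {..<n} \<Longrightarrow> 0 \<le> mean_Im_trace S"
  unfolding mean_Im_trace_def
  by (intro integral_nonneg_AE AE_I2 divide_nonneg_nonneg res.Im_res_trace_nonneg) (auto intro: finite_subset)

lemma mean_Im_trace_remove:
  assumes "S \<subseteq> {..<n}" "i \<in> S"
  shows "\<bar>mean_Im_trace S - mean_Im_trace (S - {i})\<bar> \<le> 1 / (n * \<eta>)"
proof -
  have S: "S - {i} \<subseteq> {..<n}" using assms by auto
  note i = integrable_res_trace[OF assms(1)] integrable_res_trace[OF S]
  have "\<bar>Im (res_trace (H x) z S) / n - Im (res_trace (H x) z (S - {i})) / n\<bar> \<le> 1 / (n * \<eta>)" for x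
  proof -
    have "\<bar>Im (res_trace (H x) z S) - Im (res_trace (H x) z (S - {i}))\<bar> \<le> 1 / \<eta>"
      using res.norm_res_trace_diff[OF finite_subset[OF assms(1)] assms(2), of x]
        abs_Im_le_cmod[of "res_trace (H x) z S - res_trace (H x) z (S - {i})"] by simp
    then have "\<bar>Im (res_trace (H x) z S) - Im (res_trace (H x) z (S - {i}))\<bar> / n \<le> 1 / \<eta> / n"
      by (rule divide_right_mono) simp
    then show ?thesis by (simp add: diff_divide_distrib[symmetric] mult.commute)
  qed
  then have "\<bar>\<integral>x. Im (res_trace (H x) z S) / n - Im (res_trace (H x) z (S - {i})) / n \<partial>P\<bar> \<le> (\<integral>x. 1 / (n * \<eta>) \<partial>P)"
    using i by (intro order_trans[OF integral_abs_bound] integral_mono) auto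
  then show ?thesis
    using i by (simp add: mean_Im_trace_def P.prob_space)
qed

text \<open>Conditionally on the minor this is \<open>quadratic_form\<close> with matrix
  \<open>G / n\<close>, whose Hilbert-Schmidt norm Ward converts into the imaginary part of the
  trace.\<close>

lemma schur_form_moment:
  assumes "S \<subseteq> {..<n}" "i \<in> S"
  shows "integrable P (\<lambda>x. (cmod (res_form (H x) z (S - {i}) (H x i) - res_trace (H x) z (S - {i}) / n))\<^sup>2)"
    and "(\<integral>x. (cmod (res_form (H x) z (S - {i}) (H x i) - res_trace (H x) z (S - {i}) / n))\<^sup>2 \<partial>P)
      \<le> (8 + 2 * \<kappa>) / (n * \<eta>) * mean_Im_trace (S - {i})"
proof -
  let ?T = "S - {i}"
  have T: "?T \<subseteq> {..<n}" and i: "i < n" and fT: "finite ?T" using assms finite_subset by auto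
  have eT: "up i ` ?T \<subseteq> upper_indices n" using T i by (intro row_subset)
  note [measurable] = measurable_res_H(2)[OF T i] measurable_res(4)[OF T]
  let ?f = "\<lambda>x. (cmod (res_form (H x) z ?T (H x i) - res_trace (H x) z ?T / n))\<^sup>2"
  let ?g = "\<lambda>x. (8 + 2 * \<kappa>) / (n * \<eta>) * (Im (res_trace (H x) z ?T) / n)"
  have m: "?f \<in> borel_measurable P" by measurable
  have g: "integrable P ?g" using integrable_res_trace[OF T] by simp
  have 1: "integrable P (\<lambda>y. ?f (resample (up i ` ?T) x y)) \<and> (\<integral>y. ?f (resample (up i ` ?T) x y) \<partial>P) \<le> ?g x" for x
  proof -
    let ?B = "\<lambda>k l. resolvent (H x) z ?T k l / n"
    have f: "(\<lambda>y. ?f (resample (up i ` ?T) x y)) =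
      (\<lambda>y. (cmod (\<Sum>k\<in>?T. \<Sum>l\<in>?T. ?B k l * of_real (y (up i k) * y (up i l) - (if k = l then 1 else 0))))\<^sup>2)"
    proof
      fix y
      let ?x = "resample (up i ` ?T) x y"
      have rr: "resolvent (H ?x) z ?T = resolvent (H x) z ?T"
        by (rule resolvent_resample) (auto simp: up_eq_iff)
      have r: "res_vec (H ?x) z ?T (H ?x i) k = (\<Sum>l\<in>?T. resolvent (H x) z ?T k l * of_real (y (up i l) / sqrt n))" for k
        unfolding res_vec_def rr by (intro sum.cong refl) (simp add: wigner_resample(2))
      have sq: "complex_of_real (a / sqrt n) * (g * complex_of_real (b / sqrt n)) = g / n * complex_of_real (a * b)" for a b g
      proof -
        have "complex_of_real (a / sqrt n) * (g * complex_of_real (b / sqrt n))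
            = g * complex_of_real (a * b) / complex_of_real (sqrt n * sqrt n)"
          by (simp only: of_real_divide of_real_mult times_divide_eq_left times_divide_eq_right divide_divide_eq_left mult_ac)
        moreover have "sqrt (real n) * sqrt (real n) = real n" by simp
        ultimately show ?thesis by (simp only: of_real_of_nat_eq times_divide_eq_left)
      qed
      have "res_form (H ?x) z ?T (H ?x i) = (\<Sum>k\<in>?T. \<Sum>l\<in>?T. ?B k l * of_real (y (up i k) * y (up i l)))"
        unfolding res_form_def r sum_distrib_left
        by (intro sum.cong refl) (simp only: wigner_resample(2) sq)
      \<comment> \<open>The normalised trace supplies the diagonal subtraction in the quadratic
        form, since it is its conditional mean.\<close>
      moreover have "(\<Sum>l\<in>?T. ?B k l * of_real (if k = l then 1 else 0)) = resolvent (H x) z ?T k k / n" if "k \<in> ?T" for k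
      proof -
        have "(\<Sum>l\<in>?T. ?B k l * of_real (if k = l then 1 else 0)) = (\<Sum>l\<in>?T. if k = l then ?B k l else 0)"
          by (intro sum.cong) auto
        then show ?thesis using fT that by simp
      qed
      then have "res_trace (H ?x) z ?T / n = (\<Sum>k\<in>?T. \<Sum>l\<in>?T. ?B k l * of_real (if k = l then 1 else 0))"
        by (simp add: res_trace_def sum_divide_distrib rr)
      ultimately have "res_form (H ?x) z ?T (H ?x i) - res_trace (H ?x) z ?T / n
        = (\<Sum>k\<in>?T. \<Sum>l\<in>?T. ?B k l * of_real (y (up i k) * y (up i l) - (if k = l then 1 else 0)))"
        by (simp only: sum_subtractf[symmetric] right_diff_distrib[symmetric] of_real_diff[symmetric])
      then show "?f ?x = (cmod (\<Sum>k\<in>?T. \<Sum>l\<in>?T. ?B k l * of_real (y (up i k) * y (up i l) - (if k = l then 1 else 0))))\<^sup>2"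
        by simp
    qed
    have sB: "?B k l = ?B l k" for k l using res.resolvent_sym[OF fT, of x k l] by simp
    have "(\<Sum>k\<in>?T. \<Sum>l\<in>?T. (cmod (resolvent (H x) z ?T k l))\<^sup>2) = Im (res_trace (H x) z ?T) / \<eta>"
      using res.sum_norm_resolvent[OF fT, of x] by (subst sum.swap)
    then have "(8 + 2 * \<kappa>) * (\<Sum>k\<in>?T. \<Sum>l\<in>?T. (cmod (?B k l))\<^sup>2) = ?g x"
      by (simp add: norm_divide power_divide sum_divide_distrib[symmetric]) (simp add: power2_eq_square)
    then show ?thesis
      unfolding f using quadratic_form[OF fT inj_on_up eT, of ?B, OF sB] by simp
  qed
  have f: "integrable P ?f" "integral\<^sup>L P ?f \<le> integral\<^sup>L P ?g"
    using integrable_resample_bound[OF m _ g, of "up i ` ?T"] 1 by simp_all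
  then show "integrable P ?f" by simp
  show "integral\<^sup>L P ?f \<le> (8 + 2 * \<kappa>) / (n * \<eta>) * mean_Im_trace ?T"
    using f(2) unfolding mean_Im_trace_def integral_mult_right_zero .
qed

end

text \<open>For real \<open>z = - 2 Re m\<close> the quadratic has roots \<open>m\<close> and
  \<open>cnj m\<close>, because \<open>m\<close> has modulus 1. As \<open>Im s >= 0\<close>, the
  distance from \<open>s\<close> to \<open>cnj m\<close> is at least \<open>Im m\<close>, so a small
  defect forces \<open>s\<close> close to \<open>m\<close>. The last term pays for moving
  \<open>z\<close> off the real point.\<close>

lemma semicircle_stability:
  assumes "Im m > 0" "cmod m = 1" "Im s \<ge> 0"
  shows "Im m * cmod (s - m) \<le> cmod (1 + z * s + s\<^sup>2) + cmod (z + of_real (2 * Re m)) * cmod s"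
proof -
  have m: "m * cnj m = 1" using assms(2) by (simp flip: complex_norm_square)
  have m2: "m + cnj m = 2 * Re m" by (simp add: complex_add_cnj)
  have "(s - m) * (s - cnj m) = s\<^sup>2 - (m + cnj m) * s + m * cnj m"
    by (simp add: power2_eq_square algebra_simps)
  also have "\<dots> = (1 + z * s + s\<^sup>2) - (z + 2 * Re m) * s"
    unfolding m m2 by (simp add: algebra_simps)
  finally have e: "(s - m) * (s - cnj m) = (1 + z * s + s\<^sup>2) - (z + 2 * Re m) * s" .
  have "Im m \<le> Im (s - cnj m)" using assms by simp
  also have "\<dots> \<le> cmod (s - cnj m)" using abs_Im_le_cmod[of "s - cnj m"] by linarith
  finally have "Im m * cmod (s - m) \<le> cmod (s - cnj m) * cmod (s - m)"
    by (rule mult_right_mono) simp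
  also have "\<dots> = cmod ((s - m) * (s - cnj m))" by (simp add: norm_mult mult.commute)
  also have "\<dots> \<le> cmod (1 + z * s + s\<^sup>2) + cmod ((z + 2 * Re m) * s)" unfolding e by (rule norm_triangle_ineq4)
  finally show ?thesis by (simp add: norm_mult)
qed

lemma sum3_squared_le: "(a + b + c)\<^sup>2 \<le> 3 * (a\<^sup>2 + b\<^sup>2 + c\<^sup>2)" for a b c :: real
  using sum_squares_bound[of a b] sum_squares_bound[of b c] sum_squares_bound[of a c]
  by (simp add: power2_eq_square algebra_simps)

lemma weighted_am_gm:
  assumes "(r::real) > 0"
  shows "a * b \<le> (a\<^sup>2 / r + r * b\<^sup>2) / 2"
proof -
  have "0 \<le> (a - r * b)\<^sup>2 / r" using assms by simp
  then show ?thesis using assms by (simp add: power2_diff power_mult_distrib field_simps power2_eq_square)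
qed

section \<open>The self-consistent equation for the trace\<close>

context wigner_resolvent
begin

lemma integrable_le:
  assumes "integrable P g" "f \<in> borel_measurable P" "\<And>x. 0 \<le> f x" "\<And>x. f x \<le> (g x :: real)"
  shows "integrable P f"
  by (rule Bochner_Integration.integrable_bound[OF assms(1,2)])
     (simp add: assms(3,4) order_trans[OF assms(4) abs_ge_self])

text \<open>The error parameter of the whole argument; on the scale of the theorem it decays like a
  negative power of \<open>n\<close>.\<close>

definition rho :: real where "rho = 1 / (sqrt n * \<eta>)"

lemma rho_pos: "rho > 0"
  using n_pos Im_pos by (simp add: rho_def)

lemma rho_sq: "rho\<^sup>2 = 1 / (n * \<eta>\<^sup>2)"
  by (simp add: rho_def power_divide power_mult_distrib)

text \<open>From \<open>schur_error_moment\<close>: three terms cost a factor 3, two of them are at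
  most \<open>1 / (n \<eta>)\<close>, the third carries \<open>8 + 2 \<kappa>\<close>, and 6 + 3 (8
  + 2 \<kappa>) = 30 + 6 \<kappa>.\<close>

definition C1 :: real where "C1 = 30 + 6 * \<kappa>"

lemma C1_ge: "C1 \<ge> 30" using kappa_nonneg by (simp add: C1_def)

text \<open>Three contributions, namely the diagonal entry, the fluctuation of the quadratic form,
  and the change of the trace when \<open>i\<close> is removed. Each has second moment of order
  \<open>1 / (n \<eta>)\<close>, up to the mean trace.\<close>

lemma schur_error_moment:
  assumes "S \<subseteq> {..<n}" "i \<in> S"
  shows "integrable P (\<lambda>x. (cmod (schur_error S i x))\<^sup>2)"
    and "(\<integral>x. (cmod (schur_error S i x))\<^sup>2 \<partial>P) \<le> C1 * (1 + mean_Im_trace S) / (n * \<eta>)"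
proof -
  let ?T = "S - {i}"
  have T: "?T \<subseteq> {..<n}" and i: "i < n" and fS: "finite S" using assms finite_subset by auto
  note [measurable] = measurable_res_H(2)[OF T i] measurable_res(4)[OF T] measurable_res(4)[OF assms(1)] measurable_H[OF i i]
  let ?q = "\<lambda>x. res_form (H x) z ?T (H x i) - res_trace (H x) z ?T / n"
  let ?d = "\<lambda>x. (res_trace (H x) z S - res_trace (H x) z ?T) / n"
  have H2: "integrable P (\<lambda>x. (H x i i)\<^sup>2)" "(\<integral>x. (H x i i)\<^sup>2 \<partial>P) = 1 / n"
    using coord_moments(2,5)[OF up_in_upper_indices[OF i i]] by (simp_all add: wigner_def power_divide)
  have d: "cmod (?d x) \<le> 1 / (n * \<eta>)" for x
  proof -
    have "cmod (?d x) \<le> (1 / \<eta>) / n"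
      using divide_right_mono[OF res.norm_res_trace_diff[OF fS assms(2), of x], of n] by (simp add: norm_divide)
    then show ?thesis by (simp add: mult.commute)
  qed
  let ?g = "\<lambda>x. 3 * ((H x i i)\<^sup>2 + (cmod (?q x))\<^sup>2 + (1 / (n * \<eta>))\<^sup>2)"
  have le: "(cmod (schur_error S i x))\<^sup>2 \<le> ?g x" for x
  proof -
    have e: "schur_error S i x = of_real (H x i i) - ?q x + ?d x"
      by (simp add: schur_error_def diff_divide_distrib)
    have "cmod (schur_error S i x) \<le> \<bar>H x i i\<bar> + cmod (?q x) + cmod (?d x)"
      unfolding e using norm_triangle_ineq[of "of_real (H x i i) - ?q x" "?d x"]
        norm_triangle_ineq4[of "of_real (H x i i)" "?q x"] norm_of_real[of "H x i i", where 'a = complex] by linarith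
    also have "\<dots> \<le> \<bar>H x i i\<bar> + cmod (?q x) + 1 / (n * \<eta>)" using d by simp
    finally have "(cmod (schur_error S i x))\<^sup>2 \<le> (\<bar>H x i i\<bar> + cmod (?q x) + 1 / (n * \<eta>))\<^sup>2"
      by (rule power_mono) simp
    also have "\<dots> \<le> ?g x"
      using sum3_squared_le[of "\<bar>H x i i\<bar>" "cmod (?q x)" "1 / (n * \<eta>)"] by (simp only: power2_abs)
    finally show ?thesis .
  qed
  note q = schur_form_moment[OF assms]
  have g: "integrable P ?g" using H2(1) q(1) by simp
  have m: "schur_error S i \<in> borel_measurable P" unfolding schur_error_def[abs_def] by measurable
  show i: "integrable P (\<lambda>x. (cmod (schur_error S i x))\<^sup>2)"
    by (rule integrable_le[OF g _ _ le]) (use m in simp_all)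
  have "(\<integral>x. (cmod (schur_error S i x))\<^sup>2 \<partial>P) \<le> integral\<^sup>L P ?g"
    by (rule integral_mono[OF i g le])
  also have "\<dots> = 3 * (1 / n + (\<integral>x. (cmod (?q x))\<^sup>2 \<partial>P) + (1 / (n * \<eta>))\<^sup>2)"
    using H2 q(1) by (simp add: P.prob_space)
  also have "\<dots> \<le> 3 * (1 / (n * \<eta>) + (8 + 2 * \<kappa>) / (n * \<eta>) * (mean_Im_trace S + 1) + 1 / (n * \<eta>))"
  proof (intro mult_left_mono add_mono)
    have "n * \<eta> \<le> n" using Im_le n_pos by (simp add: mult_left_le)
    then show "1 / real n \<le> 1 / (n * \<eta>)" using n_eta by (simp add: frac_le)
    have "1 / (n * \<eta>) \<le> 1" using n_eta by simp
    then show "(1 / (n * \<eta>))\<^sup>2 \<le> 1 / (n * \<eta>)" using n_eta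
      by (simp add: power2_eq_square mult_left_le_one_le del: times_divide_eq_left times_divide_eq_right divide_le_eq_1)
    have "mean_Im_trace ?T \<le> mean_Im_trace S + 1"
      using mean_Im_trace_remove[OF assms] \<open>1 / (n * \<eta>) \<le> 1\<close> by linarith
    then have "(8 + 2 * \<kappa>) / (n * \<eta>) * mean_Im_trace ?T \<le> (8 + 2 * \<kappa>) / (n * \<eta>) * (mean_Im_trace S + 1)"
      using kappa_nonneg n_eta by (intro mult_left_mono) auto
    with q(2) show "(\<integral>x. (cmod (?q x))\<^sup>2 \<partial>P) \<le> (8 + 2 * \<kappa>) / (n * \<eta>) * (mean_Im_trace S + 1)" by linarith
  qed auto
  also have "\<dots> = (3 * (2 + (8 + 2 * \<kappa>) * (mean_Im_trace S + 1))) / (n * \<eta>)"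
    by (simp add: add_divide_distrib algebra_simps)
  also have "\<dots> \<le> C1 * (1 + mean_Im_trace S) / (n * \<eta>)"
    using n_eta mean_Im_trace_nonneg[OF assms(1)] by (intro divide_right_mono) (simp_all add: C1_def algebra_simps)
  finally show "(\<integral>x. (cmod (schur_error S i x))\<^sup>2 \<partial>P) \<le> C1 * (1 + mean_Im_trace S) / (n * \<eta>)" .
qed

text \<open>Shared by the trace and the form: products of a resolvent quantity with a Schur error.
  The weight \<open>sqrt n\<close> balances a sum of squares of order \<open>1 / \<eta>\<close>
  against errors of order \<open>1 / (n \<eta>)\<close>; both sides become multiples of
  \<open>rho\<close>.\<close>

lemma sum_schur_error:
  assumes S: "S \<subseteq> {..<n}" and w: "\<And>i. i \<in> S \<Longrightarrow> 0 \<le> w i" and W: "(\<Sum>i\<in>S. w i) \<le> 1"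
    and b: "integrable P b" and f: "f \<in> borel_measurable P"
    and le: "\<And>x. f x \<le> (b x / sqrt n + sqrt n * (\<Sum>i\<in>S. w i * (cmod (schur_error S i x))\<^sup>2)) / 2"
    and f0: "\<And>x. 0 \<le> f x"
    and B: "integral\<^sup>L P b \<le> B / \<eta>"
  shows "integrable P f" "integral\<^sup>L P f \<le> rho * (B + C1 * (1 + mean_Im_trace S)) / 2"
proof -
  let ?E = "\<lambda>x. \<Sum>i\<in>S. w i * (cmod (schur_error S i x))\<^sup>2"
  have E: "integrable P ?E" using schur_error_moment(1)[OF S] by auto
  have "integral\<^sup>L P ?E = (\<Sum>i\<in>S. w i * (\<integral>x. (cmod (schur_error S i x))\<^sup>2 \<partial>P))"
    using schur_error_moment(1)[OF S] by simp
  also have "\<dots> \<le> (\<Sum>i\<in>S. w i * (C1 * (1 + mean_Im_trace S) / (n * \<eta>)))"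
    by (intro sum_mono mult_left_mono schur_error_moment(2)[OF S] w)
  also have "\<dots> \<le> 1 * (C1 * (1 + mean_Im_trace S) / (n * \<eta>))"
    unfolding sum_distrib_right[symmetric] using W n_eta C1_ge mean_Im_trace_nonneg[OF S]
    by (intro mult_right_mono) auto
  finally have EE: "integral\<^sup>L P ?E \<le> C1 * (1 + mean_Im_trace S) / (n * \<eta>)" by simp
  let ?g = "\<lambda>x. (b x / sqrt n + sqrt n * ?E x) / 2"
  have g: "integrable P ?g" using b E by simp
  show i: "integrable P f"
    by (rule integrable_le[OF g f f0 le])
  have "integral\<^sup>L P f \<le> integral\<^sup>L P ?g" by (rule integral_mono[OF i g le])
  also have "\<dots> = (integral\<^sup>L P b / sqrt n + sqrt n * integral\<^sup>L P ?E) / 2" using b E by simp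
  also have "\<dots> \<le> ((B / \<eta>) / sqrt n + sqrt n * (C1 * (1 + mean_Im_trace S) / (n * \<eta>))) / 2"
    using B EE by (intro divide_right_mono add_mono mult_left_mono) auto
  also have "\<dots> = rho * (B + C1 * (1 + mean_Im_trace S)) / 2"
  proof -
    have "sqrt n / (n * \<eta>) = rho"
      using n_pos Im_pos by (simp add: rho_def field_simps)
    then have "sqrt n * (D / (n * \<eta>)) = rho * D" for D
      by (metis times_divide_eq_left times_divide_eq_right)
    moreover have "(B / \<eta>) / sqrt n = rho * B" by (simp add: rho_def mult.commute)
    ultimately show ?thesis by (simp only: ring_distribs)
  qed
  finally show "integral\<^sup>L P f \<le> rho * (B + C1 * (1 + mean_Im_trace S)) / 2" .
qed

definition stieltjes :: "(nat \<times> nat \<Rightarrow> real) \<Rightarrow> complex" where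
  "stieltjes x = res_trace (H x) z {..<n} / of_nat n"

lemma integrable_stieltjes: "integrable P stieltjes"
  unfolding stieltjes_def[abs_def] using integrable_res_trace[of "{..<n}"] by simp

lemma Im_stieltjes_nonneg: "0 \<le> Im (stieltjes x)"
  using res.Im_res_trace_nonneg[of "{..<n}" x] by (simp add: stieltjes_def)

lemma mean_Im_stieltjes: "mean_Im_trace {..<n} = (\<integral>x. Im (stieltjes x) \<partial>P)"
  by (simp add: mean_Im_trace_def stieltjes_def)

text \<open>Averaging \<open>G_ii (- (z + s) + error_i) = 1\<close> over \<open>i\<close> identifies
  the defect of the quadratic equation as the mean of \<open>G_ii error_i\<close>.\<close>

lemma trace_defect:
  shows "(\<integral>x. cmod (1 + z * stieltjes x + (stieltjes x)\<^sup>2) \<partial>P) \<le> C1 * rho * (1 + mean_Im_trace {..<n})"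
    and "integrable P (\<lambda>x. cmod (1 + z * stieltjes x + (stieltjes x)\<^sup>2))"
proof -
  let ?S = "{..<n}" and ?a = "mean_Im_trace {..<n}"
  have S: "?S \<subseteq> {..<n}" by simp
  note [measurable] = measurable_res(4)[OF S]
  let ?G = "\<lambda>x i. resolvent (H x) z ?S i i"
  have e: "1 + z * stieltjes x + (stieltjes x)\<^sup>2 = (\<Sum>i\<in>?S. ?G x i * schur_error ?S i x) / n" for x
  proof -
    have "(\<Sum>i\<in>?S. ?G x i * (- (z + stieltjes x) + schur_error ?S i x)) = (\<Sum>i\<in>?S. 1)"
      unfolding stieltjes_def by (intro sum.cong refl resolvent_diag_error[OF S])
    moreover have "(\<Sum>i\<in>?S. ?G x i * (- (z + stieltjes x) + schur_error ?S i x))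
       = (\<Sum>i\<in>?S. ?G x i) * - (z + stieltjes x) + (\<Sum>i\<in>?S. ?G x i * schur_error ?S i x)"
      by (simp only: distrib_left sum.distrib sum_distrib_right)
    moreover have "(\<Sum>i\<in>?S. ?G x i) = n * stieltjes x"
      using n_pos by (simp add: stieltjes_def res_trace_def)
    ultimately show ?thesis using n_pos by (simp add: field_simps power2_eq_square)
  qed
  have le: "cmod (1 + z * stieltjes x + (stieltjes x)\<^sup>2) \<le> (Im (res_trace (H x) z ?S) / n / \<eta> / sqrt n
      + sqrt n * (\<Sum>i\<in>?S. (1 / n) * (cmod (schur_error ?S i x))\<^sup>2)) / 2" for x
  proof -
    have "cmod (1 + z * stieltjes x + (stieltjes x)\<^sup>2) \<le> (\<Sum>i\<in>?S. cmod (?G x i) * cmod (schur_error ?S i x)) / n"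
      unfolding e by (simp add: norm_divide divide_right_mono sum_norm_le norm_mult)
    also have "\<dots> \<le> (\<Sum>i\<in>?S. ((cmod (?G x i))\<^sup>2 / sqrt n + sqrt n * (cmod (schur_error ?S i x))\<^sup>2) / 2) / n"
      using n_pos by (intro divide_right_mono sum_mono weighted_am_gm) auto
    also have "\<dots> = ((\<Sum>i\<in>?S. (cmod (?G x i))\<^sup>2) / n / sqrt n + sqrt n * (\<Sum>i\<in>?S. (1 / n) * (cmod (schur_error ?S i x))\<^sup>2)) / 2"
      by (simp add: sum.distrib sum_divide_distrib sum_distrib_left add_divide_distrib mult_ac)
    also have "\<dots> \<le> ((Im (res_trace (H x) z ?S) / \<eta>) / n / sqrt n + sqrt n * (\<Sum>i\<in>?S. (1 / n) * (cmod (schur_error ?S i x))\<^sup>2)) / 2"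
      using res.sum_norm_diag_sq[of ?S x] by (intro divide_right_mono add_right_mono) auto
    finally show ?thesis by (simp add: mult.commute)
  qed
  have b: "integrable P (\<lambda>x. Im (res_trace (H x) z ?S) / n / \<eta>)" using integrable_res_trace[OF S] by simp
  have B: "(\<integral>x. Im (res_trace (H x) z ?S) / n / \<eta> \<partial>P) \<le> ?a / \<eta>"
    by (simp add: mean_Im_trace_def)
  have m: "(\<lambda>x. cmod (1 + z * stieltjes x + (stieltjes x)\<^sup>2)) \<in> borel_measurable P" unfolding stieltjes_def by measurable
  note * = sum_schur_error[OF S, of "\<lambda>_. 1 / n", OF _ _ b m le _ B]
  show "integrable P (\<lambda>x. cmod (1 + z * stieltjes x + (stieltjes x)\<^sup>2))" using * n_pos by simp
  have "(\<integral>x. cmod (1 + z * stieltjes x + (stieltjes x)\<^sup>2) \<partial>P) \<le> rho * (?a + C1 * (1 + ?a)) / 2"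
    using * n_pos by simp
  also have "\<dots> \<le> C1 * rho * (1 + ?a)"
  proof -
    have "?a \<le> C1 * (1 + ?a)"
      using C1_ge mean_Im_trace_nonneg[OF S] mult_mono[of 1 C1 "?a" "1 + ?a"] by simp
    then have "rho * (?a + C1 * (1 + ?a)) \<le> rho * (2 * (C1 * (1 + ?a)))"
      using rho_pos by (intro mult_left_mono) auto
    then show ?thesis by (simp add: algebra_simps)
  qed
  finally show "(\<integral>x. cmod (1 + z * stieltjes x + (stieltjes x)\<^sup>2) \<partial>P) \<le> C1 * rho * (1 + ?a)" .
qed

text \<open>Stability bounds the mean distance by the defect, which is in turn bounded in terms of
  the mean distance; \<open>small\<close> makes the feedback factor at most
  \<open>Im m / 2\<close>.\<close>

lemma trace_law:
  assumes m: "Im m > 0" "cmod m = 1" and small: "C1 * rho + cmod (z + of_real (2 * Re m)) \<le> Im m / 2"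
  shows "(\<integral>x. cmod (stieltjes x - m) \<partial>P) \<le> 2 / Im m * (2 * C1 * rho + cmod (z + of_real (2 * Re m)))"
    and "mean_Im_trace {..<n} \<le> 1 + (\<integral>x. cmod (stieltjes x - m) \<partial>P)"
proof -
  let ?a = "mean_Im_trace {..<n}" and ?d = "\<integral>x. cmod (stieltjes x - m) \<partial>P"
  define w where "w = cmod (z + of_real (2 * Re m))"
  have w0: "w \<ge> 0" by (simp add: w_def)
  have i1: "integrable P (\<lambda>x. cmod (stieltjes x - m))"
    using integrable_stieltjes by (intro integrable_norm) simp
  have i2: "integrable P (\<lambda>x. cmod (stieltjes x))"
    using integrable_stieltjes by (rule integrable_norm)
  have i3: "integrable P (\<lambda>x. Im (stieltjes x))"
    using integrable_stieltjes by simp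
  have s_le: "cmod (stieltjes x) \<le> 1 + cmod (stieltjes x - m)" for x
    using norm_triangle_ineq[of "stieltjes x - m" m] m(2) by simp
  have "(\<integral>x. cmod (stieltjes x) \<partial>P) \<le> (\<integral>x. 1 + cmod (stieltjes x - m) \<partial>P)"
    by (rule integral_mono[OF i2 _ s_le]) (simp add: i1)
  then have Es: "(\<integral>x. cmod (stieltjes x) \<partial>P) \<le> 1 + ?d"
    using i1 by (simp add: P.prob_space)
  have "?a \<le> (\<integral>x. cmod (stieltjes x) \<partial>P)"
    unfolding mean_Im_stieltjes
    by (rule integral_mono[OF i3 i2]) (rule order_trans[OF abs_ge_self abs_Im_le_cmod])
  with Es have a: "?a \<le> 1 + ?d" by linarith
  have "Im m * ?d = (\<integral>x. Im m * cmod (stieltjes x - m) \<partial>P)" by simp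
  also have "\<dots> \<le> (\<integral>x. cmod (1 + z * stieltjes x + (stieltjes x)\<^sup>2) + w * cmod (stieltjes x) \<partial>P)"
    unfolding w_def
    by (rule integral_mono[OF _ _ semicircle_stability[OF m Im_stieltjes_nonneg]])
       (use i1 i2 trace_defect(2) in simp_all)
  also have "\<dots> = (\<integral>x. cmod (1 + z * stieltjes x + (stieltjes x)\<^sup>2) \<partial>P) + w * (\<integral>x. cmod (stieltjes x) \<partial>P)"
    using i2 trace_defect(2) by simp
  also have "\<dots> \<le> C1 * rho * (1 + (1 + ?d)) + w * (1 + ?d)"
  proof (rule add_mono)
    have "C1 * rho \<ge> 0" using C1_ge rho_pos by simp
    then show "(\<integral>x. cmod (1 + z * stieltjes x + (stieltjes x)\<^sup>2) \<partial>P) \<le> C1 * rho * (1 + (1 + ?d))"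
      using a by (intro order_trans[OF trace_defect(1)] mult_left_mono) auto
    show "w * (\<integral>x. cmod (stieltjes x) \<partial>P) \<le> w * (1 + ?d)"
      by (rule mult_left_mono[OF Es w0])
  qed
  also have "\<dots> = (2 * C1 * rho + w) + (C1 * rho + w) * ?d"
    by (simp add: algebra_simps)
  finally have "Im m * ?d \<le> (2 * C1 * rho + w) + (C1 * rho + w) * ?d" .
  \<comment> \<open>Absorption into the left side; it is legitimate because the deterministic bound
    on the trace makes the mean distance finite.\<close>
  moreover have "(C1 * rho + w) * ?d \<le> Im m / 2 * ?d"
    using small by (intro mult_right_mono integral_nonneg_AE) (simp_all add: w_def)
  ultimately have "Im m * ?d \<le> (2 * C1 * rho + w) + Im m / 2 * ?d" by linarith
  then show "?d \<le> 2 / Im m * (2 * C1 * rho + cmod (z + of_real (2 * Re m)))"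
    using m(1) unfolding w_def[symmetric] by (simp add: field_simps)
  show "?a \<le> 1 + ?d" by (rule a)
qed

end

section \<open>The isotropic law\<close>

lemma (in symmetric_resolvent) res_bilinear_sym:
  "finite S \<Longrightarrow> (\<Sum>k\<in>S. of_real (u k) * res_vec H z S v k) = (\<Sum>k\<in>S. of_real (v k) * res_vec H z S u k)"
  unfolding res_vec_def sum_distrib_left
  by (subst sum.swap) (simp add: resolvent_sym[of S] mult_ac cong: sum.cong)

context wigner_resolvent
begin

text \<open>The bootstrapped quantity. Its a priori bound is \<open>1 / \<eta>\<close>, and the goal
  is a bound independent of \<open>n\<close>.\<close>

definition mean_Im_form :: "nat set \<Rightarrow> (nat \<Rightarrow> real) \<Rightarrow> real" where
  "mean_Im_form S u = (\<integral>x. Im (res_form (H x) z S u) \<partial>P)"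

lemma mean_res_vec_sq:
  assumes "S \<subseteq> {..<n}"
  shows "(\<integral>x. (\<Sum>k\<in>S. (cmod (res_vec (H x) z S u k))\<^sup>2) \<partial>P) = mean_Im_form S u / \<eta>"
  unfolding mean_Im_form_def using res.Im_res_form[OF finite_subset[OF assms]] Im_pos by simp

lemma mean_Im_form_nonneg: "S \<subseteq> {..<n} \<Longrightarrow> 0 \<le> mean_Im_form S u"
  unfolding mean_Im_form_def
  by (intro integral_nonneg_AE AE_I2 res.Im_res_form_nonneg) (auto intro: finite_subset)

lemma mean_Im_form_le:
  assumes "S \<subseteq> {..<n}" "(\<Sum>k\<in>S. (u k)\<^sup>2) \<le> 1"
  shows "mean_Im_form S u \<le> 1 / \<eta>"
proof -
  have "Im (res_form (H x) z S u) \<le> 1 / \<eta>" for x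
    using abs_Im_le_cmod[of "res_form (H x) z S u"] res.res_form_bound[OF finite_subset[OF assms(1) finite_lessThan], of x u]
      divide_right_mono[OF assms(2) less_imp_le[OF Im_pos]] by linarith
  then have "mean_Im_form S u \<le> (\<integral>x. 1 / \<eta> \<partial>P)"
    unfolding mean_Im_form_def using integrable_res_form[OF assms(1)] by (intro integral_mono) auto
  then show ?thesis by (simp add: P.prob_space)
qed

text \<open>The off-diagonal entry of the Schur complement for the pair of indices \<open>i\<close>
  and \<open>j\<close>.\<close>

definition row_coupling :: "nat set \<Rightarrow> nat \<Rightarrow> nat \<Rightarrow> (nat \<times> nat \<Rightarrow> real) \<Rightarrow> complex" where
  "row_coupling S i j x = of_real (H x i j) - (\<Sum>k\<in>S - {i, j}. of_real (H x i k) * res_vec (H x) z (S - {i, j}) (H x j) k)"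

lemma row_coupling_commute: "finite S \<Longrightarrow> row_coupling S i j x = row_coupling S j i x"
  using res.res_bilinear_sym[of "S - {i, j}" "H x i" x "H x j"]
  by (simp add: row_coupling_def wigner_sym[of n x i j] insert_commute)

text \<open>By symmetry the coupling is also a linear form in row \<open>j\<close>, with weights
  that do not see that row. The weights are \<open>(1, - c)\<close>, whose squares
  \<open>norm_resolvent_diag_schur\<close> controls.\<close>

lemma row_coupling_row:
  assumes "finite S" "i \<in> S" "j \<in> S" "i \<noteq> j"
  shows "row_coupling S i j x = (\<Sum>k\<in>S - {j}. of_real (H x j k) * (if k = i then 1 else - res_vec (H x) z (S - {i, j}) (H x i) k))"
proof -
  have e: "S - {j} - {i} = S - {i, j}" by auto
  have "(\<Sum>k\<in>S - {j}. of_real (H x j k) * (if k = i then 1 else - res_vec (H x) z (S - {i, j}) (H x i) k))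
    = of_real (H x j i) + (\<Sum>k\<in>S - {i, j}. - (of_real (H x j k) * res_vec (H x) z (S - {i, j}) (H x i) k))"
    using assms by (subst sum.remove[of _ i]) (auto simp: e)
  also have "\<dots> = row_coupling S j i x"
    by (simp add: row_coupling_def sum_negf insert_commute)
  finally show ?thesis using row_coupling_commute[OF assms(1)] by simp
qed

lemma res_row_split:
  assumes "finite S" "i \<in> S" "j \<in> S" "i \<noteq> j"
  shows "res_row (H x) z S u i = res_row (H x) z (S - {j}) u i + res_vec (H x) z (S - {i}) u j * row_coupling S i j x"
  using res.res_row_remove[OF assms] by (simp add: row_coupling_def)

lemma res_vec_weight_resample:
  assumes "k \<in> S" "i \<in> S" "j \<notin> S" "T \<subseteq> S"
  shows "res_vec (H (resample (up j ` U) x y)) z T (H (resample (up j ` U) x y) i) k = res_vec (H x) z T (H x i) k"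
proof (rule res_vec_cong)
  show "H (resample (up j ` U) x y) i k = H x i k" if "k \<in> T" for k
    using that assms by (intro wigner_resample(1)) (auto simp: up_eq_iff)
  show "H (resample (up j ` U) x y) k l = H x k l" if "k \<in> T" "l \<in> T" for k l
    using that assms by (intro wigner_resample(1)) (auto simp: up_eq_iff)
qed

text \<open>Row \<open>j\<close> is integrated out first, with \<open>|(G u)_i|^2\<close> as
  prefactor. The weights then have square sum \<open>1 + |c|^2\<close>, which the diagonal entry
  hidden in \<open>(G u)_i\<close> absorbs at the cost of one factor
  \<open>1 / \<eta>\<close>.\<close>

lemma coupling_moment:
  assumes S: "S \<subseteq> {..<n}" and ij: "i \<in> S" "j \<in> S" "i \<noteq> j"
  shows "integrable P (\<lambda>x. (cmod (res_vec (H x) z (S - {j}) u i))\<^sup>2 * (cmod (row_coupling S i j x))\<^sup>2)"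
    and "(\<integral>x. (cmod (res_vec (H x) z (S - {j}) u i))\<^sup>2 * (cmod (row_coupling S i j x))\<^sup>2 \<partial>P)
      \<le> (\<integral>x. (cmod (res_vec (H x) z (S - {j}) u i))\<^sup>2 + (2 * (u i)\<^sup>2 + 2 * (cmod (res_row (H x) z (S - {j}) u i))\<^sup>2) \<partial>P) / (2 * (n * \<eta>))"
proof -
  let ?S = "S - {j}" and ?T = "S - {i, j}"
  have fS: "finite S" using S finite_subset by blast
  have e: "?S - {i} = ?T" by auto
  have S': "?S \<subseteq> {..<n}" and T: "?T \<subseteq> {..<n}" and j: "j < n" and i: "i < n" and iS: "i \<in> ?S" and fS': "finite ?S"
    using S ij fS by auto
  let ?Y = "\<lambda>x. res_vec (H x) z ?S u i" and ?a = "\<lambda>x. res_row (H x) z ?S u i"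
  let ?w = "\<lambda>x k. if k = i then 1 else - res_vec (H x) z ?T (H x i) k"
  let ?f = "\<lambda>x. (cmod (?Y x))\<^sup>2 * (\<Sum>k\<in>?S. (cmod (?w x k))\<^sup>2)"
  let ?g = "\<lambda>x. ((cmod (?Y x))\<^sup>2 + (2 * (u i)\<^sup>2 + 2 * (cmod (?a x))\<^sup>2)) / (2 * \<eta>)"
  note [measurable] = measurable_res(2)[OF S'] measurable_res_H(1)[OF T i]
  have wm: "(\<lambda>x. ?w x k) \<in> borel_measurable P" for k by measurable
  have le: "?f x \<le> ?g x" for x
  proof -
    let ?G = "resolvent (H x) z ?S i i"
    have W: "(\<Sum>k\<in>?S. (cmod (?w x k))\<^sup>2) = 1 + (\<Sum>k\<in>?T. (cmod (res_vec (H x) z ?T (H x i) k))\<^sup>2)"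
      using fS' iS by (subst sum.remove[of _ i]) (auto simp: e intro!: sum.cong)
    have Y: "cmod (?Y x) = cmod ?G * cmod (of_real (u i) - ?a x)"
      using res.res_vec_diag[OF fS' iS, of x u] by (simp add: norm_mult)
    have G: "cmod ?G * (\<eta> * (\<Sum>k\<in>?S. (cmod (?w x k))\<^sup>2)) \<le> 1"
      unfolding W using res.norm_resolvent_diag_schur[OF fS' iS, of x] by (simp add: e)
    \<comment> \<open>Only one of the two factors \<open>|Y|\<close> is expanded by
      \<open>res_vec_diag\<close>; its diagonal entry meets the sum of weights in the form required
      by \<open>G\<close>.\<close>
    have "\<eta> * ?f x = (cmod ?G * (\<eta> * (\<Sum>k\<in>?S. (cmod (?w x k))\<^sup>2))) * (cmod (?Y x) * cmod (of_real (u i) - ?a x))"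
      by (simp add: Y power2_eq_square mult_ac)
    also have "\<dots> \<le> 1 * (cmod (?Y x) * cmod (of_real (u i) - ?a x))"
      by (intro mult_right_mono G) auto
    also have "\<dots> \<le> ((cmod (?Y x))\<^sup>2 + (cmod (of_real (u i) - ?a x))\<^sup>2) / 2"
      using sum_squares_bound[of "cmod (?Y x)" "cmod (of_real (u i) - ?a x)"] by simp
    also have "(cmod (of_real (u i) - ?a x))\<^sup>2 \<le> 2 * (u i)\<^sup>2 + 2 * (cmod (?a x))\<^sup>2"
    proof -
      have "(cmod (of_real (u i) - ?a x))\<^sup>2 \<le> (\<bar>u i\<bar> + cmod (?a x))\<^sup>2"
        using norm_triangle_ineq4[of "of_real (u i)" "?a x"] by (intro power_mono) simp_all
      also have "\<dots> \<le> 2 * (u i)\<^sup>2 + 2 * (cmod (?a x))\<^sup>2"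
        using sum_squares_bound[of "\<bar>u i\<bar>" "cmod (?a x)"] by (simp add: power2_sum)
      finally show ?thesis .
    qed
    finally have "\<eta> * ?f x \<le> ((cmod (?Y x))\<^sup>2 + (2 * (u i)\<^sup>2 + 2 * (cmod (?a x))\<^sup>2)) / 2" by simp
    then show ?thesis using Im_pos by (simp add: field_simps)
  qed
  have iY: "integrable P (\<lambda>x. (cmod (?Y x))\<^sup>2)"
  proof (rule integrable_le[OF integrable_res_vec_sq[OF S', of u]])
    show "(cmod (?Y x))\<^sup>2 \<le> (\<Sum>k\<in>?S. (cmod (res_vec (H x) z ?S u k))\<^sup>2)" for x
      using member_le_sum[of i ?S "\<lambda>k. (cmod (res_vec (H x) z ?S u k))\<^sup>2"] iS fS' by simp
  qed (use iS in auto)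
  have g: "integrable P ?g" using iY res_row_moment(1)[OF S' iS, of u] by simp
  have f0: "0 \<le> ?f x" for x by (simp add: sum_nonneg)
  have fm: "?f \<in> borel_measurable P" by measurable
  have f: "integrable P ?f" by (rule integrable_le[OF g fm f0 le])
  have wr: "?w (resample (up j ` ?S) x y) k = ?w x k" if "k \<in> ?S" for x y k
    using that iS by (auto intro!: res_vec_weight_resample[of k ?S])
  have Yr: "(cmod (?Y (resample (up j ` ?S) x y)))\<^sup>2 = (cmod (?Y x))\<^sup>2" for x y
    by (simp add: res_vec_resample)
  have Ym: "(\<lambda>x. (cmod (?Y x))\<^sup>2) \<in> borel_measurable P" by measurable
  have Y0: "0 \<le> (cmod (?Y x))\<^sup>2" for x by simp
  note r = row_moment[OF S' j Ym Y0 wm Yr wr f]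
  show "integrable P (\<lambda>x. (cmod (?Y x))\<^sup>2 * (cmod (row_coupling S i j x))\<^sup>2)"
    using r(1) unfolding row_coupling_row[OF fS ij] .
  have "(\<integral>x. (cmod (?Y x))\<^sup>2 * (cmod (row_coupling S i j x))\<^sup>2 \<partial>P) \<le> integral\<^sup>L P ?f / n"
    using r(2) unfolding row_coupling_row[OF fS ij] .
  also have "\<dots> \<le> integral\<^sup>L P ?g / n" by (intro divide_right_mono integral_mono f g le) simp
  also have "\<dots> = (\<integral>x. (cmod (?Y x))\<^sup>2 + (2 * (u i)\<^sup>2 + 2 * (cmod (?a x))\<^sup>2) \<partial>P) / (2 * (n * \<eta>))"
    by (simp add: mult_ac)
  finally show "(\<integral>x. (cmod (?Y x))\<^sup>2 * (cmod (row_coupling S i j x))\<^sup>2 \<partial>P)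
      \<le> (\<integral>x. (cmod (?Y x))\<^sup>2 + (2 * (u i)\<^sup>2 + 2 * (cmod (?a x))\<^sup>2) \<partial>P) / (2 * (n * \<eta>))" .
qed

lemma measurable_cnj[measurable]: "cnj \<in> borel_measurable borel"
  by (intro borel_measurable_continuous_onI continuous_intros)

lemma integrable_mult_cnj:
  fixes f g :: "_ \<Rightarrow> complex"
  assumes [measurable]: "f \<in> borel_measurable P" "g \<in> borel_measurable P"
    and "integrable P (\<lambda>x. (cmod (f x))\<^sup>2)" "integrable P (\<lambda>x. (cmod (g x))\<^sup>2)"
  shows "integrable P (\<lambda>x. f x * cnj (g x))"
proof (rule Bochner_Integration.integrable_bound)
  show "integrable P (\<lambda>x. (cmod (f x))\<^sup>2 + (cmod (g x))\<^sup>2)" using assms by simp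
  show "(\<lambda>x. f x * cnj (g x)) \<in> borel_measurable P" by measurable
  have "cmod (f x * cnj (g x)) \<le> (cmod (f x))\<^sup>2 + (cmod (g x))\<^sup>2" for x
    using sum_squares_bound[of "cmod (f x)" "cmod (g x)"] mult_nonneg_nonneg[OF norm_ge_zero norm_ge_zero, of "f x" "g x"]
    unfolding norm_mult complex_mod_cnj by linarith
  then show "AE x in P. norm (f x * cnj (g x)) \<le> norm ((cmod (f x))\<^sup>2 + (cmod (g x))\<^sup>2)" by simp
qed

text \<open>Write \<open>a = \<alpha> + Yj g\<close> and \<open>b = \<beta> + Yi g\<close>, where
  \<open>\<alpha>\<close> does not see row \<open>j\<close> and \<open>\<beta>\<close> does not see
  row \<open>i\<close>. All products except that of the two coupling terms have mean zero.\<close>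

lemma row_pair_moment:
  assumes S: "S \<subseteq> {..<n}" and ij: "i \<in> S" "j \<in> S" "i \<noteq> j"
  shows "u i * u j * Re (\<integral>x. res_row (H x) z S u i * cnj (res_row (H x) z S u j) \<partial>P) \<le>
    ((u j)\<^sup>2 * (\<integral>x. (cmod (res_vec (H x) z (S - {j}) u i))\<^sup>2 * (cmod (row_coupling S i j x))\<^sup>2 \<partial>P)
     + (u i)\<^sup>2 * (\<integral>x. (cmod (res_vec (H x) z (S - {i}) u j))\<^sup>2 * (cmod (row_coupling S j i x))\<^sup>2 \<partial>P)) / 2"
proof -
  have fS: "finite S" using S finite_subset by blast
  have ji: "j \<in> S" "i \<in> S" "j \<noteq> i" using ij by auto
  have Sj: "S - {j} \<subseteq> {..<n}" and Si: "S - {i} \<subseteq> {..<n}" and T: "S - {i, j} \<subseteq> {..<n}" and i: "i < n" and j: "j < n"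
    using S ij by auto
  have iSj: "i \<in> S - {j}" and jSi: "j \<in> S - {i}" using ij by auto
  define a where "a = (\<lambda>x. res_row (H x) z S u i)"
  define b where "b = (\<lambda>x. res_row (H x) z S u j)"
  define \<alpha> where "\<alpha> = (\<lambda>x. res_row (H x) z (S - {j}) u i)"
  define \<beta> where "\<beta> = (\<lambda>x. res_row (H x) z (S - {i}) u j)"
  define Yi where "Yi = (\<lambda>x. res_vec (H x) z (S - {j}) u i)"
  define Yj where "Yj = (\<lambda>x. res_vec (H x) z (S - {i}) u j)"
  define g where "g = (\<lambda>x. row_coupling S i j x)"
  have g': "row_coupling S j i x = g x" for x unfolding g_def by (rule row_coupling_commute[OF fS])
  have a: "a x = \<alpha> x + Yj x * g x" for x
    unfolding a_def \<alpha>_def Yj_def g_def by (rule res_row_split[OF fS ij])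
  have b: "b x = \<beta> x + Yi x * g x" for x
    unfolding b_def \<beta>_def Yi_def g'[symmetric] by (rule res_row_split[OF fS ji])
  have ma: "a \<in> borel_measurable P" and mb: "b \<in> borel_measurable P" and m\<alpha>: "\<alpha> \<in> borel_measurable P"
    and m\<beta>: "\<beta> \<in> borel_measurable P" and mYi: "Yi \<in> borel_measurable P" and mYj: "Yj \<in> borel_measurable P"
    unfolding a_def b_def \<alpha>_def \<beta>_def Yi_def Yj_def
    by (intro measurable_res_row measurable_res(2) S Si Sj i j)+
  have mg: "g \<in> borel_measurable P"
  proof -
    note [measurable] = measurable_res_H(1)[OF T j] measurable_H[OF i j]
    have [measurable]: "\<And>k. k \<in> S - {i, j} \<Longrightarrow> (\<lambda>x. H x i k) \<in> borel_measurable P"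
      using T i by (intro measurable_H) auto
    show ?thesis unfolding g_def row_coupling_def by measurable
  qed
  have ia: "integrable P (\<lambda>x. (cmod (a x))\<^sup>2)" and ib: "integrable P (\<lambda>x. (cmod (b x))\<^sup>2)"
    and i\<alpha>: "integrable P (\<lambda>x. (cmod (\<alpha> x))\<^sup>2)" and i\<beta>: "integrable P (\<lambda>x. (cmod (\<beta> x))\<^sup>2)"
    unfolding a_def b_def \<alpha>_def \<beta>_def
    by (intro res_row_moment(1) S Si Sj ij iSj jSi)+
  have iYi: "integrable P (\<lambda>x. (cmod (Yi x))\<^sup>2 * (cmod (g x))\<^sup>2)"
    unfolding Yi_def g_def by (rule coupling_moment(1)[OF S ij])
  have iYj: "integrable P (\<lambda>x. (cmod (Yj x))\<^sup>2 * (cmod (g x))\<^sup>2)"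
    unfolding Yj_def g'[symmetric] by (rule coupling_moment(1)[OF S ji])
  have mYg: "(\<lambda>x. Yi x * g x) \<in> borel_measurable P" "(\<lambda>x. Yj x * g x) \<in> borel_measurable P"
    using mYi mYj mg by simp_all
  have iYg: "integrable P (\<lambda>x. (cmod (Yi x * g x))\<^sup>2)" "integrable P (\<lambda>x. (cmod (Yj x * g x))\<^sup>2)"
    using iYi iYj by (simp_all add: norm_mult power_mult_distrib)
  \<comment> \<open>Integrate row \<open>j\<close>: \<open>b\<close> is linear in it and
    \<open>\<alpha>\<close> is free of it.\<close>
  have z1: "(\<integral>x. cnj (\<alpha> x) * b x \<partial>P) = 0"
    unfolding b_def res_row_def
  proof (rule row_mean_zero[OF Sj j])
    show "cnj (\<alpha> (resample (up j ` (S - {j})) x y)) = cnj (\<alpha> x)" for x y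
      using iSj by (simp add: \<alpha>_def res_row_resample)
    show "res_vec (H (resample (up j ` (S - {j})) x y)) z (S - {j}) u k = res_vec (H x) z (S - {j}) u k" for x y k
      by (simp add: res_vec_resample)
    show "integrable P (\<lambda>x. cnj (\<alpha> x) * (\<Sum>k\<in>S - {j}. of_real (H x j k) * res_vec (H x) z (S - {j}) u k))"
      unfolding res_row_def[symmetric]
      using integrable_mult_cnj[OF mb m\<alpha> ib i\<alpha>] by (simp add: b_def mult.commute)
  qed
  \<comment> \<open>Integrate row \<open>i\<close>: the coupling is read as a linear form in that
    row, while \<open>Yj\<close> and \<open>\<beta>\<close> live on the minor without
    \<open>i\<close>.\<close>
  have z2: "(\<integral>x. (Yj x * cnj (\<beta> x)) * g x \<partial>P) = 0"
    unfolding g'[symmetric] row_coupling_row[OF fS ji]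
  proof (rule row_mean_zero[OF Si i])
    show "Yj (resample (up i ` (S - {i})) x y) * cnj (\<beta> (resample (up i ` (S - {i})) x y)) = Yj x * cnj (\<beta> x)" for x y
      using jSi by (simp add: \<beta>_def Yj_def res_row_resample res_vec_resample)
    show "(if k = j then 1 else - res_vec (H (resample (up i ` (S - {i})) x y)) z (S - {j, i}) (H (resample (up i ` (S - {i})) x y) j) k)
      = (if k = j then 1 else - res_vec (H x) z (S - {j, i}) (H x j) k)" if "k \<in> S - {i}" for x y k
      using that jSi by (auto intro!: res_vec_weight_resample[of k "S - {i}"])
    have "integrable P (\<lambda>x. (Yj x * g x) * cnj (\<beta> x))"
      by (rule integrable_mult_cnj[OF mYg(2) m\<beta> iYg(2) i\<beta>])
    then show "integrable P (\<lambda>x. Yj x * cnj (\<beta> x) * (\<Sum>k\<in>S - {i}. of_real (H x i k) * (if k = j then 1 else - res_vec (H x) z (S - {j, i}) (H x j) k)))"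
      unfolding row_coupling_row[OF fS ji, symmetric] g' by (simp add: mult_ac)
  qed
  have I1: "integrable P (\<lambda>x. \<alpha> x * cnj (b x))"
    by (rule integrable_mult_cnj[OF m\<alpha> mb i\<alpha> ib])
  have z1': "(\<integral>x. \<alpha> x * cnj (b x) \<partial>P) = 0"
    using integral_bounded_linear[OF bounded_linear_cnj I1] z1 by simp
  have I2: "integrable P (\<lambda>x. (Yj x * cnj (\<beta> x)) * g x)"
    using integrable_mult_cnj[OF mYg(2) m\<beta> iYg(2) i\<beta>] by (simp add: mult_ac)
  define h where "h = (\<lambda>x. (Yj x * g x) * cnj (Yi x * g x))"
  have I3: "integrable P h"
    unfolding h_def by (rule integrable_mult_cnj[OF mYg(2) mYg(1) iYg(2) iYg(1)])
  have "a x * cnj (b x) = \<alpha> x * cnj (b x) + (Yj x * cnj (\<beta> x)) * g x + h x" for x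
    unfolding a b h_def by (simp add: algebra_simps)
  then have ab: "(\<integral>x. a x * cnj (b x) \<partial>P) = integral\<^sup>L P h"
    using I1 I2 I3 z1' z2 by simp
  define A where "A = (\<lambda>x. (cmod (Yi x))\<^sup>2 * (cmod (g x))\<^sup>2)"
  define B where "B = (\<lambda>x. (cmod (Yj x))\<^sup>2 * (cmod (g x))\<^sup>2)"
  \<comment> \<open>The pairing is crosswise: the square of \<open>u j\<close> stays with
    \<open>Yi\<close>. Summing over \<open>i\<close> then gives an unweighted sum of
    \<open>|Yi|^2\<close>, a Ward sum, and the outer weights add up to at most 1.\<close>
  have le: "u i * u j * Re (h x) \<le> ((u j)\<^sup>2 * A x + (u i)\<^sup>2 * B x) / 2" for x
  proof -
    have "u i * u j * Re (h x) \<le> \<bar>u i * u j\<bar> * \<bar>Re (h x)\<bar>"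
      by (metis abs_ge_self abs_mult)
    also have "\<dots> \<le> \<bar>u i * u j\<bar> * cmod (h x)"
      by (intro mult_left_mono abs_Re_le_cmod) simp
    also have "\<dots> = (\<bar>u j\<bar> * cmod (Yi x) * cmod (g x)) * (\<bar>u i\<bar> * cmod (Yj x) * cmod (g x))"
      by (simp add: h_def norm_mult abs_mult mult_ac)
    also have "\<dots> \<le> ((\<bar>u j\<bar> * cmod (Yi x) * cmod (g x))\<^sup>2 + (\<bar>u i\<bar> * cmod (Yj x) * cmod (g x))\<^sup>2) / 2"
      using sum_squares_bound[of "\<bar>u j\<bar> * cmod (Yi x) * cmod (g x)" "\<bar>u i\<bar> * cmod (Yj x) * cmod (g x)"] by simp
    finally show ?thesis by (simp add: A_def B_def power_mult_distrib mult.assoc)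
  qed
  have AB: "integrable P A" "integrable P B" using iYi iYj by (simp_all add: A_def B_def)
  have "u i * u j * Re (\<integral>x. a x * cnj (b x) \<partial>P) = (\<integral>x. u i * u j * Re (h x) \<partial>P)"
    unfolding ab using I3 by simp
  also have "\<dots> \<le> (\<integral>x. ((u j)\<^sup>2 * A x + (u i)\<^sup>2 * B x) / 2 \<partial>P)"
    by (rule integral_mono[OF _ _ le]) (use I3 AB in simp_all)
  also have "\<dots> = ((u j)\<^sup>2 * integral\<^sup>L P A + (u i)\<^sup>2 * integral\<^sup>L P B) / 2"
    using AB by simp
  finally show ?thesis unfolding a_def b_def A_def B_def Yi_def Yj_def g' unfolding g_def .
qed

end

lemma (in symmetric_resolvent) norm_res_trace_diff_set:
  assumes "finite S" "R \<subseteq> S"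
  shows "cmod (res_trace H z S - res_trace H z (S - R)) \<le> card R / Im z"
proof -
  have "finite R" using assms finite_subset by blast
  then show ?thesis using assms(2)
  proof (induction R rule: finite_induct)
    case empty
    then show ?case by simp
  next
    case (insert i R)
    have i: "i \<in> S - R" using insert by auto
    have "cmod (res_trace H z (S - R) - res_trace H z (S - R - {i})) \<le> 1 / Im z"
      using norm_res_trace_diff[OF _ i] assms(1) by simp
    moreover have "S - insert i R = S - R - {i}" by auto
    moreover have "cmod (res_trace H z S - res_trace H z (S - R - {i}))
       \<le> cmod (res_trace H z S - res_trace H z (S - R)) + cmod (res_trace H z (S - R) - res_trace H z (S - R - {i}))"
      using norm_triangle_ineq[of "res_trace H z S - res_trace H z (S - R)" "res_trace H z (S - R) - res_trace H z (S - R - {i})"] by simp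
    ultimately show ?case using insert by (simp add: add_divide_distrib)
  qed
qed

context wigner_resolvent
begin

text \<open>The linear remainder of the isotropic equation; its second moment needs the cancellation
  between different rows.\<close>

definition row_sum :: "nat set \<Rightarrow> (nat \<Rightarrow> real) \<Rightarrow> (nat \<times> nat \<Rightarrow> real) \<Rightarrow> complex" where
  "row_sum S u x = (\<Sum>i\<in>S. of_real (u i) * res_row (H x) z S u i)"

definition error_sum :: "nat set \<Rightarrow> (nat \<Rightarrow> real) \<Rightarrow> (nat \<times> nat \<Rightarrow> real) \<Rightarrow> complex" where
  "error_sum S u x = (\<Sum>i\<in>S. of_real (u i) * (schur_error S i x * res_vec (H x) z S u i))"

lemma res_form_identity:
  assumes "S \<subseteq> {..<n}"
  shows "- (z + res_trace (H x) z S / n) * res_form (H x) z S u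
    = of_real (\<Sum>i\<in>S. (u i)\<^sup>2) - row_sum S u x - error_sum S u x"
proof -
  have fS: "finite S" using assms finite_subset by blast
  let ?s = "z + res_trace (H x) z S / n" and ?y = "res_vec (H x) z S u"
  have "- ?s * ?y i = of_real (u i) - res_row (H x) z S u i - schur_error S i x * ?y i" if "i \<in> S" for i
  proof -
    have "?y i * (- ?s + schur_error S i x) = (resolvent (H x) z S i i * (- ?s + schur_error S i x)) * (of_real (u i) - res_row (H x) z S u i)"
      using res.res_vec_diag[OF fS that, of x u] by simp
    also have "\<dots> = of_real (u i) - res_row (H x) z S u i"
      using resolvent_diag_error[OF assms that, of x] by simp
    finally show ?thesis by (simp add: algebra_simps)
  qed
  then have "- ?s * res_form (H x) z S u = (\<Sum>i\<in>S. of_real (u i) * (of_real (u i) - res_row (H x) z S u i - schur_error S i x * ?y i))"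
    unfolding res_form_def sum_distrib_left by (intro sum.cong refl) (metis mult.left_commute)
  also have "\<dots> = of_real (\<Sum>i\<in>S. (u i)\<^sup>2) - row_sum S u x - error_sum S u x"
    by (simp add: row_sum_def error_sum_def right_diff_distrib sum_subtractf power2_eq_square)
  finally show ?thesis .
qed

lemma measurable_sums:
  assumes S: "S \<subseteq> {..<n}"
  shows "row_sum S u \<in> borel_measurable P" "error_sum S u \<in> borel_measurable P"
proof -
  have 1: "\<And>i. i \<in> S \<Longrightarrow> (\<lambda>x. res_row (H x) z S u i) \<in> borel_measurable P"
    using S by (intro measurable_res_row) auto
  have 2: "\<And>i. i \<in> S \<Longrightarrow> schur_error S i \<in> borel_measurable P"
  proof -
    fix i assume "i \<in> S"
    then have i: "i < n" and T: "S - {i} \<subseteq> {..<n}" using S by auto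
    note [measurable] = measurable_H[OF i i] measurable_res_H(2)[OF T i] measurable_res(4)[OF S]
    show "schur_error S i \<in> borel_measurable P" unfolding schur_error_def[abs_def] by measurable
  qed
  note [measurable] = measurable_res(2)[OF S]
  show "row_sum S u \<in> borel_measurable P" unfolding row_sum_def[abs_def] using 1 by measurable
  show "error_sum S u \<in> borel_measurable P" unfolding error_sum_def[abs_def] using 2 by measurable
qed

text \<open>Here the sum of squares in \<open>sum_schur_error\<close> is that of \<open>G u\<close>,
  so \<open>mean_Im_form\<close> of the same minor reappears on the right.\<close>

lemma error_sum_moment:
  assumes S: "S \<subseteq> {..<n}" and u: "(\<Sum>i\<in>S. (u i)\<^sup>2) \<le> 1"
  shows "integrable P (\<lambda>x. cmod (error_sum S u x))"
    "(\<integral>x. cmod (error_sum S u x) \<partial>P) \<le> rho * (mean_Im_form S u + C1 * (1 + mean_Im_trace S)) / 2"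
proof -
  let ?b = "\<lambda>x. \<Sum>i\<in>S. (cmod (res_vec (H x) z S u i))\<^sup>2"
  have le: "cmod (error_sum S u x) \<le> (?b x / sqrt n + sqrt n * (\<Sum>i\<in>S. (u i)\<^sup>2 * (cmod (schur_error S i x))\<^sup>2)) / 2" for x
  proof -
    have "cmod (error_sum S u x) \<le> (\<Sum>i\<in>S. cmod (res_vec (H x) z S u i) * (\<bar>u i\<bar> * cmod (schur_error S i x)))"
      unfolding error_sum_def by (rule sum_norm_le) (simp add: norm_mult mult_ac)
    also have "\<dots> \<le> (\<Sum>i\<in>S. ((cmod (res_vec (H x) z S u i))\<^sup>2 / sqrt n + sqrt n * (\<bar>u i\<bar> * cmod (schur_error S i x))\<^sup>2) / 2)"
      using n_pos by (intro sum_mono weighted_am_gm) simp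
    also have "\<dots> = (?b x / sqrt n + sqrt n * (\<Sum>i\<in>S. (u i)\<^sup>2 * (cmod (schur_error S i x))\<^sup>2)) / 2"
      by (simp add: sum_divide_distrib[symmetric] sum.distrib sum_distrib_left power_mult_distrib)
    finally show ?thesis .
  qed
  have m: "(\<lambda>x. cmod (error_sum S u x)) \<in> borel_measurable P" using measurable_sums(2)[OF S] by simp
  note * = sum_schur_error[OF S _ u integrable_res_vec_sq[OF S] m le norm_ge_zero]
  show "integrable P (\<lambda>x. cmod (error_sum S u x))"
    by (rule *(1)[of "mean_Im_form S u"]) (simp_all add: mean_res_vec_sq[OF S])
  show "(\<integral>x. cmod (error_sum S u x) \<partial>P) \<le> rho * (mean_Im_form S u + C1 * (1 + mean_Im_trace S)) / 2"
    by (rule *(2)) (simp_all add: mean_res_vec_sq[OF S])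
qed

text \<open>The three copies of \<open>K / \<eta>\<close> are one from the Ward sum of
  \<open>G u\<close> and two from at most \<open>n\<close> row moments of size
  \<open>K / (n \<eta>)\<close>, each doubled; the 2 comes from the squares of
  \<open>u\<close>.\<close>

lemma coupling_sum:
  assumes S: "S \<subseteq> {..<n}" and u: "(\<Sum>i\<in>S. (u i)\<^sup>2) \<le> 1" and j: "j \<in> S"
    and K1: "\<And>i. i \<in> S \<Longrightarrow> mean_Im_form (S - {i}) u \<le> K"
    and K2: "\<And>i j. i \<in> S \<Longrightarrow> j \<in> S \<Longrightarrow> i \<noteq> j \<Longrightarrow> mean_Im_form (S - {i, j}) u \<le> K"
  shows "(\<Sum>i\<in>S - {j}. \<integral>x. (cmod (res_vec (H x) z (S - {j}) u i))\<^sup>2 * (cmod (row_coupling S i j x))\<^sup>2 \<partial>P)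
     \<le> (3 * K / \<eta> + 2) / (2 * (n * \<eta>))"
proof -
  let ?S = "S - {j}"
  have S': "?S \<subseteq> {..<n}" and fS: "finite S" using S finite_subset by auto
  have iYs: "integrable P (\<lambda>x. (cmod (res_vec (H x) z ?S u i))\<^sup>2)" if "i \<in> ?S" for i
  proof (rule integrable_le[OF integrable_res_vec_sq[OF S', of u]])
    show "(\<lambda>x. (cmod (res_vec (H x) z ?S u i))\<^sup>2) \<in> borel_measurable P"
      using measurable_res(2)[OF S', of u i] by measurable
    show "(cmod (res_vec (H x) z ?S u i))\<^sup>2 \<le> (\<Sum>k\<in>?S. (cmod (res_vec (H x) z ?S u k))\<^sup>2)" for x
      using that fS by (intro member_le_sum) auto
  qed simp
  have K0: "0 \<le> K" using mean_Im_form_nonneg[OF S', of u] K1[OF j] by linarith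
  have "(\<Sum>i\<in>?S. \<integral>x. (cmod (res_vec (H x) z ?S u i))\<^sup>2 * (cmod (row_coupling S i j x))\<^sup>2 \<partial>P)
    \<le> (\<Sum>i\<in>?S. ((\<integral>x. (cmod (res_vec (H x) z ?S u i))\<^sup>2 \<partial>P) + (2 * (u i)\<^sup>2 + 2 * (K / (n * \<eta>)))) / (2 * (n * \<eta>)))"
  proof (rule sum_mono)
    fix i assume i: "i \<in> ?S"
    then have i': "i \<in> S" "i \<noteq> j" by auto
    have ir: "integrable P (\<lambda>x. (cmod (res_row (H x) z ?S u i))\<^sup>2)" by (rule res_row_moment(1)[OF S' i])
    have "(\<integral>x. (cmod (res_row (H x) z ?S u i))\<^sup>2 \<partial>P) \<le> mean_Im_form (?S - {i}) u / (n * \<eta>)"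
      unfolding mean_Im_form_def by (rule res_row_moment(2)[OF S' i])
    also have "?S - {i} = S - {i, j}" by auto
    also have "mean_Im_form (S - {i, j}) u / (n * \<eta>) \<le> K / (n * \<eta>)"
      using K2[OF i'(1) j i'(2)] Im_pos by (intro divide_right_mono) auto
    finally have r: "(\<integral>x. (cmod (res_row (H x) z ?S u i))\<^sup>2 \<partial>P) \<le> K / (n * \<eta>)" .
    have "(\<integral>x. (cmod (res_vec (H x) z ?S u i))\<^sup>2 * (cmod (row_coupling S i j x))\<^sup>2 \<partial>P)
      \<le> (\<integral>x. (cmod (res_vec (H x) z ?S u i))\<^sup>2 + (2 * (u i)\<^sup>2 + 2 * (cmod (res_row (H x) z ?S u i))\<^sup>2) \<partial>P) / (2 * (n * \<eta>))"
      by (rule coupling_moment(2)[OF S i'(1) j i'(2)])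
    also have "(\<integral>x. (cmod (res_vec (H x) z ?S u i))\<^sup>2 + (2 * (u i)\<^sup>2 + 2 * (cmod (res_row (H x) z ?S u i))\<^sup>2) \<partial>P)
      = (\<integral>x. (cmod (res_vec (H x) z ?S u i))\<^sup>2 \<partial>P) + (2 * (u i)\<^sup>2 + 2 * (\<integral>x. (cmod (res_row (H x) z ?S u i))\<^sup>2 \<partial>P))"
      using iYs[OF i] ir by (simp add: P.prob_space)
    also have "\<dots> / (2 * (n * \<eta>)) \<le> ((\<integral>x. (cmod (res_vec (H x) z ?S u i))\<^sup>2 \<partial>P) + (2 * (u i)\<^sup>2 + 2 * (K / (n * \<eta>)))) / (2 * (n * \<eta>))"
      using r Im_pos by (intro divide_right_mono) auto
    finally show "(\<integral>x. (cmod (res_vec (H x) z ?S u i))\<^sup>2 * (cmod (row_coupling S i j x))\<^sup>2 \<partial>P)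
      \<le> ((\<integral>x. (cmod (res_vec (H x) z ?S u i))\<^sup>2 \<partial>P) + (2 * (u i)\<^sup>2 + 2 * (K / (n * \<eta>)))) / (2 * (n * \<eta>))" .
  qed
  also have "\<dots> = ((\<Sum>i\<in>?S. \<integral>x. (cmod (res_vec (H x) z ?S u i))\<^sup>2 \<partial>P) + (2 * (\<Sum>i\<in>?S. (u i)\<^sup>2) + card ?S * (2 * (K / (n * \<eta>))))) / (2 * (n * \<eta>))"
    by (simp only: sum_divide_distrib[symmetric] sum.distrib sum_distrib_left[symmetric] sum_constant) (simp add: mult_ac)
  also have "\<dots> \<le> (K / \<eta> + (2 * 1 + n * (2 * (K / (n * \<eta>))))) / (2 * (n * \<eta>))"
  proof (intro divide_right_mono add_mono mult_left_mono mult_right_mono)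
    have "(\<Sum>i\<in>?S. \<integral>x. (cmod (res_vec (H x) z ?S u i))\<^sup>2 \<partial>P) = mean_Im_form ?S u / \<eta>"
      unfolding mean_res_vec_sq[OF S', symmetric]
      by (rule Bochner_Integration.integral_sum[symmetric]) (rule iYs)
    also have "\<dots> \<le> K / \<eta>" using K1[OF j] Im_pos by (intro divide_right_mono) auto
    finally show "(\<Sum>i\<in>?S. \<integral>x. (cmod (res_vec (H x) z ?S u i))\<^sup>2 \<partial>P) \<le> K / \<eta>" .
    show "(\<Sum>i\<in>?S. (u i)\<^sup>2) \<le> 1"
      using sum_mono2[OF fS Diff_subset, of "{j}" "\<lambda>i. (u i)\<^sup>2"] u by simp
    show "real (card ?S) \<le> real n" using card_mono[OF _ S'] by simp
  qed (use K0 Im_pos in auto)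
  also have "\<dots> = (3 * K / \<eta> + 2) / (2 * (n * \<eta>))" using n_pos by (simp add: field_simps)
  finally show ?thesis .
qed

text \<open>Diagonal terms are \<open>res_row_moment\<close>, off-diagonal ones
  \<open>row_pair_moment\<close> summed by \<open>coupling_sum\<close>. The bound refers to minors
  with one or two rows fewer, the loss that the iteration has to pay for.\<close>

lemma row_sum_moment:
  assumes S: "S \<subseteq> {..<n}" and u: "(\<Sum>i\<in>S. (u i)\<^sup>2) \<le> 1"
    and K1: "\<And>i. i \<in> S \<Longrightarrow> mean_Im_form (S - {i}) u \<le> K"
    and K2: "\<And>i j. i \<in> S \<Longrightarrow> j \<in> S \<Longrightarrow> i \<noteq> j \<Longrightarrow> mean_Im_form (S - {i, j}) u \<le> K"
    and K0: "0 \<le> K"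
  shows "integrable P (\<lambda>x. (cmod (row_sum S u x))\<^sup>2)"
    and "(\<integral>x. (cmod (row_sum S u x))\<^sup>2 \<partial>P) \<le> rho\<^sup>2 * (3 * K + 1)"
proof -
  have fS: "finite S" using S finite_subset by blast
  define a where "a = (\<lambda>i x. res_row (H x) z S u i)"
  define c where "c = (\<lambda>i j. \<integral>x. (cmod (res_vec (H x) z (S - {j}) u i))\<^sup>2 * (cmod (row_coupling S i j x))\<^sup>2 \<partial>P)"
  have ma: "a i \<in> borel_measurable P" and ia: "integrable P (\<lambda>x. (cmod (a i x))\<^sup>2)" if "i \<in> S" for i
    unfolding a_def using that S by (auto intro!: measurable_res_row res_row_moment(1))
  have iab: "integrable P (\<lambda>x. a i x * cnj (a j x))" if "i \<in> S" "j \<in> S" for i j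
    using that ma ia by (intro integrable_mult_cnj) auto
  have ex: "(cmod (row_sum S u x))\<^sup>2 = (\<Sum>i\<in>S. \<Sum>j\<in>S. u i * u j * Re (a i x * cnj (a j x)))" for x
  proof -
    have "of_real ((cmod (row_sum S u x))\<^sup>2) = (\<Sum>i\<in>S. of_real (u i) * a i x) * cnj (\<Sum>j\<in>S. of_real (u j) * a j x)"
      unfolding complex_norm_square row_sum_def a_def ..
    also have "\<dots> = (\<Sum>i\<in>S. \<Sum>j\<in>S. of_real (u i * u j) * (a i x * cnj (a j x)))"
      unfolding cnj_sum sum_product by (intro sum.cong refl) simp
    finally have "(cmod (row_sum S u x))\<^sup>2 = Re (\<Sum>i\<in>S. \<Sum>j\<in>S. of_real (u i * u j) * (a i x * cnj (a j x)))"
      by (metis Re_complex_of_real)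
    moreover have "Re (of_real r * w) = r * Re w" for r w by simp
    ultimately show ?thesis by (simp only: Re_sum)
  qed
  have iR: "integrable P (\<lambda>x. u i * u j * Re (a i x * cnj (a j x)))" if "i \<in> S" "j \<in> S" for i j
    using integrable_Re[OF iab[OF that]] by (rule integrable_mult_right)
  show "integrable P (\<lambda>x. (cmod (row_sum S u x))\<^sup>2)"
    unfolding ex by (intro Bochner_Integration.integrable_sum iR)
  have "(\<integral>x. (cmod (row_sum S u x))\<^sup>2 \<partial>P) = (\<Sum>i\<in>S. \<Sum>j\<in>S. \<integral>x. u i * u j * Re (a i x * cnj (a j x)) \<partial>P)"
    unfolding ex by (subst Bochner_Integration.integral_sum, intro Bochner_Integration.integrable_sum iR, assumption+)
      (intro sum.cong refl Bochner_Integration.integral_sum iR, assumption+)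
  also have "\<dots> = (\<Sum>i\<in>S. \<Sum>j\<in>S. u i * u j * Re (\<integral>x. a i x * cnj (a j x) \<partial>P))"
    using iab by (intro sum.cong refl) (simp only: integral_mult_right_zero integral_Re)
  also have "\<dots> \<le> (\<Sum>i\<in>S. (u i)\<^sup>2 * (K / (n * \<eta>)) + (\<Sum>j\<in>S - {i}. ((u j)\<^sup>2 * c i j + (u i)\<^sup>2 * c j i) / 2))"
  proof (rule sum_mono)
    fix i assume i: "i \<in> S"
    have "(\<Sum>j\<in>S. u i * u j * Re (\<integral>x. a i x * cnj (a j x) \<partial>P))
      = u i * u i * Re (\<integral>x. a i x * cnj (a i x) \<partial>P) + (\<Sum>j\<in>S - {i}. u i * u j * Re (\<integral>x. a i x * cnj (a j x) \<partial>P))"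
      by (rule sum.remove[OF fS i])
    also have "\<dots> \<le> (u i)\<^sup>2 * (K / (n * \<eta>)) + (\<Sum>j\<in>S - {i}. ((u j)\<^sup>2 * c i j + (u i)\<^sup>2 * c j i) / 2)"
    proof (rule add_mono)
      have "Re (\<integral>x. a i x * cnj (a i x) \<partial>P) = (\<integral>x. (cmod (a i x))\<^sup>2 \<partial>P)"
        unfolding complex_norm_square[symmetric] by (simp flip: integral_Re[OF integrable_of_real[OF ia[OF i]]] del: of_real_power)
      also have "\<dots> \<le> mean_Im_form (S - {i}) u / (n * \<eta>)"
        unfolding a_def mean_Im_form_def by (rule res_row_moment(2)[OF S i])
      also have "\<dots> \<le> K / (n * \<eta>)" using K1[OF i] Im_pos by (intro divide_right_mono) auto
      finally show "u i * u i * Re (\<integral>x. a i x * cnj (a i x) \<partial>P) \<le> (u i)\<^sup>2 * (K / (n * \<eta>))"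
        unfolding power2_eq_square by (rule mult_left_mono) simp
      show "(\<Sum>j\<in>S - {i}. u i * u j * Re (\<integral>x. a i x * cnj (a j x) \<partial>P)) \<le> (\<Sum>j\<in>S - {i}. ((u j)\<^sup>2 * c i j + (u i)\<^sup>2 * c j i) / 2)"
        unfolding a_def c_def using i by (intro sum_mono row_pair_moment[OF S]) auto
    qed
    finally show "(\<Sum>j\<in>S. u i * u j * Re (\<integral>x. a i x * cnj (a j x) \<partial>P))
       \<le> (u i)\<^sup>2 * (K / (n * \<eta>)) + (\<Sum>j\<in>S - {i}. ((u j)\<^sup>2 * c i j + (u i)\<^sup>2 * c j i) / 2)" .
  qed
  also have "\<dots> = (\<Sum>i\<in>S. (u i)\<^sup>2) * (K / (n * \<eta>)) + (\<Sum>j\<in>S. (u j)\<^sup>2 * (\<Sum>i\<in>S - {j}. c i j))"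
  proof -
    \<comment> \<open>With value 0 on the diagonal all sums run over the full square, so that the
      two halves of the symmetrised bound can be exchanged.\<close>
    define d where "d = (\<lambda>i j. if i = j then 0 else (u j)\<^sup>2 * c i j)"
    have rem: "(\<Sum>j\<in>S - {i}. f j) = (\<Sum>j\<in>S. if i = j then 0 else f j)" if "i \<in> S" for i and f :: "nat \<Rightarrow> real"
      using fS that by (subst sum.remove[of S i "\<lambda>j. if i = j then 0 else f j"]) auto
    have 1: "(\<Sum>j\<in>S - {i}. ((u j)\<^sup>2 * c i j + (u i)\<^sup>2 * c j i) / 2) = (\<Sum>j\<in>S. (d i j + d j i) / 2)" if "i \<in> S" for i
      unfolding rem[OF that] by (intro sum.cong refl) (auto simp: d_def)
    have 2: "(u j)\<^sup>2 * (\<Sum>i\<in>S - {j}. c i j) = (\<Sum>i\<in>S. d i j)" if "j \<in> S" for j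
      unfolding rem[OF that] sum_distrib_left by (intro sum.cong refl) (auto simp: d_def)
    have "(\<Sum>i\<in>S. \<Sum>j\<in>S. (d i j + d j i) / 2) = ((\<Sum>i\<in>S. \<Sum>j\<in>S. d i j) + (\<Sum>i\<in>S. \<Sum>j\<in>S. d j i)) / 2"
      by (simp only: sum_divide_distrib[symmetric] sum.distrib)
    also have "(\<Sum>i\<in>S. \<Sum>j\<in>S. d i j) = (\<Sum>i\<in>S. \<Sum>j\<in>S. d j i)" by (rule sum.swap)
    finally have 3: "(\<Sum>i\<in>S. \<Sum>j\<in>S. (d i j + d j i) / 2) = (\<Sum>j\<in>S. \<Sum>i\<in>S. d i j)" by simp
    have "(\<Sum>i\<in>S. \<Sum>j\<in>S - {i}. ((u j)\<^sup>2 * c i j + (u i)\<^sup>2 * c j i) / 2) = (\<Sum>i\<in>S. \<Sum>j\<in>S. (d i j + d j i) / 2)"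
      by (intro sum.cong refl 1)
    also have "\<dots> = (\<Sum>j\<in>S. (u j)\<^sup>2 * (\<Sum>i\<in>S - {j}. c i j))"
      unfolding 3 by (intro sum.cong refl 2[symmetric])
    finally show ?thesis by (simp only: sum.distrib sum_distrib_right)
  qed
  also have "\<dots> \<le> 1 * (K / (n * \<eta>)) + (\<Sum>j\<in>S. (u j)\<^sup>2 * ((3 * K / \<eta> + 2) / (2 * (n * \<eta>))))"
    using u K0 Im_pos coupling_sum[OF S u _ K1 K2] unfolding c_def
    by (intro add_mono mult_right_mono sum_mono mult_left_mono) auto
  also have "(\<Sum>j\<in>S. (u j)\<^sup>2 * ((3 * K / \<eta> + 2) / (2 * (n * \<eta>)))) = (\<Sum>j\<in>S. (u j)\<^sup>2) * ((3 * K / \<eta> + 2) / (2 * (n * \<eta>)))"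
    by (simp only: sum_distrib_right)
  also have "1 * (K / (n * \<eta>)) + (\<Sum>j\<in>S. (u j)\<^sup>2) * ((3 * K / \<eta> + 2) / (2 * (n * \<eta>))) \<le> 1 * (K / (n * \<eta>)) + 1 * ((3 * K / \<eta> + 2) / (2 * (n * \<eta>)))"
    using u K0 Im_pos by (intro add_left_mono mult_right_mono) auto
  \<comment> \<open>Since \<open>\<eta> <= 1\<close>, every term is raised to the common order
    \<open>1 / (n \<eta>^2)\<close>, which is the square of \<open>rho\<close>.\<close>
  also have "\<dots> \<le> (K / \<eta>) / (n * \<eta>) + ((3 * K / \<eta> + 2 / \<eta>) / (2 * (n * \<eta>)))"
  proof -
    have "K * 1 \<le> K * (1 / \<eta>)" using Im_pos Im_le K0 by (intro mult_left_mono) auto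
    moreover have "2 \<le> 2 / \<eta>" using Im_pos Im_le by (simp add: le_divide_eq)
    ultimately show ?thesis using Im_pos n_pos by (simp only: mult_1) (intro add_mono divide_right_mono; simp)
  qed
  also have "\<dots> = (5 / 2 * K + 1) / (n * \<eta>\<^sup>2)" using n_pos Im_pos by (simp add: field_simps power2_eq_square)
  also have "\<dots> \<le> rho\<^sup>2 * (3 * K + 1)" unfolding rho_sq using K0 n_pos by (simp add: divide_right_mono)
  finally show "(\<integral>x. (cmod (row_sum S u x))\<^sup>2 \<partial>P) \<le> rho\<^sup>2 * (3 * K + 1)" .
qed

end

section \<open>The bootstrap for the quadratic form\<close>

lemma measure_Markov:
  assumes "finite_measure M" "integrable M f" "\<And>x. 0 \<le> f x" "t > 0"
  shows "measure M {x \<in> space M. t < f x} \<le> integral\<^sup>L M f / t"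
proof -
  interpret finite_measure M by fact
  have [measurable]: "f \<in> borel_measurable M" using assms by simp
  have "measure M {x \<in> space M. t < f x} \<le> measure M {x \<in> space M. t \<le> f x}"
    by (rule finite_measure_mono) auto
  also have "\<dots> \<le> integral\<^sup>L M f / t"
    by (rule integral_Markov_inequality_measure[where A = "{}"]) (use assms in auto)
  finally show ?thesis .
qed

text \<open>The tolerances 1/4 for \<open>z\<close>, 1/8 for the trace and 1/8 for the loss of up to
  \<open>2 * k\<close> rows add up to 1/2, so \<open>z + s\<close> stays at distance at least 1/2
  from 0. The bound \<open>bad\<close> offsets the trivial estimate \<open>1 / \<eta>\<close> on the
  exceptional event.\<close>

locale wigner_bulk = wigner_resolvent +
  fixes m :: complex and k :: nat and u :: "nat \<Rightarrow> real"
  assumes m: "Im m > 0" "cmod m = 1"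
    and near: "cmod (z + of_real (2 * Re m)) \<le> 1 / 4"
    and trace_bounded: "mean_Im_trace {..<n} \<le> 3"
    and rho_small: "rho \<le> 1 / 8"
    and k_small: "2 * real k / (n * \<eta>) \<le> 1 / 8"
    and bad: "P.prob {x \<in> space P. 1 / 8 < cmod (stieltjes x - m)} \<le> \<eta>"
    and u: "(\<Sum>i<n. (u i)\<^sup>2) \<le> 1"
begin

abbreviation "bad_set \<equiv> {x \<in> space P. 1 / 8 < cmod (stieltjes x - m)}"

lemma measurable_stieltjes[measurable]: "stieltjes \<in> borel_measurable P"
  using integrable_stieltjes by simp

lemma trace_close:
  assumes "S \<subseteq> {..<n}" "card ({..<n} - S) \<le> 2 * k"
  shows "cmod (res_trace (H x) z S / n - stieltjes x) \<le> 1 / 8"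
proof -
  have "S = {..<n} - ({..<n} - S)" using assms by auto
  then have "cmod (res_trace (H x) z {..<n} - res_trace (H x) z S) \<le> card ({..<n} - S) / \<eta>"
    using res.norm_res_trace_diff_set[of "{..<n}" "{..<n} - S" x] by simp
  also have "\<dots> \<le> 2 * real k / \<eta>" using assms(2) Im_pos by (intro divide_right_mono) auto
  finally have "cmod (res_trace (H x) z {..<n} - res_trace (H x) z S) / n \<le> 2 * real k / \<eta> / n"
    by (rule divide_right_mono) simp
  also have "\<dots> \<le> 1 / 8" using k_small by (simp add: mult.commute)
  also have "cmod (res_trace (H x) z {..<n} - res_trace (H x) z S) / n = cmod (res_trace (H x) z S / n - stieltjes x)"
    by (simp add: stieltjes_def diff_divide_distrib[symmetric] norm_divide norm_minus_commute)
  finally show ?thesis .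
qed

text \<open>At the limit point \<open>z + s\<close> equals \<open>m - 2 Re m = - cnj m\<close>, of
  modulus 1.\<close>

lemma denominator_lower_bound:
  assumes "S \<subseteq> {..<n}" "card ({..<n} - S) \<le> 2 * k" "cmod (stieltjes x - m) \<le> 1 / 8"
  shows "1 / 2 \<le> cmod (z + res_trace (H x) z S / n)"
proof -
  define e where "e = (z + of_real (2 * Re m)) + ((stieltjes x - m) + (res_trace (H x) z S / n - stieltjes x))"
  have c: "m - of_real (2 * Re m) = - cnj m" by (simp add: complex_eq_iff)
  have "z + res_trace (H x) z S / n = - cnj m + e" unfolding c[symmetric] e_def by simp
  moreover have "cmod e \<le> 1 / 4 + (1 / 8 + 1 / 8)"
    unfolding e_def by (intro order_trans[OF norm_triangle_ineq] add_mono near assms(3) trace_close[OF assms(1,2)])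
  moreover have "cmod (- cnj m) = 1" using m by simp
  ultimately show ?thesis
    using norm_triangle_ineq2[of "- cnj m" "- e"] by simp
qed

lemma mean_Im_trace_close:
  assumes "S \<subseteq> {..<n}" "card ({..<n} - S) \<le> 2 * k"
  shows "mean_Im_trace S \<le> 4"
proof -
  have "Im (res_trace (H x) z S) / n \<le> Im (stieltjes x) + 1 / 8" for x
    using abs_Im_le_cmod[of "res_trace (H x) z S / n - stieltjes x"] trace_close[OF assms, of x] by simp
  then have "mean_Im_trace S \<le> (\<integral>x. Im (stieltjes x) + 1 / 8 \<partial>P)"
    unfolding mean_Im_trace_def using integrable_res_trace[OF assms(1)] integrable_stieltjes
    by (intro integral_mono) auto
  also have "\<dots> = mean_Im_trace {..<n} + 1 / 8"
    unfolding mean_Im_stieltjes using integrable_stieltjes by (simp add: P.prob_space)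
  finally show ?thesis using trace_bounded by linarith
qed

text \<open>The part of one bootstrap step free of \<open>K\<close>: 3 from the main term and the
  exceptional event, and \<open>2 + 5 C1\<close> from the errors after \<open>rho <= 1\<close>. The
  5 in front of \<open>C1\<close> bounds 1 plus the mean trace.\<close>

definition D :: real where "D = 5 + 5 * C1"

text \<open>The first moment of \<open>row_sum\<close> is taken from its second by weighting with
  \<open>rho\<close>, which balances the two terms because the second moment is of order
  \<open>rho^2\<close>.\<close>

lemma sums_moment:
  assumes S: "S \<subseteq> {..<n}" "card ({..<n} - S) \<le> 2 * k"
    and K: "\<And>R. R \<subseteq> S \<Longrightarrow> card R \<le> 2 \<Longrightarrow> mean_Im_form (S - R) u \<le> K"
  shows "integrable P (\<lambda>x. cmod (row_sum S u x))" "integrable P (\<lambda>x. cmod (error_sum S u x))"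
    "(\<integral>x. cmod (row_sum S u x) \<partial>P) + (\<integral>x. cmod (error_sum S u x) \<partial>P) \<le> rho * (4 * K + 2 + 5 * C1) / 2"
proof -
  have us: "(\<Sum>i\<in>S. (u i)\<^sup>2) \<le> 1"
    using sum_mono2[OF _ S(1), of "\<lambda>i. (u i)\<^sup>2"] u by simp
  have K0: "0 \<le> K" using K[of "{}"] mean_Im_form_nonneg[OF S(1), of u] by simp
  have kS: "mean_Im_form S u \<le> K" using K[of "{}"] by simp
  have K1: "mean_Im_form (S - {i}) u \<le> K" if "i \<in> S" for i using that by (intro K) auto
  have K2: "mean_Im_form (S - {i, j}) u \<le> K" if "i \<in> S" "j \<in> S" "i \<noteq> j" for i j
    using that by (intro K) auto
  note r1 = row_sum_moment(1)[OF S(1) us K1 K2 K0] and r2 = row_sum_moment(2)[OF S(1) us K1 K2 K0]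
  have le: "cmod (row_sum S u x) \<le> (rho + (cmod (row_sum S u x))\<^sup>2 / rho) / 2" for x
    using weighted_am_gm[OF rho_pos, of "cmod (row_sum S u x)" 1] by simp
  have rm: "(\<lambda>x. cmod (row_sum S u x)) \<in> borel_measurable P" using measurable_sums(1)[OF S(1)] by simp
  have g: "integrable P (\<lambda>x. (rho + (cmod (row_sum S u x))\<^sup>2 / rho) / 2)" using r1 by simp
  show ir: "integrable P (\<lambda>x. cmod (row_sum S u x))" by (rule integrable_le[OF g rm norm_ge_zero le])
  have "(\<integral>x. cmod (row_sum S u x) \<partial>P) \<le> (\<integral>x. (rho + (cmod (row_sum S u x))\<^sup>2 / rho) / 2 \<partial>P)"
    by (rule integral_mono[OF ir g le])
  also have "\<dots> = (rho + (\<integral>x. (cmod (row_sum S u x))\<^sup>2 \<partial>P) / rho) / 2"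
    using r1 by (simp add: P.prob_space)
  also have "\<dots> \<le> (rho + (rho\<^sup>2 * (3 * K + 1)) / rho) / 2"
    using r2 rho_pos by (intro divide_right_mono add_left_mono) auto
  also have "(rho\<^sup>2 * (3 * K + 1)) / rho = rho * (3 * K + 1)" using rho_pos by (simp add: power2_eq_square)
  also have "(rho + rho * (3 * K + 1)) / 2 = rho * (3 * K + 2) / 2" by (simp add: algebra_simps)
  finally have R: "(\<integral>x. cmod (row_sum S u x) \<partial>P) \<le> rho * (3 * K + 2) / 2" .
  note e = error_sum_moment[OF S(1) us]
  show "integrable P (\<lambda>x. cmod (error_sum S u x))" by (rule e(1))
  have "C1 * (1 + mean_Im_trace S) \<le> C1 * 5"
    using mean_Im_trace_close[OF S] C1_ge by (intro mult_left_mono) auto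
  then have "rho * (mean_Im_form S u + C1 * (1 + mean_Im_trace S)) / 2 \<le> rho * (K + 5 * C1) / 2"
    using kS rho_pos by (intro divide_right_mono mult_left_mono) auto
  with e(2) have E: "(\<integral>x. cmod (error_sum S u x) \<partial>P) \<le> rho * (K + 5 * C1) / 2" by linarith
  have "rho * (3 * K + 2) / 2 + rho * (K + 5 * C1) / 2 = rho * (4 * K + 2 + 5 * C1) / 2"
    by (simp add: algebra_simps add_divide_distrib)
  with R E show "(\<integral>x. cmod (row_sum S u x) \<partial>P) + (\<integral>x. cmod (error_sum S u x) \<partial>P) \<le> rho * (4 * K + 2 + 5 * C1) / 2"
    by linarith
qed

text \<open>Off the exceptional event \<open>res_form_identity\<close> is divided by a denominator
  of modulus at least 1/2. On it, the trivial bound \<open>1 / \<eta>\<close> times the probability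
  contributes at most 1.\<close>

lemma mean_Im_form_step:
  assumes S: "S \<subseteq> {..<n}" "card ({..<n} - S) \<le> 2 * k"
    and K: "\<And>R. R \<subseteq> S \<Longrightarrow> card R \<le> 2 \<Longrightarrow> mean_Im_form (S - R) u \<le> K"
  shows "mean_Im_form S u \<le> D + 4 * rho * K"
proof -
  have fS: "finite S" using S finite_subset by blast
  have us: "(\<Sum>i\<in>S. (u i)\<^sup>2) \<le> 1"
    using sum_mono2[OF _ S(1), of "\<lambda>i. (u i)\<^sup>2"] u by simp
  note s = sums_moment[OF S K]
  let ?R = "\<lambda>x. cmod (row_sum S u x)" and ?E = "\<lambda>x. cmod (error_sum S u x)" and ?F = "\<lambda>x. res_form (H x) z S u"
  let ?b = "\<lambda>x. indicator bad_set x / \<eta> :: real"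
  have le: "Im (?F x) \<le> 2 * (1 + ?R x + ?E x) + ?b x" if x: "x \<in> space P" for x
  proof (cases "x \<in> bad_set")
    case True
    have "cmod (?F x) \<le> (\<Sum>i\<in>S. (u i)\<^sup>2) / \<eta>" by (rule res.res_form_bound[OF fS])
    also have "\<dots> \<le> 1 / \<eta>" using us Im_pos by (intro divide_right_mono) auto
    finally have "Im (?F x) \<le> ?b x" using True abs_Im_le_cmod[of "?F x"] by simp
    then show ?thesis by (simp add: add_increasing)
  next
    case False
    then have "cmod (stieltjes x - m) \<le> 1 / 8" using x by simp
    then have d: "1 / 2 \<le> cmod (z + res_trace (H x) z S / n)" by (rule denominator_lower_bound[OF S])
    have "1 / 2 * cmod (?F x) \<le> cmod (z + res_trace (H x) z S / n) * cmod (?F x)"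
      by (rule mult_right_mono[OF d]) simp
    also have "\<dots> = cmod (- (z + res_trace (H x) z S / n) * ?F x)" by (simp only: norm_mult norm_minus_cancel)
    also have "\<dots> = cmod (of_real (\<Sum>i\<in>S. (u i)\<^sup>2) - row_sum S u x - error_sum S u x)"
      unfolding res_form_identity[OF S(1)] ..
    also have "\<dots> \<le> cmod (of_real (\<Sum>i\<in>S. (u i)\<^sup>2)) + ?R x + ?E x"
      by (intro order_trans[OF norm_triangle_ineq4] add_mono order_refl)
    also have "cmod (of_real (\<Sum>i\<in>S. (u i)\<^sup>2)) = (\<Sum>i\<in>S. (u i)\<^sup>2)" unfolding norm_of_real by (simp add: sum_nonneg)
    finally have "cmod (?F x) \<le> 2 * (1 + ?R x + ?E x)" using us by simp
    then show ?thesis using abs_Im_le_cmod[of "?F x"] False by simp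
  qed
  have "bad_set \<in> sets P" by measurable
  then have ib: "integrable P ?b" "integral\<^sup>L P ?b = P.prob bad_set / \<eta>"
    by (simp_all add: P.emeasure_eq_measure)
  have ig: "integrable P (\<lambda>x. 2 * (1 + ?R x + ?E x) + ?b x)" using s(1,2) ib(1) by simp
  have iF: "integrable P (\<lambda>x. Im (?F x))" using integrable_res_form[OF S(1)] by simp
  have "mean_Im_form S u \<le> (\<integral>x. 2 * (1 + ?R x + ?E x) + ?b x \<partial>P)"
    unfolding mean_Im_form_def by (rule integral_mono[OF iF ig le])
  also have "\<dots> = 2 * (1 + ((\<integral>x. ?R x \<partial>P) + (\<integral>x. ?E x \<partial>P))) + P.prob bad_set / \<eta>"
    using s(1,2) ib by (simp add: P.prob_space)
  also have "\<dots> \<le> 2 * (1 + rho * (4 * K + 2 + 5 * C1) / 2) + 1"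
    using s(3) bad Im_pos by (intro add_mono mult_left_mono) auto
  also have "\<dots> = 3 + 4 * rho * K + rho * (2 + 5 * C1)" by (simp add: algebra_simps)
  also have "\<dots> \<le> 3 + 4 * rho * K + 1 * (2 + 5 * C1)"
    using rho_small C1_ge by (intro add_left_mono mult_right_mono) auto
  finally show ?thesis by (simp add: D_def)
qed

text \<open>Each step removes at most two more rows and multiplies the a priori bound by
  \<open>4 rho <= 1/2\<close>, while the constant stays below the fixed point \<open>2 D\<close>.
  Starting at most \<open>2 * (k - j)\<close> rows down leaves room for \<open>j\<close>
  steps.\<close>

lemma mean_Im_form_iterate:
  assumes "j \<le> k" "S \<subseteq> {..<n}" "card ({..<n} - S) \<le> 2 * (k - j)"
  shows "mean_Im_form S u \<le> 2 * D + (4 * rho) ^ j / \<eta>"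
  using assms
proof (induction j arbitrary: S)
  case 0
  have "(\<Sum>i\<in>S. (u i)\<^sup>2) \<le> 1"
    using sum_mono2[OF _ 0(2), of "\<lambda>i. (u i)\<^sup>2"] u by simp
  then have "mean_Im_form S u \<le> 1 / \<eta>" by (rule mean_Im_form_le[OF 0(2)])
  moreover have "D \<ge> 0" using C1_ge by (simp add: D_def)
  ultimately show ?case by simp
next
  case (Suc j)
  have c: "card ({..<n} - S) \<le> 2 * k" using Suc.prems by linarith
  have "mean_Im_form (S - R) u \<le> 2 * D + (4 * rho) ^ j / \<eta>" if R: "R \<subseteq> S" "card R \<le> 2" for R
  proof (rule Suc.IH)
    have "{..<n} - (S - R) \<subseteq> ({..<n} - S) \<union> R" by auto
    then have "card ({..<n} - (S - R)) \<le> card (({..<n} - S) \<union> R)"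
      using R Suc.prems(2) finite_subset[of R "{..<n}"] by (intro card_mono) auto
    also have "\<dots> \<le> card ({..<n} - S) + card R" by (rule card_Un_le)
    finally show "card ({..<n} - (S - R)) \<le> 2 * (k - j)" using Suc.prems R by linarith
  qed (use Suc.prems in auto)
  then have "mean_Im_form S u \<le> D + 4 * rho * (2 * D + (4 * rho) ^ j / \<eta>)"
    by (rule mean_Im_form_step[OF Suc.prems(2) c])
  also have "\<dots> = D + 8 * rho * D + (4 * rho) ^ Suc j / \<eta>" by (simp add: algebra_simps)
  also have "\<dots> \<le> D + 1 * D + (4 * rho) ^ Suc j / \<eta>"
    using rho_small C1_ge by (intro add_mono mult_right_mono order_refl) (auto simp: D_def)
  finally show ?case by simp
qed

text \<open>With all relevant minors bounded, both error sums are of order \<open>rho\<close>;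
  Markov's inequality is then applied to the identity for the form minus the equation for
  \<open>m\<close>.\<close>

lemma isotropic_law:
  assumes k: "k > 0" "(4 * rho) ^ (k - 1) / \<eta> \<le> 1" and u1: "(\<Sum>i<n. (u i)\<^sup>2) = 1" and t: "t > 0"
  shows "P.prob {x \<in> space P. t < cmod (res_form (H x) z {..<n} u - m)} \<le>
    \<eta> + 2 * (rho * (4 * (2 * D + 1) + 2 + 5 * C1) / 2 + cmod (z + of_real (2 * Re m)) + (\<integral>x. cmod (stieltjes x - m) \<partial>P)) / t"
proof -
  let ?S = "{..<n}"
  have S: "?S \<subseteq> {..<n}" "card ({..<n} - ?S) \<le> 2 * k" by auto
  \<comment> \<open>With \<open>j = k - 1\<close> iterations the starting minors may lack 2 * (k -
    (k - 1)) = 2 rows, exactly the sets \<open>R\<close> needed here.\<close>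
  have K: "mean_Im_form (?S - R) u \<le> 2 * D + 1" if R: "R \<subseteq> ?S" "card R \<le> 2" for R
  proof -
    have "{..<n} - (?S - R) = R" using R by auto
    then have "mean_Im_form (?S - R) u \<le> 2 * D + (4 * rho) ^ (k - 1) / \<eta>"
      using R k by (intro mean_Im_form_iterate) auto
    then show ?thesis using k by linarith
  qed
  note s = sums_moment[OF S K]
  let ?R = "\<lambda>x. cmod (row_sum ?S u x)" and ?E = "\<lambda>x. cmod (error_sum ?S u x)" and ?F = "\<lambda>x. res_form (H x) z ?S u"
  let ?w = "cmod (z + of_real (2 * Re m))"
  let ?g = "\<lambda>x. 2 * (?R x + ?E x + ?w + cmod (stieltjes x - m))"
  have F: "cmod (?F x - m) \<le> ?g x" if x: "cmod (stieltjes x - m) \<le> 1 / 8" for x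
  proof -
    have c: "m - of_real (2 * Re m) = - cnj m" by (simp add: complex_eq_iff)
    have mm: "cnj m * m = 1" using m(2) by (simp add: mult.commute flip: complex_norm_square)
    have i: "- (z + stieltjes x) * ?F x = 1 - row_sum ?S u x - error_sum ?S u x"
      using res_form_identity[OF S(1), of x u] u1 by (simp add: stieltjes_def)
    \<comment> \<open>Because \<open>(- cnj m) * m = -1\<close>, the number \<open>m\<close> solves
      the limiting equation; subtracting leaves only the deviations of \<open>z\<close>, the trace
      and the two sums.\<close>
    have "(z + stieltjes x) * m = ((z + of_real (2 * Re m)) + (stieltjes x - m)) * m + (m - of_real (2 * Re m)) * m"
      by (simp add: algebra_simps)
    also have "\<dots> = ((z + of_real (2 * Re m)) + (stieltjes x - m)) * m - 1"
      unfolding c using mm by simp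
    finally have "- (z + stieltjes x) * (?F x - m)
      = ((z + of_real (2 * Re m)) + (stieltjes x - m)) * m - row_sum ?S u x - error_sum ?S u x"
      using i by (simp add: algebra_simps)
    then have "cmod (z + stieltjes x) * cmod (?F x - m)
      = cmod (((z + of_real (2 * Re m)) + (stieltjes x - m)) * m - row_sum ?S u x - error_sum ?S u x)"
      by (metis norm_minus_cancel norm_mult)
    also have "\<dots> \<le> cmod (((z + of_real (2 * Re m)) + (stieltjes x - m)) * m) + ?R x + ?E x"
      by (intro order_trans[OF norm_triangle_ineq4] add_mono order_refl)
    also have "cmod (((z + of_real (2 * Re m)) + (stieltjes x - m)) * m) \<le> ?w + cmod (stieltjes x - m)"
      using m(2) norm_triangle_ineq[of "z + of_real (2 * Re m)" "stieltjes x - m"] by (simp only: norm_mult mult_1_right)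
    finally have "cmod (z + stieltjes x) * cmod (?F x - m) \<le> ?w + cmod (stieltjes x - m) + ?R x + ?E x" by simp
    moreover have "1 / 2 * cmod (?F x - m) \<le> cmod (z + stieltjes x) * cmod (?F x - m)"
      using denominator_lower_bound[OF S x] by (intro mult_right_mono) (simp_all add: stieltjes_def)
    ultimately show ?thesis by simp
  qed
  note [measurable] = measurable_res(3)[OF S(1)] measurable_sums[OF S(1)]
  have si: "integrable P (\<lambda>x. cmod (stieltjes x - m))" using integrable_stieltjes by (intro integrable_norm) simp
  have ig: "integrable P ?g" using s(1,2) si by simp
  have "{x \<in> space P. t < cmod (?F x - m)} \<subseteq> bad_set \<union> {x \<in> space P. t < ?g x}"
  proof
    fix x assume x: "x \<in> {x \<in> space P. t < cmod (?F x - m)}"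
    show "x \<in> bad_set \<union> {x \<in> space P. t < ?g x}"
    proof (cases "cmod (stieltjes x - m) \<le> 1 / 8")
      case True
      from less_le_trans[OF _ F[OF True], of t] x show ?thesis by simp
    next
      case False
      then show ?thesis using x by simp
    qed
  qed
  then have "P.prob {x \<in> space P. t < cmod (?F x - m)} \<le> P.prob (bad_set \<union> {x \<in> space P. t < ?g x})"
    by (rule P.finite_measure_mono) measurable
  also have "\<dots> \<le> P.prob bad_set + P.prob {x \<in> space P. t < ?g x}"
    by (rule measure_Un_le) measurable
  also have "P.prob {x \<in> space P. t < ?g x} \<le> integral\<^sup>L P ?g / t"
    by (rule measure_Markov[OF P.finite_measure_axioms ig _ t]) simp
  also have "integral\<^sup>L P ?g = 2 * ((\<integral>x. ?R x \<partial>P) + (\<integral>x. ?E x \<partial>P) + ?w + (\<integral>x. cmod (stieltjes x - m) \<partial>P))"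
    using s(1,2) si by (simp add: P.prob_space)
  finally have 1: "P.prob {x \<in> space P. t < cmod (?F x - m)} \<le> P.prob bad_set
    + 2 * ((\<integral>x. ?R x \<partial>P) + (\<integral>x. ?E x \<partial>P) + ?w + (\<integral>x. cmod (stieltjes x - m) \<partial>P)) / t" by simp
  also have "\<dots> \<le> \<eta> + 2 * (rho * (4 * (2 * D + 1) + 2 + 5 * C1) / 2 + ?w + (\<integral>x. cmod (stieltjes x - m) \<partial>P)) / t"
    using s(3) bad t by (intro add_mono divide_right_mono mult_left_mono) auto
  finally show ?thesis .
qed

end

section \<open>Concentration of the trace\<close>

context iid_product
begin

lemma measurable_block_mean:
  assumes "f \<in> borel_measurable P"
  shows "(\<lambda>x. \<integral>y. f (resample B x y) \<partial>P :: real) \<in> borel_measurable P"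
proof (rule P.borel_measurable_lebesgue_integral)
  show "(\<lambda>(x, y). f (resample B x y)) \<in> borel_measurable (P \<Otimes>\<^sub>M P)"
    using measurable_compose[OF measurable_resample assms, of B] by (simp add: case_prod_beta')
qed

text \<open>Bounded differences by induction on the blocks, with resampling in place of a
  martingale. Averaging out block \<open>i\<close> gives \<open>g\<close>, which has the same mean
  and the same differences in the other blocks; Hoeffding's lemma handles \<open>f - g\<close> with
  those blocks fixed.\<close>

lemma mcdiarmid_mgf:
  fixes f :: "('k \<Rightarrow> real) \<Rightarrow> real" and c :: real
  assumes "finite A" and disj: "disjoint_family_on B A"
    and "f \<in> borel_measurable P" "\<And>x. \<bar>f x\<bar> \<le> C"
    and "\<And>x y. x \<in> space P \<Longrightarrow> y \<in> space P \<Longrightarrow> (\<forall>k\<in>(\<Union>j\<in>A. B j). x k = y k) \<Longrightarrow> f x = f y"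
    and "\<And>j x y. j \<in> A \<Longrightarrow> x \<in> space P \<Longrightarrow> y \<in> space P \<Longrightarrow> \<bar>f x - f (resample (B j) x y)\<bar> \<le> c"
    and l: "l > 0"
  shows "(\<integral>x. exp (l * (f x - integral\<^sup>L P f)) \<partial>P) \<le> exp (card A * (l\<^sup>2 * c\<^sup>2 / 2))"
  using assms(1-6)
proof (induction A arbitrary: f rule: finite_induct)
  case empty
  obtain x0 where x0: "x0 \<in> space P" using P.not_empty by blast
  have c: "f x = f x0" if "x \<in> space P" for x using empty.prems(4)[OF that x0] by simp
  have "integral\<^sup>L P f = (\<integral>x. f x0 \<partial>P)" by (rule Bochner_Integration.integral_cong) (auto simp: c)
  then have "integral\<^sup>L P f = f x0" by (simp add: P.prob_space)
  then have "(\<integral>x. exp (l * (f x - integral\<^sup>L P f)) \<partial>P) = (\<integral>x. 1 \<partial>P)"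
    by (intro Bochner_Integration.integral_cong) (auto simp: c)
  then show ?case by (simp add: P.prob_space)
next
  case (insert i A)
  note fm[measurable] = insert.prems(2) and fC = insert.prems(3) and dep = insert.prems(4) and diff = insert.prems(5)
  have disjA: "disjoint_family_on B A" using insert.prems(1) by (auto simp: disjoint_family_on_def)
  have iB: "B i \<inter> B j = {}" if "j \<in> A" for j
    using insert.prems(1) insert.hyps(2) that by (auto simp: disjoint_family_on_def)
  have C0: "C \<ge> 0" using fC[of "\<lambda>_. 0"] by linarith
  have bi: "integrable P h" if "h \<in> borel_measurable P" "\<And>x. \<bar>h x\<bar> \<le> C" for h :: "_ \<Rightarrow> real"
    using that by (intro P.integrable_const_bound[of _ C]) auto
  have fr: "(\<lambda>y. f (resample (B i) x y)) \<in> borel_measurable P" if "x \<in> space P" for x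
    using that by measurable
  have ir: "integrable P (\<lambda>y. f (resample (B i) x y))" if "x \<in> space P" for x
    by (rule bi[OF fr[OF that] fC])
  \<comment> \<open>The value 0 off the space makes the bound by \<open>C\<close> hold at every
    argument, as the induction hypothesis demands.\<close>
  define g where "g = (\<lambda>x. if x \<in> space P then \<integral>y. f (resample (B i) x y) \<partial>P else 0)"
  have gx: "g x = (\<integral>y. f (resample (B i) x y) \<partial>P)" if "x \<in> space P" for x using that by (simp add: g_def)
  have gm[measurable]: "g \<in> borel_measurable P"
    using measurable_block_mean[OF fm, of "B i"] by (subst measurable_cong[OF gx])
  have gC: "\<bar>g x\<bar> \<le> C" for x
  proof (cases "x \<in> space P")
    case True
    have "\<bar>g x\<bar> \<le> (\<integral>y. \<bar>f (resample (B i) x y)\<bar> \<partial>P)" unfolding gx[OF True] by (rule integral_abs_bound)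
    also have "\<dots> \<le> (\<integral>y. C \<partial>P)" using ir[OF True] fC by (intro integral_mono) auto
    finally show ?thesis by (simp add: P.prob_space)
  qed (simp add: g_def C0)
  have gdep: "g x = g y" if xy: "x \<in> space P" "y \<in> space P" and eq: "\<forall>k\<in>(\<Union>j\<in>A. B j). x k = y k" for x y
    unfolding gx[OF xy(1)] gx[OF xy(2)]
  proof (rule Bochner_Integration.integral_cong[OF refl])
    fix w assume w: "w \<in> space P"
    show "f (resample (B i) x w) = f (resample (B i) y w)"
      by (rule dep) (use eq in \<open>auto simp: resample_space xy w\<close>, auto simp: resample_def)
  qed
  have gdiff: "\<bar>g x - g (resample (B j) x y)\<bar> \<le> c" if j: "j \<in> A" and xy: "x \<in> space P" "y \<in> space P" for j x y
  proof -
    have xy': "resample (B j) x y \<in> space P" using xy by (rule resample_space)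
    \<comment> \<open>Resampling operations of disjoint blocks commute, so a difference of
      \<open>g\<close> is an average of differences of \<open>f\<close>.\<close>
    have sw: "resample (B i) (resample (B j) x y) w = resample (B j) (resample (B i) x w) y" for w
      using iB[OF j] by (auto simp: resample_def fun_eq_iff)
    have "g x - g (resample (B j) x y) = (\<integral>w. f (resample (B i) x w) - f (resample (B i) (resample (B j) x y) w) \<partial>P)"
      unfolding gx[OF xy(1)] gx[OF xy'] using ir[OF xy(1)] ir[OF xy'] by simp
    also have "\<bar>\<dots>\<bar> \<le> (\<integral>w. \<bar>f (resample (B i) x w) - f (resample (B i) (resample (B j) x y) w)\<bar> \<partial>P)"
      by (rule integral_abs_bound)
    also have "\<dots> \<le> (\<integral>w. c \<partial>P)"
    proof (rule integral_mono)
      show "integrable P (\<lambda>w. \<bar>f (resample (B i) x w) - f (resample (B i) (resample (B j) x y) w)\<bar>)"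
        using ir[OF xy(1)] ir[OF xy'] by simp
      fix w assume w: "w \<in> space P"
      show "\<bar>f (resample (B i) x w) - f (resample (B i) (resample (B j) x y) w)\<bar> \<le> c"
        unfolding sw by (rule diff) (use j xy w in \<open>auto intro: resample_space\<close>)
    qed simp
    finally show ?thesis by (simp add: P.prob_space)
  qed
  have IH: "(\<integral>x. exp (l * (g x - integral\<^sup>L P g)) \<partial>P) \<le> exp (card A * (l\<^sup>2 * c\<^sup>2 / 2))"
    by (rule insert.IH[OF disjA gm gC gdep gdiff])
  have fg: "integral\<^sup>L P f = integral\<^sup>L P g"
    unfolding integral_resample[OF bi[OF fm fC], of "B i"]
    by (rule Bochner_Integration.integral_cong) (simp_all add: gx)
  let ?E = "integral\<^sup>L P f"
  have ib: "integrable P (\<lambda>x. exp (l * (h x - e)))" if "h \<in> borel_measurable P" "\<And>x. \<bar>h x\<bar> \<le> C" for h :: "_ \<Rightarrow> real" and e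
  proof (rule P.integrable_const_bound[of _ "exp (l * (C - e))"])
    note [measurable] = that(1)
    show "(\<lambda>x. exp (l * (h x - e))) \<in> borel_measurable P" by measurable
    have "norm (exp (l * (h x - e))) \<le> exp (l * (C - e))" for x
      using l abs_le_D1[OF that(2)[of x]] by simp
    then show "AE x in P. norm (exp (l * (h x - e))) \<le> exp (l * (C - e))" by simp
  qed
  have step: "(\<integral>y. exp (l * (f (resample (B i) x y) - ?E)) \<partial>P) \<le> exp (l\<^sup>2 * c\<^sup>2 / 2) * exp (l * (g x - ?E))" if x: "x \<in> space P" for x
  proof -
    let ?f = "\<lambda>y. f (resample (B i) x y)"
    \<comment> \<open>The interval has length \<open>2 c\<close>, so Hoeffding's (2 c)^2 / 8 becomes
      c^2 / 2.\<close>
    interpret h: interval_bounded_random_variable P ?f "f x - c" "f x + c"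
    proof
      show "AE y in P. ?f y \<in> {f x - c..f x + c}"
      proof (rule AE_I2)
        fix y assume "y \<in> space P"
        then have "\<bar>f x - ?f y\<bar> \<le> c" using diff x by auto
        then show "?f y \<in> {f x - c..f x + c}" by auto
      qed
    qed (rule fr[OF x])
    have "ennreal (\<integral>y. exp (l * (?f y - g x)) \<partial>P) = (\<integral>\<^sup>+y. exp (l * (?f y - g x)) \<partial>P)"
      by (rule nn_integral_eq_integral[symmetric]) (use ib[OF fr[OF x] fC] in auto)
    also have "\<dots> \<le> ennreal (exp (l\<^sup>2 * (f x + c - (f x - c))\<^sup>2 / 8))"
      using h.Hoeffdings_lemma_nn_integral[OF l] by (simp add: gx[OF x])
    finally have "(\<integral>y. exp (l * (?f y - g x)) \<partial>P) \<le> exp (l\<^sup>2 * (f x + c - (f x - c))\<^sup>2 / 8)" by simp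
    also have "l\<^sup>2 * (f x + c - (f x - c))\<^sup>2 / 8 = l\<^sup>2 * c\<^sup>2 / 2" by (simp add: power2_eq_square)
    finally have H: "(\<integral>y. exp (l * (?f y - g x)) \<partial>P) \<le> exp (l\<^sup>2 * c\<^sup>2 / 2)" .
    have "(\<integral>y. exp (l * (?f y - ?E)) \<partial>P) = (\<integral>y. exp (l * (?f y - g x)) * exp (l * (g x - ?E)) \<partial>P)"
      by (intro Bochner_Integration.integral_cong refl) (simp add: exp_add[symmetric] algebra_simps)
    also have "\<dots> = (\<integral>y. exp (l * (?f y - g x)) \<partial>P) * exp (l * (g x - ?E))" by simp
    also have "\<dots> \<le> exp (l\<^sup>2 * c\<^sup>2 / 2) * exp (l * (g x - ?E))" by (rule mult_right_mono[OF H]) simp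
    finally show ?thesis .
  qed
  have "(\<integral>x. exp (l * (f x - ?E)) \<partial>P) = (\<integral>x. (\<integral>y. exp (l * (f (resample (B i) x y) - ?E)) \<partial>P) \<partial>P)"
    by (rule integral_resample[OF ib[OF fm fC]])
  also have "\<dots> \<le> (\<integral>x. exp (l\<^sup>2 * c\<^sup>2 / 2) * exp (l * (g x - ?E)) \<partial>P)"
  proof (rule integral_mono_AE)
    show "AE x in P. (\<integral>y. exp (l * (f (resample (B i) x y) - ?E)) \<partial>P) \<le> exp (l\<^sup>2 * c\<^sup>2 / 2) * exp (l * (g x - ?E))"
      using step by (rule AE_I2)
    show "integrable P (\<lambda>x. exp (l\<^sup>2 * c\<^sup>2 / 2) * exp (l * (g x - ?E)))"
      using ib[OF gm gC] by simp
    show "integrable P (\<lambda>x. \<integral>y. exp (l * (f (resample (B i) x y) - ?E)) \<partial>P)"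
    proof (rule P.integrable_const_bound[of _ "exp (l * (C - ?E))"])
      have m: "(\<lambda>x. exp (l * (f x - ?E))) \<in> borel_measurable P" by measurable
      show "(\<lambda>x. \<integral>y. exp (l * (f (resample (B i) x y) - ?E)) \<partial>P) \<in> borel_measurable P"
        by (rule measurable_block_mean[OF m])
      show "AE x in P. norm (\<integral>y. exp (l * (f (resample (B i) x y) - ?E)) \<partial>P) \<le> exp (l * (C - ?E))"
      proof (rule AE_I2)
        fix x assume x: "x \<in> space P"
        have "(\<integral>y. exp (l * (f (resample (B i) x y) - ?E)) \<partial>P) \<le> (\<integral>y. exp (l * (C - ?E)) \<partial>P)"
        proof (rule integral_mono[OF ib[OF fr[OF x] fC]])
          show "exp (l * (f (resample (B i) x y) - ?E)) \<le> exp (l * (C - ?E))" for y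
            using l abs_le_D1[OF fC[of "resample (B i) x y"]] by simp
        qed simp
        moreover have "0 \<le> (\<integral>y. exp (l * (f (resample (B i) x y) - ?E)) \<partial>P)"
          by (intro integral_nonneg_AE AE_I2) simp
        ultimately show "norm (\<integral>y. exp (l * (f (resample (B i) x y) - ?E)) \<partial>P) \<le> exp (l * (C - ?E))"
          by (simp add: P.prob_space)
      qed
    qed
  qed
  also have "\<dots> = exp (l\<^sup>2 * c\<^sup>2 / 2) * (\<integral>x. exp (l * (g x - ?E)) \<partial>P)" by simp
  also have "\<dots> \<le> exp (l\<^sup>2 * c\<^sup>2 / 2) * exp (card A * (l\<^sup>2 * c\<^sup>2 / 2))"
    using IH unfolding fg by (intro mult_left_mono) simp_all
  also have "\<dots> = exp (card (insert i A) * (l\<^sup>2 * c\<^sup>2 / 2))"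
    using insert.hyps by (simp add: exp_add[symmetric] algebra_simps)
  finally show ?case .
qed

lemma mcdiarmid_upper:
  fixes f :: "('k \<Rightarrow> real) \<Rightarrow> real" and c :: real
  assumes A: "finite A" "A \<noteq> {}" "disjoint_family_on B A"
    and f: "f \<in> borel_measurable P" "\<And>x. \<bar>f x\<bar> \<le> C"
    and dep: "\<And>x y. x \<in> space P \<Longrightarrow> y \<in> space P \<Longrightarrow> (\<forall>k\<in>(\<Union>j\<in>A. B j). x k = y k) \<Longrightarrow> f x = f y"
    and diff: "\<And>j x y. j \<in> A \<Longrightarrow> x \<in> space P \<Longrightarrow> y \<in> space P \<Longrightarrow> \<bar>f x - f (resample (B j) x y)\<bar> \<le> c"
    and c: "c > 0" and t: "t > 0"
  shows "P.prob {x \<in> space P. t < f x - integral\<^sup>L P f} \<le> exp (- (t\<^sup>2 / (2 * card A * c\<^sup>2)))"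
proof -
  let ?E = "integral\<^sup>L P f"
  have cA: "real (card A) > 0" using A by (simp add: card_gt_0_iff)
  \<comment> \<open>The minimiser of the Chernoff exponent.\<close>
  define l where "l = t / (card A * c\<^sup>2)"
  have l: "l > 0" using t cA c by (simp add: l_def)
  note [measurable] = f(1)
  have ib: "integrable P (\<lambda>x. exp (l * (f x - ?E)))"
  proof (rule P.integrable_const_bound[of _ "exp (l * (C - ?E))"])
    have "norm (exp (l * (f x - ?E))) \<le> exp (l * (C - ?E))" for x
      using l abs_le_D1[OF f(2)[of x]] by simp
    then show "AE x in P. norm (exp (l * (f x - ?E))) \<le> exp (l * (C - ?E))" by simp
  qed measurable
  have "{x \<in> space P. t < f x - ?E} = {x \<in> space P. exp (l * t) < exp (l * (f x - ?E))}"
    using l by simp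
  then have "P.prob {x \<in> space P. t < f x - ?E} \<le> (\<integral>x. exp (l * (f x - ?E)) \<partial>P) / exp (l * t)"
    using measure_Markov[OF P.finite_measure_axioms ib, of "exp (l * t)"] by simp
  also have "\<dots> \<le> exp (card A * (l\<^sup>2 * c\<^sup>2 / 2)) / exp (l * t)"
    by (intro divide_right_mono mcdiarmid_mgf[OF A(1,3) f dep diff l]) auto
  also have "\<dots> = exp (card A * (l\<^sup>2 * c\<^sup>2 / 2) - l * t)" by (simp add: exp_diff)
  also have "card A * (l\<^sup>2 * c\<^sup>2 / 2) - l * t = - (t\<^sup>2 / (2 * card A * c\<^sup>2))"
    using cA c by (simp add: l_def field_simps power2_eq_square)
  finally show ?thesis .
qed

lemma mcdiarmid:
  fixes f :: "('k \<Rightarrow> real) \<Rightarrow> real" and c :: real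
  assumes A: "finite A" "A \<noteq> {}" "disjoint_family_on B A"
    and f: "f \<in> borel_measurable P" "\<And>x. \<bar>f x\<bar> \<le> C"
    and dep: "\<And>x y. x \<in> space P \<Longrightarrow> y \<in> space P \<Longrightarrow> (\<forall>k\<in>(\<Union>j\<in>A. B j). x k = y k) \<Longrightarrow> f x = f y"
    and diff: "\<And>j x y. j \<in> A \<Longrightarrow> x \<in> space P \<Longrightarrow> y \<in> space P \<Longrightarrow> \<bar>f x - f (resample (B j) x y)\<bar> \<le> c"
    and c: "c > 0" and t: "t > 0"
  shows "P.prob {x \<in> space P. t < \<bar>f x - integral\<^sup>L P f\<bar>} \<le> 2 * exp (- (t\<^sup>2 / (2 * card A * c\<^sup>2)))"
proof -
  note [measurable] = f(1)
  let ?U = "{x \<in> space P. t < f x - integral\<^sup>L P f}" and ?L = "{x \<in> space P. t < - f x - integral\<^sup>L P (\<lambda>x. - f x)}"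
  have "{x \<in> space P. t < \<bar>f x - integral\<^sup>L P f\<bar>} = ?U \<union> ?L" by auto
  then have "P.prob {x \<in> space P. t < \<bar>f x - integral\<^sup>L P f\<bar>} \<le> P.prob ?U + P.prob ?L"
    using measure_Un_le[of ?U P ?L] by simp
  moreover have "P.prob ?U \<le> exp (- (t\<^sup>2 / (2 * card A * c\<^sup>2)))"
    by (rule mcdiarmid_upper[OF A f dep diff c t])
  moreover have "P.prob ?L \<le> exp (- (t\<^sup>2 / (2 * card A * c\<^sup>2)))"
  proof (rule mcdiarmid_upper[OF A, where C = C])
    show "- f x = - f y" if "x \<in> space P" "y \<in> space P" "\<forall>k\<in>(\<Union>j\<in>A. B j). x k = y k" for x y
      using dep[OF that] by simp
    show "\<bar>- f x - - f (resample (B j) x y)\<bar> \<le> c" if "j \<in> A" "x \<in> space P" "y \<in> space P" for j x y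
      using diff[OF that] by simp
  qed (use f c t in auto)
  ultimately show ?thesis by simp
qed

end

context wigner_resolvent
begin

text \<open>Both traces are compared with that of the minor without \<open>i\<close>, which the
  resampling does not touch.\<close>

lemma stieltjes_resample:
  assumes i: "i < n"
  shows "cmod (stieltjes x - stieltjes (resample (up i ` U) x y)) \<le> 2 / (n * \<eta>)"
proof -
  let ?x = "resample (up i ` U) x y" and ?T = "{..<n} - {i}"
  have d: "cmod (res_trace (H w) z {..<n} - res_trace (H w) z ?T) \<le> 1 / \<eta>" for w
    using i by (intro res.norm_res_trace_diff) auto
  have "cmod (res_trace (H x) z {..<n} - res_trace (H ?x) z {..<n})
     = cmod ((res_trace (H x) z {..<n} - res_trace (H x) z ?T) - (res_trace (H ?x) z {..<n} - res_trace (H ?x) z ?T))"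
    by (simp add: res_trace_resample)
  also have "\<dots> \<le> 1 / \<eta> + 1 / \<eta>"
    by (intro order_trans[OF norm_triangle_ineq4] add_mono d)
  finally have "cmod (res_trace (H x) z {..<n} - res_trace (H ?x) z {..<n}) / n \<le> (1 / \<eta> + 1 / \<eta>) / n"
    by (rule divide_right_mono) simp
  then show ?thesis
    by (simp add: stieltjes_def diff_divide_distrib[symmetric] norm_divide mult.commute)
qed

text \<open>The blocks are the rows of the lower triangle: they partition the coordinates into only
  \<open>n\<close> sets, each changing the trace by at most \<open>2 / (n \<eta>)\<close>. Single
  entries would give of order n^2 blocks and too weak an exponent. The factor 2 in the threshold
  pays for treating real and imaginary part separately.\<close>

lemma stieltjes_concentration:
  assumes t: "t > 0"
  shows "P.prob {x \<in> space P. 2 * t < cmod (stieltjes x - integral\<^sup>L P stieltjes)} \<le> 4 * exp (- (t\<^sup>2 * (n * \<eta>\<^sup>2) / 8))"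
proof -
  let ?B = "\<lambda>i. up i ` {..i}"
  have disj: "disjoint_family_on ?B {..<n}"
    by (auto simp: disjoint_family_on_def up_eq_iff)
  have un: "(\<Union>j\<in>{..<n}. ?B j) = upper_indices n"
  proof (intro equalityI subsetI)
    fix p assume "p \<in> upper_indices n"
    then obtain a b where p: "p = (a, b)" "a \<le> b" "b < n" by (auto simp: upper_indices_def)
    then have "p = up b a" by (simp add: up_def)
    then show "p \<in> (\<Union>j\<in>{..<n}. ?B j)" using p by auto
  next
    fix p assume "p \<in> (\<Union>j\<in>{..<n}. ?B j)"
    then show "p \<in> upper_indices n" by (auto intro: up_in_upper_indices)
  qed
  have ext: "x = y" if "x \<in> space P" "y \<in> space P" and eq: "\<forall>k\<in>(\<Union>j\<in>{..<n}. ?B j). x k = y k" for x y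
  proof (rule PiE_ext)
    show "x \<in> (\<Pi>\<^sub>E k\<in>upper_indices n. UNIV)" "y \<in> (\<Pi>\<^sub>E k\<in>upper_indices n. UNIV)"
      using that(1,2) by (simp_all add: P_def space_PiM)
    show "x k = y k" if "k \<in> upper_indices n" for k
      using eq that unfolding un by (rule bspec)
  qed
  have c: "2 / (n * \<eta>) > 0" using n_pos Im_pos by simp
  have nb: "cmod (stieltjes x) \<le> 1 / \<eta>" for x
    using divide_right_mono[OF res.norm_res_trace[of "{..<n}" x], of n] n_pos by (simp add: stieltjes_def norm_divide)
  have e: "t\<^sup>2 / (2 * card {..<n} * (2 / (n * \<eta>))\<^sup>2) = t\<^sup>2 * (n * \<eta>\<^sup>2) / 8"
    using n_pos Im_pos by (simp add: power_divide power_mult_distrib) (simp add: power2_eq_square)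
  have sm[measurable]: "stieltjes \<in> borel_measurable P" using integrable_stieltjes by simp
  have R: "P.prob {x \<in> space P. t < \<bar>Re (stieltjes x) - integral\<^sup>L P (\<lambda>x. Re (stieltjes x))\<bar>} \<le> 2 * exp (- (t\<^sup>2 * (n * \<eta>\<^sup>2) / 8))"
    unfolding e[symmetric]
  proof (rule mcdiarmid[OF _ _ disj _ _ _ _ c t, where C = "1 / \<eta>"])
    show "Re (stieltjes x) = Re (stieltjes y)" if "x \<in> space P" "y \<in> space P" "\<forall>k\<in>(\<Union>j\<in>{..<n}. ?B j). x k = y k" for x y
      using ext[OF that] by simp
    show "\<bar>Re (stieltjes x)\<bar> \<le> 1 / \<eta>" for x using abs_Re_le_cmod[of "stieltjes x"] nb[of x] by linarith
    show "\<bar>Re (stieltjes x) - Re (stieltjes (resample (?B j) x y))\<bar> \<le> 2 / (n * \<eta>)" if "j \<in> {..<n}" for j x y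
      using stieltjes_resample[of j x "{..j}" y] abs_Re_le_cmod[of "stieltjes x - stieltjes (resample (?B j) x y)"] that by simp
  qed (use n_pos in auto)
  have I: "P.prob {x \<in> space P. t < \<bar>Im (stieltjes x) - integral\<^sup>L P (\<lambda>x. Im (stieltjes x))\<bar>} \<le> 2 * exp (- (t\<^sup>2 * (n * \<eta>\<^sup>2) / 8))"
    unfolding e[symmetric]
  proof (rule mcdiarmid[OF _ _ disj _ _ _ _ c t, where C = "1 / \<eta>"])
    show "Im (stieltjes x) = Im (stieltjes y)" if "x \<in> space P" "y \<in> space P" "\<forall>k\<in>(\<Union>j\<in>{..<n}. ?B j). x k = y k" for x y
      using ext[OF that] by simp
    show "\<bar>Im (stieltjes x)\<bar> \<le> 1 / \<eta>" for x using abs_Im_le_cmod[of "stieltjes x"] nb[of x] by linarith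
    show "\<bar>Im (stieltjes x) - Im (stieltjes (resample (?B j) x y))\<bar> \<le> 2 / (n * \<eta>)" if "j \<in> {..<n}" for j x y
      using stieltjes_resample[of j x "{..j}" y] abs_Im_le_cmod[of "stieltjes x - stieltjes (resample (?B j) x y)"] that by simp
  qed (use n_pos in auto)
  let ?R = "{x \<in> space P. t < \<bar>Re (stieltjes x) - integral\<^sup>L P (\<lambda>x. Re (stieltjes x))\<bar>}"
  let ?I = "{x \<in> space P. t < \<bar>Im (stieltjes x) - integral\<^sup>L P (\<lambda>x. Im (stieltjes x))\<bar>}"
  have "{x \<in> space P. 2 * t < cmod (stieltjes x - integral\<^sup>L P stieltjes)} \<subseteq> ?R \<union> ?I"
  proof
    fix x assume x: "x \<in> {x \<in> space P. 2 * t < cmod (stieltjes x - integral\<^sup>L P stieltjes)}"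
    have "2 * t < \<bar>Re (stieltjes x - integral\<^sup>L P stieltjes)\<bar> + \<bar>Im (stieltjes x - integral\<^sup>L P stieltjes)\<bar>"
      using x cmod_le[of "stieltjes x - integral\<^sup>L P stieltjes"] by simp
    then have "t < \<bar>Re (stieltjes x) - Re (integral\<^sup>L P stieltjes)\<bar> \<or> t < \<bar>Im (stieltjes x) - Im (integral\<^sup>L P stieltjes)\<bar>"
      by auto
    then show "x \<in> ?R \<union> ?I"
      using x integral_Re[OF integrable_stieltjes] integral_Im[OF integrable_stieltjes] by simp
  qed
  then have "P.prob {x \<in> space P. 2 * t < cmod (stieltjes x - integral\<^sup>L P stieltjes)} \<le> P.prob (?R \<union> ?I)"
    by (rule P.finite_measure_mono) measurable
  also have "\<dots> \<le> P.prob ?R + P.prob ?I" by (rule measure_Un_le) measurable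
  finally show ?thesis using R I by simp
qed

end

section \<open>The local law along a sequence of spectral parameters\<close>

locale unit_variance = prob_space \<mu> for \<mu> :: "real measure" +
  assumes sets_mu: "sets \<mu> = sets borel" and int4: "integrable \<mu> (\<lambda>x. x ^ 4)"
    and mean: "integral\<^sup>L \<mu> (\<lambda>x. x) = 0" and var: "integral\<^sup>L \<mu> (\<lambda>x. x\<^sup>2) = 1"
begin

lemma wigner_resolvent:
  assumes "Im z > 0" "Im z \<le> 1" "1 / (sqrt n * Im z) \<le> 1" "n > 0"
  shows "wigner_resolvent \<mu> n (integral\<^sup>L \<mu> (\<lambda>x. x ^ 4)) z"
proof -
  have "1 \<le> sqrt n * Im z" using assms by (simp add: field_simps)
  then have "1\<^sup>2 \<le> (sqrt n * Im z)\<^sup>2" by (intro power_mono) auto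
  then have "1 \<le> n * (Im z)\<^sup>2" by (simp add: power_mult_distrib)
  then show ?thesis
    using assms by unfold_locales (simp_all add: finite_upper_indices sets_mu int4 mean var)
qed

text \<open>One rate serves all unit vectors: the bounds of the bootstrap depend on \<open>u\<close>
  only through its norm. The vector can therefore be chosen after the rate, in particular at random
  and independently.\<close>

lemma local_law:
  fixes z :: "nat \<Rightarrow> complex" and m :: complex and \<delta> t :: real
  assumes m: "Im m > 0" "cmod m = 1"
    and z: "\<And>n. n \<ge> 1 \<Longrightarrow> Im (z n) > 0" "(\<lambda>n. Im (z n)) \<longlonglongrightarrow> 0"
      "(\<lambda>n. cmod (z n + of_real (2 * Re m))) \<longlonglongrightarrow> 0"
    and \<delta>: "\<delta> > 0" "(\<lambda>n. real n powr \<delta> / (sqrt n * Im (z n))) \<longlonglongrightarrow> 0"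
    and t: "t > 0"
  shows "\<exists>e. e \<longlonglongrightarrow> 0 \<and> (\<forall>\<^sub>F n in sequentially.
     measure (\<Pi>\<^sub>M k\<in>upper_indices n. \<mu>) {x \<in> space (\<Pi>\<^sub>M k\<in>upper_indices n. \<mu>).
        t < cmod (res_trace (wigner n x) (z n) {..<n} / n - m)} \<le> e n \<and>
     (\<forall>u. (\<Sum>i<n. (u i)\<^sup>2) = 1 \<longrightarrow>
       measure (\<Pi>\<^sub>M k\<in>upper_indices n. \<mu>) {x \<in> space (\<Pi>\<^sub>M k\<in>upper_indices n. \<mu>).
        t < cmod (res_form (wigner n x) (z n) {..<n} u - m)} \<le> e n))"
proof -
  define \<kappa> where "\<kappa> = integral\<^sup>L \<mu> (\<lambda>x. x ^ 4)"
  define C where "C = 30 + 6 * \<kappa>"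
  define \<eta> where "\<eta> = (\<lambda>n. Im (z n))"
  define r where "r = (\<lambda>n. 1 / (sqrt (real n) * \<eta> n))"
  define w where "w = (\<lambda>n. cmod (z n + of_real (2 * Re m)))"
  define d where "d = (\<lambda>n. 2 / Im m * (2 * C * r n + w n))"
  \<comment> \<open>The bound of \<open>isotropic_law\<close> with \<open>D\<close> written out,
    plus Markov's bound \<open>d n / t\<close> for the trace.\<close>
  define e where "e = (\<lambda>n. \<eta> n + 2 * (r n * (4 * (2 * (5 + 5 * C) + 1) + 2 + 5 * C) / 2 + w n + d n) / t + d n / t)"
  \<comment> \<open>With \<open>r n <= n^(-\<delta>)\<close> this makes the \<open>j\<close>-th
    power of \<open>r n\<close> at most 1 / n, which beats \<open>1 / \<eta> n <= sqrt n\<close>.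
    The bootstrap depth \<open>k\<close> is one larger because \<open>isotropic_law\<close> iterates
    \<open>k - 1\<close> times.\<close>
  obtain j :: nat where j: "real j * \<delta> \<ge> 1"
    using reals_Archimedean3[OF \<delta>(1), rule_format, of 1] by (auto intro: less_imp_le)
  define k where "k = Suc j"
  have \<eta>0: "\<eta> \<longlonglongrightarrow> 0" and w0: "w \<longlonglongrightarrow> 0" using z unfolding \<eta>_def w_def by auto
  have ev_r: "\<forall>\<^sub>F n in sequentially. real n powr \<delta> * r n \<le> 1"
    using order_tendstoD(2)[OF \<delta>(2), of 1] by (auto elim!: eventually_mono simp: r_def \<eta>_def)
  have r_le: "0 \<le> r n" "r n \<le> real n powr \<delta> * r n" if "n \<ge> 1" for n
  proof -
    show "0 \<le> r n" using z(1)[OF that] by (simp add: r_def \<eta>_def)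
    then show "r n \<le> real n powr \<delta> * r n"
      using that \<delta>(1) ge_one_powr_ge_zero[of "real n" \<delta>] mult_right_mono[of 1 "real n powr \<delta>" "r n"] by simp
  qed
  have r0: "r \<longlonglongrightarrow> 0"
  proof (rule tendsto_sandwich[OF _ _ tendsto_const])
    show "(\<lambda>n. real n powr \<delta> * r n) \<longlonglongrightarrow> 0" using \<delta>(2) by (simp add: r_def \<eta>_def)
    show "\<forall>\<^sub>F n in sequentially. 0 \<le> r n" using r_le(1) by (auto intro: eventually_sequentiallyI[of 1])
    show "\<forall>\<^sub>F n in sequentially. r n \<le> real n powr \<delta> * r n" using r_le(2) by (auto intro: eventually_sequentiallyI[of 1])
  qed
  have d0: "d \<longlonglongrightarrow> 0"
    unfolding d_def by (intro tendsto_mult_right_zero tendsto_add_zero r0 w0)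
  have e0: "e \<longlonglongrightarrow> 0"
  proof -
    have "e \<longlonglongrightarrow> 0 + 2 * (0 * (4 * (2 * (5 + 5 * C) + 1) + 2 + 5 * C) / 2 + 0 + 0) / t + 0 / t"
      unfolding e_def using t by (intro tendsto_intros r0 d0 w0 \<eta>0) auto
    then show ?thesis by simp
  qed
  have small: "\<forall>\<^sub>F n in sequentially. f n \<le> c" if "f \<longlonglongrightarrow> 0" "c > 0" for f :: "nat \<Rightarrow> real" and c
    using order_tendstoD(2)[OF that] by (auto elim!: eventually_mono)
  have ev1: "\<forall>\<^sub>F n in sequentially. 4 ^ j * sqrt n / n \<le> 1"
    by (rule small) (real_asymp, simp)
  \<comment> \<open>The exponential in n^(2 \<delta>) must fall below n^(-1/2), a lower bound for
    the imaginary part once \<open>r n <= 1\<close>.\<close>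
  have ev2: "\<forall>\<^sub>F n in sequentially. 4 * sqrt n * exp (- ((1 / 32)\<^sup>2 * (real n powr (2 * \<delta>)) / 8)) \<le> 1"
    by (rule small) (use \<delta>(1) in real_asymp, simp)
  have Crw: "(\<lambda>n. C * r n + w n) \<longlonglongrightarrow> 0" by (intro tendsto_add_zero tendsto_mult_right_zero r0 w0)
  have kr: "(\<lambda>n. 2 * real k * r n) \<longlonglongrightarrow> 0" by (intro tendsto_mult_right_zero r0)
  have "\<forall>\<^sub>F n in sequentially. n \<ge> 1 \<and> real n powr \<delta> * r n \<le> 1 \<and> r n \<le> 1 / 8 \<and> \<eta> n \<le> 1 \<and> w n \<le> 1 / 4 \<and>
    C * r n + w n \<le> Im m / 2 \<and> d n \<le> 1 / 16 \<and> 2 * real k * r n \<le> 1 / 8 \<and> 4 ^ j * sqrt n / n \<le> 1 \<and>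
    4 * sqrt n * exp (- ((1 / 32)\<^sup>2 * (real n powr (2 * \<delta>)) / 8)) \<le> 1"
    using m by (intro eventually_conj eventually_ge_at_top ev_r ev1 ev2 small r0 \<eta>0 w0 d0 Crw kr) auto
  then have "\<forall>\<^sub>F n in sequentially.
     measure (\<Pi>\<^sub>M k\<in>upper_indices n. \<mu>) {x \<in> space (\<Pi>\<^sub>M k\<in>upper_indices n. \<mu>).
        t < cmod (res_trace (wigner n x) (z n) {..<n} / n - m)} \<le> e n \<and>
     (\<forall>u. (\<Sum>i<n. (u i)\<^sup>2) = 1 \<longrightarrow>
       measure (\<Pi>\<^sub>M k\<in>upper_indices n. \<mu>) {x \<in> space (\<Pi>\<^sub>M k\<in>upper_indices n. \<mu>).
        t < cmod (res_form (wigner n x) (z n) {..<n} u - m)} \<le> e n)"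
  proof eventually_elim
    case (elim n)
    then have n: "n \<ge> 1" and el: "real n powr \<delta> * r n \<le> 1" "r n \<le> 1 / 8" "\<eta> n \<le> 1" "w n \<le> 1 / 4"
      "C * r n + w n \<le> Im m / 2" "d n \<le> 1 / 16" "2 * real k * r n \<le> 1 / 8" "4 ^ j * sqrt n / n \<le> 1"
      "4 * sqrt n * exp (- ((1 / 32)\<^sup>2 * (real n powr (2 * \<delta>)) / 8)) \<le> 1" by auto
    have \<eta>: "\<eta> n > 0" using z(1)[OF n] by (simp add: \<eta>_def)
    interpret W: wigner_resolvent \<mu> n \<kappa> "z n"
      unfolding \<kappa>_def by (rule wigner_resolvent) (use n \<eta> el(2,3) in \<open>auto simp: \<eta>_def r_def\<close>)
    have rho: "W.rho = r n" and C1: "W.C1 = C" by (simp_all add: W.rho_def r_def \<eta>_def W.C1_def C_def)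
    have rn: "0 < r n" using W.rho_pos rho by simp
    have C0: "C \<ge> 30" using W.C1_ge C1 by simp
    have w_n: "0 \<le> w n" by (simp add: w_def)
    have d_n: "0 \<le> d n" using m rn C0 w_n by (simp add: d_def)
    have law: "(\<integral>x. cmod (W.stieltjes x - m) \<partial>W.P) \<le> d n"
      "W.mean_Im_trace {..<n} \<le> 1 + (\<integral>x. cmod (W.stieltjes x - m) \<partial>W.P)"
      using W.trace_law[OF m] el(5) unfolding rho C1 d_def w_def by simp_all
    have si: "integrable W.P (\<lambda>x. cmod (W.stieltjes x - m))"
      using W.integrable_stieltjes by (intro integrable_norm) simp
    have Es: "cmod (integral\<^sup>L W.P W.stieltjes - m) \<le> 1 / 16"
    proof -
      have "integral\<^sup>L W.P W.stieltjes - m = (\<integral>x. W.stieltjes x - m \<partial>W.P)"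
        using W.integrable_stieltjes by (simp add: W.P.prob_space)
      also have "cmod \<dots> \<le> (\<integral>x. cmod (W.stieltjes x - m) \<partial>W.P)" by (rule integral_norm_bound)
      finally show ?thesis using law(1) el(6) by linarith
    qed
    have inv\<eta>: "1 / \<eta> n = r n * sqrt n" using n by (simp add: r_def)
    have powr: "real n powr (2 * \<delta>) \<le> n * (\<eta> n)\<^sup>2"
    proof -
      have "real n powr \<delta> \<le> sqrt n * \<eta> n"
        using el(1) n \<eta> by (simp add: r_def pos_divide_le_eq)
      then have "(real n powr \<delta>)\<^sup>2 \<le> (sqrt n * \<eta> n)\<^sup>2" by (intro power_mono) auto
      then show ?thesis using n by (simp add: power_mult_distrib powr_power mult.commute)
    qed
    \<comment> \<open>The mean of the trace is within 1/16 of \<open>m\<close>, so leaving the 1/8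
      ball around \<open>m\<close> means moving more than 1/16 = 2 * (1/32) away from the
      mean.\<close>
    have "W.P.prob {x \<in> space W.P. 1 / 8 < cmod (W.stieltjes x - m)}
       \<le> W.P.prob {x \<in> space W.P. 2 * (1 / 32) < cmod (W.stieltjes x - integral\<^sup>L W.P W.stieltjes)}"
    proof (rule W.P.finite_measure_mono)
      show "{x \<in> space W.P. 1 / 8 < cmod (W.stieltjes x - m)}
        \<subseteq> {x \<in> space W.P. 2 * (1 / 32) < cmod (W.stieltjes x - integral\<^sup>L W.P W.stieltjes)}"
      proof safe
        fix x assume "1 / 8 < cmod (W.stieltjes x - m)"
        moreover have "cmod (W.stieltjes x - m) \<le> cmod (W.stieltjes x - integral\<^sup>L W.P W.stieltjes) + cmod (integral\<^sup>L W.P W.stieltjes - m)"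
          using norm_triangle_ineq[of "W.stieltjes x - integral\<^sup>L W.P W.stieltjes" "integral\<^sup>L W.P W.stieltjes - m"] by simp
        ultimately show "2 * (1 / 32) < cmod (W.stieltjes x - integral\<^sup>L W.P W.stieltjes)" using Es by linarith
      qed
      have [measurable]: "W.stieltjes \<in> borel_measurable W.P" using W.integrable_stieltjes by simp
      show "{x \<in> space W.P. 2 * (1 / 32) < cmod (W.stieltjes x - integral\<^sup>L W.P W.stieltjes)} \<in> sets W.P"
        by measurable
    qed
    also have "\<dots> \<le> 4 * exp (- ((1 / 32)\<^sup>2 * (n * (\<eta> n)\<^sup>2) / 8))"
      using W.stieltjes_concentration[of "1 / 32"] by (simp add: \<eta>_def)
    also have "\<dots> \<le> 4 * exp (- ((1 / 32)\<^sup>2 * (real n powr (2 * \<delta>)) / 8))"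
      using powr by simp
    also have "\<dots> \<le> \<eta> n"
    proof -
      have "4 * exp (- ((1 / 32)\<^sup>2 * (real n powr (2 * \<delta>)) / 8)) \<le> 1 / sqrt n"
        using el(9) n by (simp add: field_simps)
      also have "\<dots> \<le> \<eta> n"
      proof -
        have "1 / \<eta> n \<le> 1 * sqrt n" unfolding inv\<eta> using el(2) by (intro mult_right_mono) auto
        then show ?thesis using \<eta> n by (simp add: field_simps)
      qed
      finally show ?thesis .
    qed
    finally have bad: "W.P.prob {x \<in> space W.P. 1 / 8 < cmod (W.stieltjes x - m)} \<le> \<eta> n" .
    have k_small: "2 * real k / (n * \<eta> n) \<le> 1 / 8"
    proof -
      have "sqrt n * 1 \<le> sqrt n * sqrt n" using n by (intro mult_left_mono) auto
      then have "sqrt n * \<eta> n \<le> n * \<eta> n" using \<eta> by simp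
      then have "1 / (n * \<eta> n) \<le> r n"
        using n \<eta> unfolding r_def by (intro divide_left_mono mult_pos_pos) auto
      then have "2 * real k * (1 / (n * \<eta> n)) \<le> 2 * real k * r n" by (intro mult_left_mono) auto
      then show ?thesis using el(7) by simp
    qed
    have pow: "(4 * r n) ^ (k - 1) / \<eta> n \<le> 1"
    proof -
      have "r n \<le> real n powr (- \<delta>)"
        using el(1) n by (simp add: powr_minus field_simps)
      then have "(r n) ^ j \<le> (real n powr (- \<delta>)) ^ j" using rn by (intro power_mono) auto
      also have "\<dots> = real n powr (- (j * \<delta>))" using n by (simp add: powr_power)
      also have "\<dots> \<le> real n powr (- 1)" using j n by (intro powr_mono) auto
      also have "\<dots> = 1 / n" using n by (simp add: powr_minus_divide)
      finally have rj: "(r n) ^ j \<le> 1 / n" .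
      have "(4 * r n) ^ (k - 1) / \<eta> n = 4 ^ j * ((r n) ^ j * (1 / \<eta> n))"
        by (simp add: k_def power_mult_distrib)
      also have "\<dots> \<le> 4 ^ j * ((1 / n) * (1 * sqrt n))"
        unfolding inv\<eta> using rj rn el(2) by (intro mult_left_mono mult_mono) auto
      also have "\<dots> \<le> 1" using el(8) by simp
      finally show ?thesis .
    qed
    have PiM: "W.P = (\<Pi>\<^sub>M k\<in>upper_indices n. \<mu>)" by (simp add: W.P_def)
    have "W.P.prob {x \<in> space W.P. t < cmod (W.stieltjes x - m)} \<le> (\<integral>x. cmod (W.stieltjes x - m) \<partial>W.P) / t"
      by (rule measure_Markov[OF W.P.finite_measure_axioms si _ t]) simp
    also have "\<dots> \<le> d n / t" using law(1) t by (intro divide_right_mono) auto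
    also have "\<dots> \<le> e n" unfolding e_def using \<eta> rn C0 w_n d_n t by simp
    finally have A: "W.P.prob {x \<in> space W.P. t < cmod (W.stieltjes x - m)} \<le> e n" .
    have B: "W.P.prob {x \<in> space W.P. t < cmod (res_form (wigner n x) (z n) {..<n} u - m)} \<le> e n"
      if u: "(\<Sum>i<n. (u i)\<^sup>2) = 1" for u
    proof -
      interpret B: wigner_bulk \<mu> n \<kappa> "z n" m k u
        by unfold_locales (use m el law bad k_small rho u in \<open>auto simp: w_def \<eta>_def\<close>)
      have "W.P.prob {x \<in> space W.P. t < cmod (res_form (wigner n x) (z n) {..<n} u - m)} \<le>
        \<eta> n + 2 * (r n * (4 * (2 * (5 + 5 * C) + 1) + 2 + 5 * C) / 2 + w n + (\<integral>x. cmod (W.stieltjes x - m) \<partial>W.P)) / t"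
        using B.isotropic_law[OF _ _ u t] pow unfolding rho B.D_def C1 by (simp add: k_def \<eta>_def w_def)
      also have "\<dots> \<le> \<eta> n + 2 * (r n * (4 * (2 * (5 + 5 * C) + 1) + 2 + 5 * C) / 2 + w n + d n) / t + d n / t"
        using law(1) t d_n by (intro order_trans[OF _ add_increasing2[OF _ order_refl]] add_left_mono divide_right_mono mult_left_mono) auto
      finally show ?thesis by (simp add: e_def)
    qed
    show ?case using A B unfolding W.stieltjes_def PiM by simp
  qed
  with e0 show ?thesis by blast
qed

end

section \<open>Poisson kernels and windows\<close>

text \<open>Normalised without 1 / pi, so that it is the imaginary part of a resolvent.\<close>

definition poisson :: "real \<Rightarrow> real \<Rightarrow> real \<Rightarrow> real" where
  "poisson E h t = h / ((t - E)\<^sup>2 + h\<^sup>2)"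

lemma Im_inverse_poisson: "Im (1 / (of_real t - Complex E h)) = poisson E h t"
  by (simp add: poisson_def Im_divide)

lemma poisson_nonneg: "h > 0 \<Longrightarrow> 0 \<le> poisson E h t"
  by (simp add: poisson_def)

text \<open>The hypotenuse \<open>X\<close> with legs \<open>t - E\<close> and \<open>h\<close>
  grows by at most \<open>d\<close> when the centre moves by \<open>d\<close>, and
  \<open>d <= X * d / h\<close> because \<open>h <= X\<close>. A multiplicative comparison is
  uniform in \<open>t\<close>, including the tails.\<close>

lemma poisson_harnack:
  assumes h: "h > 0" and E: "\<bar>E - E'\<bar> \<le> d"
  shows "poisson E h t \<le> (1 + d / h)\<^sup>2 * poisson E' h t"
proof -
  define X where "X = sqrt ((t - E)\<^sup>2 + h\<^sup>2)"
  have X2: "X\<^sup>2 = (t - E)\<^sup>2 + h\<^sup>2" by (simp add: X_def)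
  have Xh: "h \<le> X" unfolding X_def using h by (intro real_le_rsqrt) simp
  have Xt: "\<bar>t - E\<bar> \<le> X" unfolding X_def by (intro real_le_rsqrt) simp
  have d0: "0 \<le> d" using E by linarith
  have "(t - E')\<^sup>2 \<le> (\<bar>t - E\<bar> + d)\<^sup>2"
    using E by (intro abs_le_square_iff[THEN iffD1]) linarith
  then have "(t - E')\<^sup>2 + h\<^sup>2 \<le> X\<^sup>2 + 2 * d * \<bar>t - E\<bar> + d\<^sup>2"
    by (simp add: X2 power2_sum algebra_simps)
  also have "\<dots> \<le> X\<^sup>2 + 2 * d * X + d\<^sup>2" using Xt d0 by (simp add: mult_left_mono)
  also have "\<dots> = (X + d)\<^sup>2" by (simp add: power2_sum)
  also have "\<dots> \<le> (X * (1 + d / h))\<^sup>2"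
  proof (rule power_mono)
    have "d * 1 \<le> d * (X / h)" using Xh h d0 by (intro mult_left_mono) auto
    then show "X + d \<le> X * (1 + d / h)" by (simp add: algebra_simps)
  qed (use Xh h d0 in auto)
  finally have le: "(t - E')\<^sup>2 + h\<^sup>2 \<le> (1 + d / h)\<^sup>2 * ((t - E)\<^sup>2 + h\<^sup>2)"
    by (simp add: power_mult_distrib X2 mult.commute)
  define A where "A = (t - E)\<^sup>2 + h\<^sup>2"
  define B where "B = (t - E')\<^sup>2 + h\<^sup>2"
  have p: "0 < A" "0 < B" using h by (auto simp: A_def B_def add_nonneg_pos)
  have "h * B \<le> h * ((1 + d / h)\<^sup>2 * A)"
    unfolding A_def B_def using le h by (intro mult_left_mono) auto
  then have "h / A \<le> ((1 + d / h)\<^sup>2 * h) / B"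
    using p by (simp add: pos_divide_le_eq pos_le_divide_eq mult_ac)
  then show ?thesis by (simp add: poisson_def A_def B_def)
qed

text \<open>The integral of \<open>poisson E h t\<close> over \<open>E\<close> from
  \<open>- a\<close> to \<open>a\<close> in closed form; \<open>grid_sum\<close> is its Riemann sum
  with \<open>N\<close> left endpoints.\<close>

definition arctan_window :: "real \<Rightarrow> real \<Rightarrow> real \<Rightarrow> real" where
  "arctan_window a h t = arctan ((a - t) / h) + arctan ((a + t) / h)"

definition grid_sum :: "real \<Rightarrow> real \<Rightarrow> nat \<Rightarrow> real \<Rightarrow> real" where
  "grid_sum a h N t = (\<Sum>l<N. 2 * a / real N * poisson (- a + 2 * a / real N * real l) h t)"

lemma arctan_increment:
  assumes h: "h > 0" and d: "d > 0"
  shows "\<exists>E'. E < E' \<and> E' < E + d \<and> arctan ((E + d - t) / h) - arctan ((E - t) / h) = d * poisson E' h t"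
proof -
  have der: "((\<lambda>E. arctan ((E - t) / h)) has_real_derivative poisson E h t) (at E)" for E
  proof -
    have "((\<lambda>E. arctan ((E - t) / h)) has_real_derivative inverse (1 + ((E - t) / h)\<^sup>2) * (1 / h)) (at E)"
      using h by (auto intro!: derivative_eq_intros)
    also have "inverse (1 + ((E - t) / h)\<^sup>2) * (1 / h) = poisson E h t"
    proof -
      have "1 + ((E - t) / h)\<^sup>2 = ((t - E)\<^sup>2 + h\<^sup>2) / h\<^sup>2"
        using h by (simp add: power_divide add_divide_distrib power2_commute)
      then show ?thesis using h by (simp add: poisson_def power2_eq_square)
    qed
    finally show ?thesis .
  qed
  obtain E' where "E < E'" "E' < E + d" "arctan ((E + d - t) / h) - arctan ((E - t) / h) = (E + d - E) * poisson E' h t"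
    using MVT2[of E "E + d" "\<lambda>E. arctan ((E - t) / h)" "\<lambda>E. poisson E h t"] der d by auto
  then show ?thesis by auto
qed

text \<open>On each cell the integral is the mesh times the kernel at an intermediate centre, which
  Harnack compares with the kernel at the left endpoint.\<close>

lemma grid_sum_bounds:
  assumes a: "a > 0" and h: "h > 0" and N: "N > 0"
  defines "q \<equiv> (1 + (2 * a / N) / h)\<^sup>2"
  shows "arctan_window a h t \<le> q * grid_sum a h N t" "grid_sum a h N t \<le> q * arctan_window a h t"
proof -
  define d where "d = 2 * a / N"
  define E where "E = (\<lambda>l::nat. - a + d * l)"
  have d: "d > 0" using a N by (simp add: d_def)
  have EN: "E N = a" "E 0 = - a" using N by (simp_all add: E_def d_def)
  have ES: "E (Suc l) = E l + d" for l by (simp add: E_def algebra_simps)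
  have "arctan_window a h t = arctan ((E N - t) / h) - arctan ((E 0 - t) / h)"
    using arctan_minus[of "(a + t) / h"] by (simp add: EN arctan_window_def minus_divide_left)
  also have "\<dots> = (\<Sum>l<N. arctan ((E (Suc l) - t) / h) - arctan ((E l - t) / h))"
    by (rule sum_lessThan_telescope[symmetric])
  finally have A: "arctan_window a h t = (\<Sum>l<N. arctan ((E l + d - t) / h) - arctan ((E l - t) / h))"
    by (simp only: ES)
  have inc: "arctan ((E l + d - t) / h) - arctan ((E l - t) / h) \<le> q * (d * poisson (E l) h t) \<and>
     d * poisson (E l) h t \<le> q * (arctan ((E l + d - t) / h) - arctan ((E l - t) / h))" for l
  proof -
    obtain E' where E': "E l < E'" "E' < E l + d"
      "arctan ((E l + d - t) / h) - arctan ((E l - t) / h) = d * poisson E' h t"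
      using arctan_increment[OF h d] by blast
    have "poisson E' h t \<le> q * poisson (E l) h t" "poisson (E l) h t \<le> q * poisson E' h t"
      unfolding q_def d_def[symmetric] using E' by (auto intro!: poisson_harnack h)
    then have "d * poisson E' h t \<le> d * (q * poisson (E l) h t)" "d * poisson (E l) h t \<le> d * (q * poisson E' h t)"
      using d by (auto intro!: mult_left_mono)
    then show ?thesis unfolding E'(3) by (simp add: mult_ac)
  qed
  have G: "grid_sum a h N t = (\<Sum>l<N. d * poisson (E l) h t)" by (simp add: grid_sum_def d_def E_def)
  show "arctan_window a h t \<le> q * grid_sum a h N t"
    unfolding A G sum_distrib_left by (intro sum_mono) (use inc in blast)
  show "grid_sum a h N t \<le> q * arctan_window a h t"
    unfolding A G sum_distrib_left by (intro sum_mono) (use inc in blast)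
qed

lemma arctan_ge: "y > 0 \<Longrightarrow> pi / 2 - 1 / y \<le> arctan y"
  using arctan_inverse[of y] arctan_le_self[of "1 / y"] by (simp add: sgn_if inverse_eq_divide)

text \<open>The height \<open>s^3\<close> is small against the margin \<open>s\<close>: both
  arguments are at least \<open>s^(-2)\<close>, so each arctangent misses pi / 2 by at most
  \<open>s^2\<close>.\<close>

lemma arctan_window_inside:
  assumes s: "0 < s" "s \<le> 1" and t: "\<bar>t\<bar> \<le> 1"
  shows "pi * (1 - s) \<le> arctan_window (1 + s) (s ^ 3) t"
proof -
  have *: "pi / 2 - s\<^sup>2 \<le> arctan (b / s ^ 3)" if "s \<le> b" for b
  proof -
    have "1 / s\<^sup>2 = s / s ^ 3" using s by (simp add: power2_eq_square power3_eq_cube)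
    also have "\<dots> \<le> b / s ^ 3" using that s by (intro divide_right_mono) auto
    finally have "arctan (1 / s\<^sup>2) \<le> arctan (b / s ^ 3)" by (rule arctan_monotone')
    moreover have "pi / 2 - s\<^sup>2 \<le> arctan (1 / s\<^sup>2)" using arctan_ge[of "1 / s\<^sup>2"] s by simp
    ultimately show ?thesis by linarith
  qed
  have "pi / 2 - s\<^sup>2 \<le> arctan ((1 + s - t) / s ^ 3)" "pi / 2 - s\<^sup>2 \<le> arctan ((1 + s + t) / s ^ 3)"
    using t by (intro *; linarith)+
  then have "pi - 2 * s\<^sup>2 \<le> arctan_window (1 + s) (s ^ 3) t" by (simp add: arctan_window_def)
  moreover have "2 * s\<^sup>2 \<le> pi * s"
    using s pi_ge_two mult_mono[of 2 pi "s\<^sup>2" s] by (simp add: power2_eq_square mult_left_le)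
  ultimately show ?thesis by (simp add: algebra_simps)
qed

lemma arctan_window_le_pi: "arctan_window a h t \<le> pi"
  using arctan_ubound[of "(a - t) / h"] arctan_ubound[of "(a + t) / h"] by (simp add: arctan_window_def)

lemma arctan_window_minus: "arctan_window a h (- t) = arctan_window a h t"
  by (simp add: arctan_window_def add.commute)

text \<open>Outside the unit interval the smoothed window is dominated by a small multiple of one
  kernel of height 1, so a single further Poisson integral controls the whole tail.\<close>

lemma arctan_window_outside:
  assumes s: "0 < s" "s < 1" and t: "1 < \<bar>t\<bar>"
  shows "arctan_window (1 - s) (s ^ 3) t \<le> 4 * s * poisson 0 1 t"
proof -
  have pos: "arctan_window (1 - s) (s ^ 3) t \<le> 4 * s * poisson 0 1 t" if t: "t > 1" for t
  proof -
    define h where "h = s ^ 3"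
    have h: "h > 0" using s by (simp add: h_def)
    obtain E' where E': "- (1 - s) < E'" "E' < - (1 - s) + 2 * (1 - s)"
      "arctan ((- (1 - s) + 2 * (1 - s) - t) / h) - arctan ((- (1 - s) - t) / h) = 2 * (1 - s) * poisson E' h t"
      using arctan_increment[OF h, of "2 * (1 - s)" "- (1 - s)" t] s by auto
    have "arctan ((- (1 - s) - t) / h) = - arctan ((1 - s + t) / h)"
      by (simp add: arctan_minus[symmetric] minus_divide_left)
    then have "arctan_window (1 - s) h t = 2 * (1 - s) * poisson E' h t"
      using E'(3) by (simp add: arctan_window_def)
    also have "\<dots> \<le> 2 * poisson E' h t" using s poisson_nonneg[OF h, of E' t] by (intro mult_right_mono) auto
    \<comment> \<open>The centre lies below \<open>1 - s\<close> and \<open>t > 1\<close>, hence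
      \<open>t - E' >= s * t\<close>; the numerator \<open>s^3\<close> leaves a factor
      \<open>s\<close>.\<close>
    also have "poisson E' h t \<le> h / (s * t)\<^sup>2"
      unfolding poisson_def
    proof (rule divide_left_mono)
      have "(1 - s) * 1 \<le> (1 - s) * t" using s t by (intro mult_left_mono) auto
      then have "s * t \<le> t - E'" using E' by (simp add: algebra_simps)
      then have "(s * t)\<^sup>2 \<le> (t - E')\<^sup>2" using s t by (intro power_mono) auto
      then show "(s * t)\<^sup>2 \<le> (t - E')\<^sup>2 + h\<^sup>2" by (simp add: add_increasing2)
      show "0 < ((t - E')\<^sup>2 + h\<^sup>2) * (s * t)\<^sup>2" using s t h by (intro mult_pos_pos add_nonneg_pos) auto
    qed (use h in simp)
    also have "h / (s * t)\<^sup>2 = s / t\<^sup>2"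
      using s t by (simp add: h_def power_mult_distrib power2_eq_square power3_eq_cube)
    also have "s / t\<^sup>2 \<le> s * (2 / (t\<^sup>2 + 1))"
    proof -
      have t2: "1 \<le> t\<^sup>2" using t by simp
      then have "2 / (2 * t\<^sup>2) \<le> 2 / (t\<^sup>2 + 1)" by (intro divide_left_mono mult_pos_pos) auto
      then have "1 / t\<^sup>2 \<le> 2 / (t\<^sup>2 + 1)" by simp
      then have "s * (1 / t\<^sup>2) \<le> s * (2 / (t\<^sup>2 + 1))" using s by (intro mult_left_mono) auto
      then show ?thesis by simp
    qed
    finally show ?thesis by (simp add: h_def poisson_def)
  qed
  show ?thesis
  proof (cases "t > 0")
    case True
    then show ?thesis using pos t by simp
  next
    case False
    then have "- t > 1" using t by simp
    then have "arctan_window (1 - s) (s ^ 3) (- t) \<le> 4 * s * poisson 0 1 (- t)" by (rule pos)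
    then show ?thesis by (simp add: arctan_window_minus poisson_def)
  qed
qed

text \<open>The indicator of \<open>[-1, 1]\<close> lies between multiples of integrals of Poisson kernels over slightly
  different intervals; a Riemann sum replaces each integral by finitely many kernels.\<close>

lemma window_mass_from_poisson:
  assumes c: "c > 0" and \<kappa>: "\<kappa> > 0"
  shows "\<exists>W \<tau>. finite W \<and> (\<forall>w\<in>W. Im w > 0) \<and> \<tau> > 0 \<and>
    (\<forall>(I::nat set) p t. finite I \<longrightarrow> (\<forall>i\<in>I. 0 \<le> p i) \<longrightarrow>
       (\<forall>w\<in>W. \<bar>(\<Sum>i\<in>I. p i * Im (1 / (of_real (t i) - w))) - c\<bar> \<le> \<tau>) \<longrightarrow>
       \<bar>(\<Sum>i\<in>{i\<in>I. \<bar>t i\<bar> \<le> 1}. p i) - 2 * c / pi\<bar> \<le> \<kappa>)"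
proof -
  \<comment> \<open>\<open>U s\<close> and \<open>L s\<close> are the bounds produced by the two
    comparisons below when margin, mesh error and tolerance are all tied to \<open>s\<close>. Both
    tend to 2 c / pi, the length of the window times the density c / pi.\<close>
  define U where "U = (\<lambda>s::real. (1 + s) ^ 3 / (1 - s) * (2 / pi) * (c + s))"
  define L where "L = (\<lambda>s::real. (1 - s) / (1 + s)\<^sup>2 * (2 / pi) * (c - s) - 4 * s / pi * (c + s))"
  have "(U \<longlongrightarrow> (1 + 0) ^ 3 / (1 - 0) * (2 / pi) * (c + 0)) (at_right 0)"
    unfolding U_def by (intro tendsto_intros) auto
  then have U: "\<forall>\<^sub>F s in at_right 0. U s < 2 * c / pi + \<kappa>" by (rule order_tendstoD(2)) (use \<kappa> in simp)
  have "(L \<longlongrightarrow> (1 - 0) / (1 + 0)\<^sup>2 * (2 / pi) * (c - 0) - 4 * 0 / pi * (c + 0)) (at_right 0)"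
    unfolding L_def by (intro tendsto_intros) auto
  then have L: "\<forall>\<^sub>F s in at_right 0. 2 * c / pi - \<kappa> < L s" by (rule order_tendstoD(1)) (use \<kappa> in simp)
  have "\<forall>\<^sub>F s in at_right 0. s \<in> {0<..<min c 1}" by (rule eventually_at_right_real) (use c in simp)
  with U L have "\<forall>\<^sub>F s in at_right 0. U s < 2 * c / pi + \<kappa> \<and> 2 * c / pi - \<kappa> < L s \<and> s \<in> {0<..<min c 1}"
    by eventually_elim simp
  then obtain s where s: "U s < 2 * c / pi + \<kappa>" "2 * c / pi - \<kappa> < L s" "0 < s" "s < c" "s < 1"
    using eventually_happens[of _ "at_right (0::real)"] trivial_limit_at_right_real[of "0::real"] by auto
  define h where "h = s ^ 3"
  have h: "h > 0" using s by (simp add: h_def)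
  \<comment> \<open>Chosen so that for half-widths up to 2 the mesh is at most \<open>s * h\<close>,
    making the Harnack factor at most \<open>(1 + s)^2\<close>.\<close>
  obtain N0 :: nat where N0: "4 / (h * s) < N0" using reals_Archimedean2 by blast
  define N where "N = Suc N0"
  have N: "N > 0" "4 / (h * s) < N" using N0 by (simp_all add: N_def)
  have Nd: "(2 * a / N) / h \<le> s" if "0 < a" "a \<le> 2" for a
  proof -
    have "4 < N * (h * s)" using N h s by (simp add: pos_divide_less_eq)
    then have "2 * a \<le> s * (h * N)" using that by (simp add: mult_ac)
    then show ?thesis using h N by (simp add: divide_le_eq mult_ac)
  qed
  define grid where "grid = (\<lambda>a. (\<lambda>l. Complex (- a + 2 * a / real N * real l) h) ` {..<N})"
  \<comment> \<open>The grids discretise the slightly larger and the slightly smaller window; the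
    point \<open>\<i>\<close> carries the kernel that dominates the tail.\<close>
  define W where "W = insert \<i> (grid (1 + s) \<union> grid (1 - s))"
  have W: "finite W" "\<forall>w\<in>W. Im w > 0" using h by (auto simp: W_def grid_def)
  have main: "\<bar>(\<Sum>i\<in>{i\<in>I. \<bar>t i\<bar> \<le> 1}. p i) - 2 * c / pi\<bar> \<le> \<kappa>"
    if I: "finite I" and p: "\<forall>i\<in>I. 0 \<le> p i"
      and app: "\<forall>w\<in>W. \<bar>(\<Sum>i\<in>I. p i * Im (1 / (of_real (t i) - w))) - c\<bar> \<le> s" for I :: "nat set" and p t
  proof -
    have ps: "\<bar>(\<Sum>i\<in>I. p i * poisson E h (t i)) - c\<bar> \<le> s" if "Complex E h \<in> W" for E h
      using app that unfolding Im_inverse_poisson[symmetric] by blast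
    have K: "(\<Sum>i\<in>I. p i * poisson 0 1 (t i)) \<le> c + s"
      using ps[of 0 1] by (simp add: W_def complex_eq_iff abs_le_iff)
    have S: "(\<Sum>i\<in>I. p i * grid_sum a h N (t i)) = (\<Sum>l<N. 2 * a / real N * (\<Sum>i\<in>I. p i * poisson (- a + 2 * a / real N * real l) h (t i)))" for a
      unfolding grid_sum_def sum_distrib_left by (subst sum.swap) (simp add: mult_ac)
    have Sb: "(\<Sum>i\<in>I. p i * grid_sum a h N (t i)) \<le> 2 * a * (c + s) \<and> 2 * a * (c - s) \<le> (\<Sum>i\<in>I. p i * grid_sum a h N (t i))"
      if a: "0 < a" "grid a \<subseteq> W" for a
    proof -
      have b: "\<bar>(\<Sum>i\<in>I. p i * poisson (- a + 2 * a / real N * real l) h (t i)) - c\<bar> \<le> s" if "l < N" for l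
        using a that by (intro ps) (auto simp: grid_def)
      have "(\<Sum>l<N. 2 * a / real N * (\<Sum>i\<in>I. p i * poisson (- a + 2 * a / real N * real l) h (t i))) \<le> (\<Sum>l<N. 2 * a / real N * (c + s))"
        using a by (intro sum_mono mult_left_mono) (use b in \<open>force simp: abs_le_iff\<close>, simp)
      moreover have "(\<Sum>l<N. 2 * a / real N * (c - s)) \<le> (\<Sum>l<N. 2 * a / real N * (\<Sum>i\<in>I. p i * poisson (- a + 2 * a / real N * real l) h (t i)))"
        using a by (intro sum_mono mult_left_mono) (use b in \<open>force simp: abs_le_iff\<close>, simp)
      ultimately show ?thesis unfolding S using N by simp
    qed
    let ?M = "\<Sum>i\<in>{i\<in>I. \<bar>t i\<bar> \<le> 1}. p i"
    have M: "?M = (\<Sum>i\<in>I. p i * (if \<bar>t i\<bar> \<le> 1 then 1 else 0))"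
      using I by (simp add: sum.If_cases if_distrib[of "(*) _"] Int_def cong: if_cong)
    have up: "pi * (1 - s) * ?M \<le> (1 + s)\<^sup>2 * (2 * (1 + s) * (c + s))"
    proof -
      define q where "q = (1 + (2 * (1 + s) / N) / h)\<^sup>2"
      have q: "q \<le> (1 + s)\<^sup>2" "0 \<le> q" unfolding q_def using Nd[of "1 + s"] s h by (auto intro!: power_mono)
      have g0: "0 \<le> grid_sum (1 + s) h N (t i)" for i
        unfolding grid_sum_def using s by (intro sum_nonneg mult_nonneg_nonneg poisson_nonneg h) auto
      have "pi * (1 - s) * ?M = (\<Sum>i\<in>I. p i * (pi * (1 - s) * (if \<bar>t i\<bar> \<le> 1 then 1 else 0)))"
        unfolding M sum_distrib_left by (intro sum.cong) auto
      also have "\<dots> \<le> (\<Sum>i\<in>I. p i * (q * grid_sum (1 + s) h N (t i)))"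
      proof (intro sum_mono mult_left_mono)
        fix i assume "i \<in> I"
        show "pi * (1 - s) * (if \<bar>t i\<bar> \<le> 1 then 1 else 0) \<le> q * grid_sum (1 + s) h N (t i)"
        proof (cases "\<bar>t i\<bar> \<le> 1")
          case True
          have "pi * (1 - s) \<le> arctan_window (1 + s) h (t i)"
            unfolding h_def using s True by (intro arctan_window_inside) auto
          also have "\<dots> \<le> q * grid_sum (1 + s) h N (t i)"
            unfolding q_def using s by (intro grid_sum_bounds(1) h N) auto
          finally show ?thesis using True by simp
        qed (use q g0 in simp)
      qed (use p in auto)
      also have "\<dots> = q * (\<Sum>i\<in>I. p i * grid_sum (1 + s) h N (t i))" by (simp add: sum_distrib_left mult_ac)
      also have "\<dots> \<le> (1 + s)\<^sup>2 * (2 * (1 + s) * (c + s))"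
        using q Sb[of "1 + s"] s p g0 by (intro mult_mono) (auto simp: W_def intro!: sum_nonneg mult_nonneg_nonneg)
      finally show ?thesis .
    qed
    have low: "2 * (1 - s) * (c - s) \<le> (1 + s)\<^sup>2 * (pi * ?M + 4 * s * (c + s))"
    proof -
      define q where "q = (1 + (2 * (1 - s) / N) / h)\<^sup>2"
      have q: "q \<le> (1 + s)\<^sup>2" "0 \<le> q" unfolding q_def using Nd[of "1 - s"] s h by (auto intro!: power_mono)
      have "2 * (1 - s) * (c - s) \<le> (\<Sum>i\<in>I. p i * grid_sum (1 - s) h N (t i))"
        using Sb[of "1 - s"] s by (auto simp: W_def)
      also have "\<dots> \<le> (\<Sum>i\<in>I. p i * (q * (pi * (if \<bar>t i\<bar> \<le> 1 then 1 else 0) + 4 * s * poisson 0 1 (t i))))"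
      proof (intro sum_mono mult_left_mono)
        fix i assume "i \<in> I"
        have "arctan_window (1 - s) h (t i) \<le> pi * (if \<bar>t i\<bar> \<le> 1 then 1 else 0) + 4 * s * poisson 0 1 (t i)"
          using arctan_window_le_pi[of "1 - s" h "t i"] arctan_window_outside[of s "t i"] poisson_nonneg[of 1 0 "t i"] s
          by (auto simp: h_def intro: add_increasing2)
        then have "q * arctan_window (1 - s) h (t i) \<le> q * (pi * (if \<bar>t i\<bar> \<le> 1 then 1 else 0) + 4 * s * poisson 0 1 (t i))"
          using q by (intro mult_left_mono) auto
        moreover have "grid_sum (1 - s) h N (t i) \<le> q * arctan_window (1 - s) h (t i)"
          unfolding q_def using s by (intro grid_sum_bounds(2) h N) auto
        ultimately show "grid_sum (1 - s) h N (t i) \<le> q * (pi * (if \<bar>t i\<bar> \<le> 1 then 1 else 0) + 4 * s * poisson 0 1 (t i))"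
          by linarith
      qed (use p in auto)
      also have "\<dots> = q * (pi * ?M + 4 * s * (\<Sum>i\<in>I. p i * poisson 0 1 (t i)))"
        unfolding M sum_distrib_left sum.distrib[symmetric] by (intro sum.cong refl) (simp add: algebra_simps)
      also have "\<dots> \<le> (1 + s)\<^sup>2 * (pi * ?M + 4 * s * (c + s))"
        using q s K p by (intro mult_mono add_left_mono mult_left_mono add_nonneg_nonneg mult_nonneg_nonneg sum_nonneg)
          (auto intro: poisson_nonneg)
      finally show ?thesis .
    qed
    have "?M \<le> U s"
    proof -
      have "?M \<le> (1 + s)\<^sup>2 * (2 * (1 + s) * (c + s)) / (pi * (1 - s))"
        using up s by (subst pos_le_divide_eq) (auto simp: mult_ac)
      also have "\<dots> = U s" using s by (simp add: U_def field_simps power2_eq_square power3_eq_cube)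
      finally show ?thesis .
    qed
    moreover have "L s \<le> ?M"
    proof -
      have "2 * (1 - s) * (c - s) / (1 + s)\<^sup>2 \<le> pi * ?M + 4 * s * (c + s)"
        using low s by (subst pos_divide_le_eq) (auto simp: mult_ac)
      then have "(2 * (1 - s) * (c - s) / (1 + s)\<^sup>2 - 4 * s * (c + s)) / pi \<le> ?M"
        by (subst pos_divide_le_eq) (auto simp: algebra_simps)
      moreover have "(2 * (1 - s) * (c - s) / (1 + s)\<^sup>2 - 4 * s * (c + s)) / pi = L s"
      proof -
        have "2 * (1 - s) * (c - s) / (1 + s)\<^sup>2 / pi = (1 - s) / (1 + s)\<^sup>2 * (2 / pi) * (c - s)"
          by (simp only: times_divide_eq_left times_divide_eq_right divide_divide_eq_left mult_ac)
        then show ?thesis by (simp add: L_def diff_divide_distrib)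
      qed
      ultimately show ?thesis by simp
    qed
    ultimately show ?thesis using s by (simp add: abs_le_iff)
  qed
  show ?thesis
    using W s(3) main by (intro exI[of _ W] exI[of _ s]) blast
qed

section \<open>Rank-one perturbation\<close>

lemma index_mult_sum:
  assumes "A \<in> carrier_mat n n" "B \<in> carrier_mat n n" "i < n" "j < n"
  shows "(A * B) $$ (i, j) = (\<Sum>k<n. A $$ (i, k) * B $$ (k, j))"
  using assms by (simp add: scalar_prod_def atLeast0LessThan)

lemma trace_mult_commute:
  fixes A B :: "'a :: comm_ring_1 mat"
  assumes "A \<in> carrier_mat n n" "B \<in> carrier_mat n n"
  shows "(\<Sum>i<n. (A * B) $$ (i, i)) = (\<Sum>i<n. (B * A) $$ (i, i))"
proof -
  have "(\<Sum>i<n. (A * B) $$ (i, i)) = (\<Sum>i<n. \<Sum>k<n. A $$ (i, k) * B $$ (k, i))"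
    by (intro sum.cong refl index_mult_sum[OF assms]) auto
  also have "\<dots> = (\<Sum>k<n. \<Sum>i<n. A $$ (i, k) * B $$ (k, i))" by (rule sum.swap)
  also have "\<dots> = (\<Sum>k<n. (B * A) $$ (k, k))"
    by (intro sum.cong refl, subst index_mult_sum[OF assms(2,1)]) (auto simp: mult.commute)
  finally show ?thesis .
qed

text \<open>Together with the eigenvector equation, this makes the squared Frobenius norm of
  \<open>B - \<theta> u u\<^sup>T\<close> vanish for a rank-one spike \<open>B\<close>.\<close>

lemma trace_square_charpoly:
  fixes A :: "real mat"
  assumes A: "A \<in> carrier_mat n n" and c: "char_poly A = (\<Prod>e\<leftarrow>es. [:- e, 1:])"
  shows "(\<Sum>i<n. (A * A) $$ (i, i)) = (\<Sum>e\<leftarrow>es. e\<^sup>2)"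
proof -
  obtain B P Q where s: "schur_decomposition A es = (B, P, Q)" by (cases "schur_decomposition A es")
  from schur_decomposition[OF A c s]
  have w: "similar_mat_wit A B P Q" and ut: "upper_triangular B" and d: "diag_mat B = es" by auto
  from similar_mat_witD2[OF A w] have PQ: "P * Q = 1\<^sub>m n" "Q * P = 1\<^sub>m n" and AP: "A = P * B * Q"
    and [simp]: "B \<in> carrier_mat n n" "P \<in> carrier_mat n n" "Q \<in> carrier_mat n n" by auto
  have c[simp]: "X * Y \<in> carrier_mat n n" if "X \<in> carrier_mat n n" "Y \<in> carrier_mat n n" for X Y :: "real mat"
    using that by (rule mult_carrier_mat)
  have dB[simp]: "dim_row B = n" by (rule carrier_matD(1)[of B n n]) simp
  have QP: "Q * (P * X) = X" if "X \<in> carrier_mat n n" for X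
    using assoc_mult_mat[of Q n n P n X n] PQ(2) that by simp
  have "A * A = P * (B * B) * Q"
    unfolding AP by (simp add: assoc_mult_mat[of _ n n _ n _ n] QP)
  then have "(\<Sum>i<n. (A * A) $$ (i, i)) = (\<Sum>i<n. (Q * (P * (B * B))) $$ (i, i))"
    using trace_mult_commute[of "P * (B * B)" n Q] by simp
  also have "Q * (P * (B * B)) = B * B" by (rule QP) simp
  also have "(\<Sum>i<n. (B * B) $$ (i, i)) = (\<Sum>i<n. (B $$ (i, i))\<^sup>2)"
  proof (intro sum.cong refl)
    fix i assume i: "i \<in> {..<n}"
    \<comment> \<open>For \<open>k\<close> different from \<open>i\<close> one of the two factors
      lies below the diagonal.\<close>
    have z: "B $$ (i, k) * B $$ (k, i) = (if k = i then (B $$ (i, i))\<^sup>2 else 0)" if "k < n" for k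
      using upper_triangularD[OF ut, of i k] upper_triangularD[OF ut, of k i] that i
      by (cases k i rule: linorder_cases) (auto simp: power2_eq_square)
    have "(B * B) $$ (i, i) = (\<Sum>k<n. B $$ (i, k) * B $$ (k, i))" using i by (intro index_mult_sum) auto
    also have "\<dots> = (\<Sum>k<n. if k = i then (B $$ (i, i))\<^sup>2 else 0)" by (intro sum.cong refl z) simp
    also have "\<dots> = (B $$ (i, i))\<^sup>2" using i by simp
    finally show "(B * B) $$ (i, i) = (B $$ (i, i))\<^sup>2" .
  qed
  also have "\<dots> = (\<Sum>e\<leftarrow>es. e\<^sup>2)"
    unfolding d[symmetric] diag_mat_def by (simp add: comp_def sum_list_sum_nth atLeast0LessThan)
  finally show ?thesis .
qed

lemma mult_mat_vec_sum: "A \<in> carrier_mat n n \<Longrightarrow> v \<in> carrier_vec n \<Longrightarrow> i < n \<Longrightarrow> (A *\<^sub>v v) $ i = (\<Sum>k<n. A $$ (i, k) * v $ k)"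
  by (simp add: scalar_prod_def atLeast0LessThan)

lemma scalar_prod_sum: "v \<in> carrier_vec n \<Longrightarrow> u \<bullet> v = (\<Sum>k<n. u $ k * v $ k)"
  by (simp add: scalar_prod_def atLeast0LessThan)

lemma rank_one_spike_entries:
  assumes n: "n \<ge> 1" and sp: "rank_one_spike n \<theta> A u"
  shows "u \<in> carrier_vec n" "(\<Sum>k<n. (u $ k)\<^sup>2) = 1"
    "k < n \<Longrightarrow> l < n \<Longrightarrow> A $$ (k, l) = \<theta> * (u $ k * u $ l)"
proof -
  have A: "A \<in> carrier_mat n n" and sy: "symmetric A" and cp: "char_poly A = [:- \<theta>, 1:] * [:0, 1:] ^ (n - 1)"
    and ev: "eigenvector A u \<theta>" and uu: "u \<bullet> u = 1" using sp by (auto simp: rank_one_spike_def)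
  show u: "u \<in> carrier_vec n" using ev A by (auto simp: eigenvector_def)
  show u1: "(\<Sum>k<n. (u $ k)\<^sup>2) = 1" using uu u by (simp add: scalar_prod_sum power2_eq_square)
  have As: "A $$ (k, l) = A $$ (l, k)" if "k < n" "l < n" for k l
    using sy A that by (metis symmetric_def index_transpose_mat(1) carrier_matD)
  have cp': "char_poly A = (\<Prod>e\<leftarrow>\<theta> # replicate (n - 1) 0. [:- e, 1:])"
    unfolding cp by (simp add: map_replicate prod_list_replicate)
  have tr: "(\<Sum>k<n. \<Sum>l<n. (A $$ (k, l))\<^sup>2) = \<theta>\<^sup>2"
  proof -
    have "(A * A) $$ (k, k) = (\<Sum>l<n. (A $$ (k, l))\<^sup>2)" if "k < n" for k
      unfolding index_mult_sum[OF A A that that] using that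
      by (intro sum.cong refl) (simp add: power2_eq_square As[of _ k])
    moreover have "(\<Sum>i<n. (A * A) $$ (i, i)) = \<theta>\<^sup>2"
      using trace_square_charpoly[OF A cp'] by (simp add: sum_list_replicate)
    ultimately show ?thesis by simp
  qed
  have Au: "(\<Sum>l<n. A $$ (k, l) * u $ l) = \<theta> * u $ k" if "k < n" for k
    using ev mult_mat_vec_sum[OF A u that] that u by (auto simp: eigenvector_def)
  \<comment> \<open>The three sums evaluate to \<theta>^2, 2 \<theta> * \<theta> and \<theta>^2, so
    the squared Frobenius distance is zero.\<close>
  have "(\<Sum>k<n. \<Sum>l<n. (A $$ (k, l) - \<theta> * (u $ k * u $ l))\<^sup>2)
     = (\<Sum>k<n. \<Sum>l<n. (A $$ (k, l))\<^sup>2) - 2 * \<theta> * (\<Sum>k<n. u $ k * (\<Sum>l<n. A $$ (k, l) * u $ l))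
       + \<theta>\<^sup>2 * (\<Sum>k<n. (u $ k)\<^sup>2 * (\<Sum>l<n. (u $ l)\<^sup>2))"
    unfolding sum_distrib_left sum_subtractf[symmetric] sum.distrib[symmetric]
    by (intro sum.cong refl) (simp add: power2_eq_square algebra_simps)
  also have "(\<Sum>k<n. u $ k * (\<Sum>l<n. A $$ (k, l) * u $ l)) = (\<Sum>k<n. \<theta> * (u $ k)\<^sup>2)"
    by (intro sum.cong refl) (simp add: Au power2_eq_square)
  also have "\<dots> = \<theta>" using u1 by (simp add: sum_distrib_left[symmetric])
  also have "(\<Sum>k<n. (u $ k)\<^sup>2 * (\<Sum>l<n. (u $ l)\<^sup>2)) = 1" using u1 by simp
  finally have "(\<Sum>k<n. \<Sum>l<n. (A $$ (k, l) - \<theta> * (u $ k * u $ l))\<^sup>2) = 0"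
    unfolding tr by (simp add: power2_eq_square)
  then have "(\<Sum>l<n. (A $$ (k, l) - \<theta> * (u $ k * u $ l))\<^sup>2) = 0" if "k < n" for k
    using that by (subst (asm) sum_nonneg_eq_0_iff) (auto intro: sum_nonneg)
  then have "(A $$ (k, l) - \<theta> * (u $ k * u $ l))\<^sup>2 = 0" if "k < n" "l < n" for k l
    using that by (subst (asm) sum_nonneg_eq_0_iff) auto
  then show "k < n \<Longrightarrow> l < n \<Longrightarrow> A $$ (k, l) = \<theta> * (u $ k * u $ l)" by simp
qed

locale spiked_resolvent = symmetric_resolvent H z for H :: "nat \<Rightarrow> nat \<Rightarrow> real" and z +
  fixes n :: nat and \<theta> :: real and u :: "nat \<Rightarrow> real" and ev :: "nat \<Rightarrow> real" and f :: "nat \<Rightarrow> nat \<Rightarrow> real"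
  assumes complete: "\<And>k l. k < n \<Longrightarrow> l < n \<Longrightarrow> (\<Sum>i<n. f i k * f i l) = (if k = l then 1 else 0)"
    and normal: "\<And>i. i < n \<Longrightarrow> (\<Sum>k<n. (f i k)\<^sup>2) = 1"
    and eigen: "\<And>i k. i < n \<Longrightarrow> k < n \<Longrightarrow> (\<Sum>l<n. (H k l + \<theta> * (u k * u l)) * f i l) = ev i * f i k"
    and unit: "(\<Sum>k<n. (u k)\<^sup>2) = 1"
begin

definition coef :: "(nat \<Rightarrow> complex) \<Rightarrow> nat \<Rightarrow> complex" where
  "coef w i = (\<Sum>k<n. of_real (f i k) * w k)"

lemma parseval: "(\<Sum>i<n. coef a i * coef b i) = (\<Sum>k<n. a k * b k)"
proof -
  have "(\<Sum>i<n. coef a i * coef b i) = (\<Sum>i<n. \<Sum>k<n. \<Sum>l<n. of_real (f i k * f i l) * (a k * b l))"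
    unfolding coef_def sum_product by (intro sum.cong refl) simp
  also have "\<dots> = (\<Sum>k<n. \<Sum>i<n. \<Sum>l<n. of_real (f i k * f i l) * (a k * b l))" by (rule sum.swap)
  also have "\<dots> = (\<Sum>k<n. \<Sum>l<n. \<Sum>i<n. of_real (f i k * f i l) * (a k * b l))"
    by (intro sum.cong refl sum.swap)
  also have "\<dots> = (\<Sum>k<n. \<Sum>l<n. of_real (\<Sum>i<n. f i k * f i l) * (a k * b l))"
    by (simp only: of_real_sum sum_distrib_right)
  also have "\<dots> = (\<Sum>k<n. \<Sum>l<n. if k = l then a k * b l else 0)"
    by (intro sum.cong refl) (simp add: complete)
  finally show ?thesis by simp
qed

lemma coef_cnj: "coef (\<lambda>k. cnj (w k)) i = cnj (coef w i)"
  by (simp add: coef_def)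

lemma parseval_norm: "(\<Sum>i<n. (cmod (coef w i))\<^sup>2) = (\<Sum>k<n. (cmod (w k))\<^sup>2)"
proof -
  have "complex_of_real (\<Sum>i<n. (cmod (coef w i))\<^sup>2) = complex_of_real (\<Sum>k<n. (cmod (w k))\<^sup>2)"
    using parseval[of w "\<lambda>k. cnj (w k)"] unfolding coef_cnj of_real_sum complex_norm_square .
  then show ?thesis by (simp only: of_real_eq_iff)
qed

text \<open>Pairing with an eigenvector of \<open>H + \<theta> u u^T\<close> diagonalises the
  perturbed matrix; trading it for \<open>H\<close> costs the rank-one term with
  \<open>u\<close>.\<close>

lemma coef_resolvent:
  assumes i: "i < n" and w: "\<And>k. k < n \<Longrightarrow> (\<Sum>l<n. of_real (H k l) * w l) - z * w k = v k"
  shows "(of_real (ev i) - z) * coef w i = coef v i + \<theta> * coef (\<lambda>k. of_real (u k)) i * (\<Sum>l<n. of_real (u l) * w l)"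
proof -
  let ?U = "\<Sum>l<n. of_real (u l) * w l"
  have "of_real (ev i) * coef w i = (\<Sum>k<n. of_real (ev i * f i k) * w k)"
    by (simp add: coef_def sum_distrib_left mult_ac)
  also have "\<dots> = (\<Sum>k<n. of_real (\<Sum>l<n. (H k l + \<theta> * (u k * u l)) * f i l) * w k)"
    by (intro sum.cong refl) (simp only: eigen[OF i] lessThan_iff)
  also have "\<dots> = (\<Sum>k<n. \<Sum>l<n. of_real (f i l) * (of_real (H k l + \<theta> * (u k * u l)) * w k))"
    by (simp add: sum_distrib_right sum_distrib_left mult_ac)
  also have "\<dots> = (\<Sum>l<n. \<Sum>k<n. of_real (f i l) * (of_real (H l k + \<theta> * (u l * u k)) * w k))"
    by (subst sum.swap) (simp add: sym[of _ _] mult.commute[of "u _" "u _"] mult_ac)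
  also have "\<dots> = (\<Sum>l<n. of_real (f i l) * ((\<Sum>k<n. of_real (H l k) * w k) + of_real \<theta> * of_real (u l) * ?U))"
    by (simp only: sum_distrib_left[symmetric] of_real_add of_real_mult ring_distribs(2) sum.distrib mult.assoc)
  also have "\<dots> = (\<Sum>l<n. of_real (f i l) * ((v l + z * w l) + of_real \<theta> * of_real (u l) * ?U))"
    by (intro sum.cong refl) (simp add: w[symmetric])
  also have "\<dots> = coef v i + z * coef w i + \<theta> * coef (\<lambda>k. of_real (u k)) i * ?U"
    by (simp add: coef_def ring_distribs sum.distrib sum_distrib_left sum_distrib_right mult_ac)
  finally show ?thesis by (simp add: algebra_simps)
qed

lemma denominator: "of_real (ev i) - z \<noteq> 0" "cmod (1 / (of_real (ev i) - z)) \<le> 1 / Im z"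
proof -
  have "Im z \<le> cmod (of_real (ev i) - z)" using abs_Im_le_cmod[of "of_real (ev i) - z"] Im_z by simp
  then show "of_real (ev i) - z \<noteq> 0" "cmod (1 / (of_real (ev i) - z)) \<le> 1 / Im z"
    using Im_z by (auto simp: norm_divide divide_simps)
qed

abbreviation "F \<equiv> res_form H z {..<n} u"

abbreviation "w \<equiv> res_vec H z {..<n} u"

lemma coef_w:
  assumes "i < n"
  shows "(of_real (ev i) - z) * coef w i = (1 + \<theta> * F) * coef (\<lambda>k. of_real (u k)) i"
  using coef_resolvent[OF assms, of w "\<lambda>k. of_real (u k)"] res_vec_eq[of "{..<n}"]
  by (simp add: res_form_def algebra_simps)

text \<open>If the factor vanished, all coordinates of \<open>G u\<close> in the eigenbasis would
  vanish, hence \<open>G u = 0\<close> and then \<open>u = 0\<close>.\<close>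

lemma spike_nonzero: "1 + \<theta> * F \<noteq> 0"
proof
  assume "1 + \<theta> * F = 0"
  then have "coef w i = 0" if "i < n" for i using coef_w[OF that] denominator(1) by simp
  then have "(\<Sum>k<n. (cmod (w k))\<^sup>2) = 0" using parseval_norm[of w] by simp
  then have w0: "w k = 0" if "k < n" for k using that by (subst (asm) sum_nonneg_eq_0_iff) auto
  have "of_real (u k) = (0 :: complex)" if "k < n" for k
    using res_vec_eq[of "{..<n}" k u] that by (simp add: w0)
  then show False using unit by simp
qed

lemma overlap_transform:
  "(\<Sum>i<n. (\<Sum>k<n. f i k * u k)\<^sup>2 / (of_real (ev i) - z)) = F / (1 + \<theta> * F)"
proof -
  let ?c = "coef (\<lambda>k. of_real (u k))"
  have c: "?c i = of_real (\<Sum>k<n. f i k * u k)" for i by (simp add: coef_def)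
  have "F = (\<Sum>i<n. ?c i * coef w i)" unfolding parseval res_form_def ..
  also have "\<dots> = (\<Sum>i<n. (1 + \<theta> * F) * (of_real ((\<Sum>k<n. f i k * u k)\<^sup>2) / (of_real (ev i) - z)))"
  proof (intro sum.cong refl)
    fix i assume "i \<in> {..<n}"
    then have "coef w i = (1 + \<theta> * F) * ?c i / (of_real (ev i) - z)"
      using coef_w[of i] denominator(1)[of i] by (simp add: eq_divide_eq mult.commute)
    then show "?c i * coef w i = (1 + \<theta> * F) * (of_real ((\<Sum>k<n. f i k * u k)\<^sup>2) / (of_real (ev i) - z))"
      by (simp add: c power2_eq_square mult_ac)
  qed
  also have "\<dots> = (1 + \<theta> * F) * (\<Sum>i<n. (\<Sum>k<n. f i k * u k)\<^sup>2 / (of_real (ev i) - z))"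
    by (simp only: sum_distrib_left)
  finally show ?thesis using spike_nonzero by (simp add: eq_divide_eq mult.commute)
qed

text \<open>In the eigenbasis the difference of traces is a sum over the coordinates of
  \<open>u\<close> and \<open>G u\<close>. The bound is crude but enough: divided by
  \<open>n\<close> it is a multiple of \<open>1 / (n * (Im z)^2)\<close>, which tends to zero on the
  scale considered.\<close>

lemma trace_perturbation:
  "cmod ((\<Sum>i<n. 1 / (of_real (ev i) - z)) - res_trace H z {..<n}) \<le> \<bar>\<theta>\<bar> / (Im z)\<^sup>2"
proof -
  let ?c = "coef (\<lambda>k. of_real (u k))" and ?G = "resolvent H z {..<n}"
  have col: "coef (\<lambda>l. ?G l k) i = (of_real (f i k) + \<theta> * ?c i * w k) / (of_real (ev i) - z)" if "i < n" "k < n" for i k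
  proof -
    have "(of_real (ev i) - z) * coef (\<lambda>l. ?G l k) i
      = coef (\<lambda>l. if l = k then 1 else 0) i + \<theta> * ?c i * (\<Sum>l<n. of_real (u l) * ?G l k)"
      using is_resolvent_resolvent[of "{..<n}"] that unfolding is_resolvent_def
      by (intro coef_resolvent) auto
    also have "coef (\<lambda>l. if l = k then 1 else 0) i = of_real (f i k)"
      using that by (simp add: coef_def if_distrib[of "(*) _"] cong: if_cong)
    also have "(\<Sum>l<n. of_real (u l) * ?G l k) = w k"
      unfolding res_vec_def by (intro sum.cong refl) (simp add: resolvent_sym[of "{..<n}" _ k] mult.commute)
    finally show ?thesis using denominator(1)[of i] by (simp add: eq_divide_eq mult.commute)
  qed
  have diag: "?G k k = (\<Sum>i<n. of_real (f i k) * coef (\<lambda>l. ?G l k) i)" if "k < n" for k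
  proof -
    have "coef (\<lambda>l. if l = k then 1 else 0) i = of_real (f i k)" for i
      using that by (simp add: coef_def if_distrib[of "(*) _"] cong: if_cong)
    then have "(\<Sum>i<n. of_real (f i k) * coef (\<lambda>l. ?G l k) i) = (\<Sum>l<n. (if l = k then 1 else 0) * ?G l k)"
      using parseval[of "\<lambda>l. if l = k then 1 else 0" "\<lambda>l. ?G l k"] by simp
    then show ?thesis using that by (simp add: if_distrib[of "\<lambda>x. x * _"] cong: if_cong)
  qed
  have "res_trace H z {..<n} = (\<Sum>k<n. \<Sum>i<n. of_real (f i k) * ((of_real (f i k) + \<theta> * ?c i * w k) / (of_real (ev i) - z)))"
    unfolding res_trace_def by (intro sum.cong refl) (simp add: diag col)
  also have "\<dots> = (\<Sum>i<n. \<Sum>k<n. of_real (f i k) * ((of_real (f i k) + \<theta> * ?c i * w k) / (of_real (ev i) - z)))"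
    by (rule sum.swap)
  also have "\<dots> = (\<Sum>i<n. (1 + \<theta> * ?c i * coef w i) / (of_real (ev i) - z))"
  proof (intro sum.cong refl)
    fix i assume "i \<in> {..<n}"
    then have "complex_of_real (\<Sum>k<n. (f i k)\<^sup>2) = 1" using normal[of i] by simp
    then have nn: "(\<Sum>k<n. complex_of_real (f i k) * of_real (f i k)) = 1" by (simp add: power2_eq_square)
    have "(\<Sum>k<n. of_real (f i k) * ((of_real (f i k) + \<theta> * ?c i * w k) / (of_real (ev i) - z)))
      = ((\<Sum>k<n. complex_of_real (f i k) * of_real (f i k)) + \<theta> * ?c i * coef w i) / (of_real (ev i) - z)"
      unfolding coef_def[of w] sum_distrib_left sum.distrib[symmetric] sum_divide_distrib
      by (intro sum.cong refl) (simp add: algebra_simps)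
    then show "(\<Sum>k<n. of_real (f i k) * ((of_real (f i k) + \<theta> * ?c i * w k) / (of_real (ev i) - z)))
      = (1 + \<theta> * ?c i * coef w i) / (of_real (ev i) - z)" unfolding nn .
  qed
  finally have "(\<Sum>i<n. 1 / (of_real (ev i) - z)) - res_trace H z {..<n} = - (\<Sum>i<n. \<theta> * (?c i * coef w i) * (1 / (of_real (ev i) - z)))"
    by (simp add: add_divide_distrib sum.distrib mult.assoc)
  then have "cmod ((\<Sum>i<n. 1 / (of_real (ev i) - z)) - res_trace H z {..<n})
     \<le> (\<Sum>i<n. cmod (\<theta> * (?c i * coef w i) * (1 / (of_real (ev i) - z))))"
    by (simp only: norm_minus_cancel norm_sum)
  \<comment> \<open>The weight \<open>Im z\<close> balances the unit square sum of \<open>u\<close>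
    against that of \<open>G u\<close>, which is at most \<open>1 / (Im z)^2\<close>.\<close>
  also have "\<dots> \<le> (\<Sum>i<n. \<bar>\<theta>\<bar> * (((cmod (?c i))\<^sup>2 / Im z + Im z * (cmod (coef w i))\<^sup>2) / 2) * (1 / Im z))"
    unfolding norm_mult norm_of_real
    by (intro sum_mono mult_mono denominator(2) mult_left_mono weighted_am_gm Im_z) (use Im_z in auto)
  also have "\<dots> = \<bar>\<theta>\<bar> * (((\<Sum>i<n. (cmod (?c i))\<^sup>2) / Im z + Im z * (\<Sum>i<n. (cmod (coef w i))\<^sup>2)) / 2) * (1 / Im z)"
    by (simp only: sum_distrib_left[symmetric] sum_distrib_right[symmetric] sum_divide_distrib[symmetric] sum.distrib)
  also have "\<dots> \<le> \<bar>\<theta>\<bar> * ((1 / Im z + Im z * (1 / (Im z)\<^sup>2)) / 2) * (1 / Im z)"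
    using res_vec_bound[of "{..<n}" u] unit Im_z unfolding parseval_norm
    by (intro mult_right_mono mult_left_mono divide_right_mono add_mono) auto
  also have "\<dots> = \<bar>\<theta>\<bar> / (Im z)\<^sup>2" using Im_z by (simp add: power2_eq_square)
  finally show ?thesis .
qed

end

lemma spiked_resolventI:
  assumes n: "n \<ge> 1" and Y: "Y \<in> carrier_mat n n" "symmetric Y" and sp: "rank_one_spike n \<theta> A u"
    and W: "W = (1 / sqrt (real n)) \<cdot>\<^sub>m Y + A" and eb: "ordered_orthonormal_eigenbasis n W l f" and z: "Im z > 0"
    and x: "\<And>p. p \<in> upper_indices n \<Longrightarrow> x p = Y $$ p"
  shows "spiked_resolvent (wigner n x) z n \<theta> (\<lambda>k. u $ k) l (\<lambda>i k. f i $ k)"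
proof -
  have A: "A \<in> carrier_mat n n" using sp by (simp add: rank_one_spike_def)
  have Wc: "W \<in> carrier_mat n n" using W Y A by simp
  have fc: "f i \<in> carrier_vec n" and fe: "W *\<^sub>v f i = l i \<cdot>\<^sub>v f i" if "i < n" for i
    using eb that Wc by (auto simp: ordered_orthonormal_eigenbasis_def eigenvector_def)
  have fo: "(\<Sum>k<n. f i $ k * f j $ k) = (if i = j then 1 else 0)" if "i < n" "j < n" for i j
    using eb that scalar_prod_sum[OF fc[OF that(2)], of "f i"] by (simp add: ordered_orthonormal_eigenbasis_def)
  have Hw: "wigner n x k l = Y $$ (k, l) / sqrt n" if "k < n" "l < n" for k l
  proof -
    have "Y $$ (k, l) = Y $$ (l, k)" using Y that by (metis symmetric_def index_transpose_mat(1) carrier_matD)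
    then have "Y $$ up k l = Y $$ (k, l)" by (auto simp: up_def min_def max_def)
    then show ?thesis using x[OF up_in_upper_indices[OF that]] by (simp add: wigner_def)
  qed
  define Q where "Q = mat n n (\<lambda>(i, k). f i $ k)"
  have Q: "Q \<in> carrier_mat n n" "transpose_mat Q \<in> carrier_mat n n" by (simp_all add: Q_def)
  have "Q * transpose_mat Q = 1\<^sub>m n"
  proof (rule eq_matI)
    fix i j assume "i < dim_row (1\<^sub>m n :: real mat)" "j < dim_col (1\<^sub>m n :: real mat)"
    then have ij: "i < n" "j < n" by simp_all
    have "(Q * transpose_mat Q) $$ (i, j) = (\<Sum>k<n. f i $ k * f j $ k)"
      unfolding index_mult_sum[OF Q ij] using ij by (simp add: Q_def)
    then show "(Q * transpose_mat Q) $$ (i, j) = 1\<^sub>m n $$ (i, j)" using ij by (simp add: fo)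
  qed (simp_all add: Q_def)
  \<comment> \<open>For square matrices a right inverse is a left inverse: orthonormality of the
    eigenvectors becomes the completeness relation.\<close>
  then have QQ: "transpose_mat Q * Q = 1\<^sub>m n" by (rule mat_mult_left_right_inverse[OF Q])
  show ?thesis
  proof
    show "wigner n x i j = wigner n x j i" for i j by (rule wigner_sym)
    show "Im z > 0" by (rule z)
    show "(\<Sum>i<n. f i $ k * f i $ l) = (if k = l then 1 else 0)" if "k < n" "l < n" for k l
    proof -
      have "(transpose_mat Q * Q) $$ (k, l) = (\<Sum>i<n. f i $ k * f i $ l)"
        unfolding index_mult_sum[OF Q(2,1) that] using that by (simp add: Q_def)
      then show ?thesis unfolding QQ using that by simp
    qed
    show "(\<Sum>k<n. (f i $ k)\<^sup>2) = 1" if "i < n" for i using fo[OF that that] by (simp add: power2_eq_square)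
    show "(\<Sum>k<n. (u $ k)\<^sup>2) = 1" by (rule rank_one_spike_entries(2)[OF n sp])
    show "(\<Sum>j<n. (wigner n x k j + \<theta> * (u $ k * u $ j)) * f i $ j) = l i * f i $ k" if "i < n" "k < n" for i k
    proof -
      have "(\<Sum>j<n. (wigner n x k j + \<theta> * (u $ k * u $ j)) * f i $ j) = (\<Sum>j<n. W $$ (k, j) * f i $ j)"
        by (intro sum.cong refl) (use that W Y A in \<open>simp add: Hw rank_one_spike_entries(3)[OF n sp]\<close>)
      also have "\<dots> = (W *\<^sub>v f i) $ k" by (rule mult_mat_vec_sum[OF Wc fc that(2), symmetric]) (rule that(1))
      also have "\<dots> = l i * f i $ k" unfolding fe[OF that(1)] using fc[OF that(1)] that by simp
      finally show ?thesis .
    qed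
  qed
qed

section \<open>Transfer to the random matrices\<close>

text \<open>By independence the joint law is a product, checked on rectangles. Fubini then bounds
  the probability by the worst value over frozen \<open>U\<close>.\<close>

lemma independent_prob_bound:
  assumes M: "prob_space M" and ind: "independent M S U T V" and Q: "Q \<in> sets (S \<Otimes>\<^sub>M T)" and e: "0 \<le> e"
    and le: "\<And>\<omega>. \<omega> \<in> space M \<Longrightarrow> measure (distr M T V) {y \<in> space T. (U \<omega>, y) \<in> Q} \<le> e"
  shows "measure M {\<omega> \<in> space M. (U \<omega>, V \<omega>) \<in> Q} \<le> e"
proof -
  interpret prob_space M by fact
  have U: "U \<in> M \<rightarrow>\<^sub>M S" and V: "V \<in> M \<rightarrow>\<^sub>M T"
    and iset: "indep_set {U -` B \<inter> space M |B. B \<in> sets S} {V -` B \<inter> space M |B. B \<in> sets T}"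
    using ind by (auto simp: independent_def)
  interpret DU: prob_space "distr M S U" by (rule prob_space_distr[OF U])
  interpret DV: prob_space "distr M T V" by (rule prob_space_distr[OF V])
  have UV: "(\<lambda>\<omega>. (U \<omega>, V \<omega>)) \<in> M \<rightarrow>\<^sub>M S \<Otimes>\<^sub>M T" by (rule measurable_Pair[OF U V])
  have prod: "distr M S U \<Otimes>\<^sub>M distr M T V = distr M (S \<Otimes>\<^sub>M T) (\<lambda>\<omega>. (U \<omega>, V \<omega>))"
  proof (rule pair_measure_eqI)
    show "sigma_finite_measure (distr M S U)" "sigma_finite_measure (distr M T V)" by unfold_locales
    show "sets (distr M S U \<Otimes>\<^sub>M distr M T V) = sets (distr M (S \<Otimes>\<^sub>M T) (\<lambda>\<omega>. (U \<omega>, V \<omega>)))"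
      by (simp cong: sets_pair_measure_cong)
    fix A B assume "A \<in> sets (distr M S U)" "B \<in> sets (distr M T V)"
    then have A: "A \<in> sets S" and B: "B \<in> sets T" by simp_all
    have AB: "A \<times> B \<in> sets (S \<Otimes>\<^sub>M T)" using A B by (rule pair_measureI)
    have "emeasure (distr M (S \<Otimes>\<^sub>M T) (\<lambda>\<omega>. (U \<omega>, V \<omega>))) (A \<times> B)
      = emeasure M ((U -` A \<inter> space M) \<inter> (V -` B \<inter> space M))"
      unfolding emeasure_distr[OF UV AB] by (intro arg_cong2[of _ _ _ _ emeasure]) auto
    also have "\<dots> = ennreal (prob (U -` A \<inter> space M) * prob (V -` B \<inter> space M))"
      unfolding emeasure_eq_measure using indep_setD[OF iset, of "U -` A \<inter> space M" "V -` B \<inter> space M"] A B by auto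
    also have "\<dots> = emeasure (distr M S U) A * emeasure (distr M T V) B"
      unfolding emeasure_distr[OF U A] emeasure_distr[OF V B] emeasure_eq_measure by (simp add: ennreal_mult)
    finally show "emeasure (distr M S U) A * emeasure (distr M T V) B
      = emeasure (distr M (S \<Otimes>\<^sub>M T) (\<lambda>\<omega>. (U \<omega>, V \<omega>))) (A \<times> B)" by simp
  qed
  have Q': "Q \<in> sets (distr M S U \<Otimes>\<^sub>M distr M T V)"
    using Q by (simp cong: sets_pair_measure_cong)
  have "emeasure M {\<omega> \<in> space M. (U \<omega>, V \<omega>) \<in> Q} = emeasure (distr M (S \<Otimes>\<^sub>M T) (\<lambda>\<omega>. (U \<omega>, V \<omega>))) Q"
    unfolding emeasure_distr[OF UV Q] by (intro arg_cong2[of _ _ _ _ emeasure]) auto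
  also have "\<dots> = (\<integral>\<^sup>+u. emeasure (distr M T V) (Pair u -` Q) \<partial>distr M S U)"
    unfolding prod[symmetric] by (rule DV.emeasure_pair_measure_alt[OF Q'])
  also have "\<dots> = (\<integral>\<^sup>+\<omega>. emeasure (distr M T V) (Pair (U \<omega>) -` Q) \<partial>M)"
    by (rule nn_integral_distr[OF U]) (use DV.measurable_emeasure_Pair[OF Q'] in simp)
  also have "\<dots> \<le> (\<integral>\<^sup>+\<omega>. ennreal e \<partial>M)"
  proof (rule nn_integral_mono)
    fix \<omega> assume \<omega>: "\<omega> \<in> space M"
    have "Pair (U \<omega>) -` Q = {y \<in> space T. (U \<omega>, y) \<in> Q}"
      using sets.sets_into_space[OF Q] by (auto simp: space_pair_measure)
    then show "emeasure (distr M T V) (Pair (U \<omega>) -` Q) \<le> ennreal e"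
      unfolding DV.emeasure_eq_measure using le[OF \<omega>] by (simp add: ennreal_leI)
  qed
  also have "\<dots> = ennreal e" by (simp add: emeasure_space_1)
  finally show ?thesis unfolding emeasure_eq_measure using e by simp
qed

definition entries :: "nat \<Rightarrow> real mat \<Rightarrow> nat \<times> nat \<Rightarrow> real" where
  "entries n Y = (\<lambda>ij\<in>upper_indices n. Y $$ ij)"

lemma iid_symmetric_matrix_law:
  assumes "prob_space M" "iid_symmetric_matrix N \<xi> M n Y" "n \<ge> 1"
  shows "(\<lambda>\<omega>. entries n (Y \<omega>)) \<in> M \<rightarrow>\<^sub>M (\<Pi>\<^sub>M ij\<in>upper_indices n. borel)"
    and "distr M (\<Pi>\<^sub>M ij\<in>upper_indices n. borel) (\<lambda>\<omega>. entries n (Y \<omega>)) = (\<Pi>\<^sub>M ij\<in>upper_indices n. distr N borel \<xi>)"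
proof -
  interpret prob_space M by fact
  have ind: "indep_vars (\<lambda>_. borel) (\<lambda>ij \<omega>. Y \<omega> $$ ij) (upper_indices n)"
    and law: "\<And>ij. ij \<in> upper_indices n \<Longrightarrow> distr M borel (\<lambda>\<omega>. Y \<omega> $$ ij) = distr N borel \<xi>"
    using assms(2) by (auto simp: iid_symmetric_matrix_def)
  have rv: "(\<lambda>\<omega>. Y \<omega> $$ ij) \<in> borel_measurable M" if "ij \<in> upper_indices n" for ij
    using ind that by (simp add: indep_vars_def2)
  have "(0, 0) \<in> upper_indices n" using assms(3) by (simp add: upper_indices_def)
  then have ne: "upper_indices n \<noteq> {}" by blast
  show "(\<lambda>\<omega>. entries n (Y \<omega>)) \<in> M \<rightarrow>\<^sub>M (\<Pi>\<^sub>M ij\<in>upper_indices n. borel)"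
    unfolding entries_def by (rule measurable_restrict) (rule rv)
  have "distr M (\<Pi>\<^sub>M ij\<in>upper_indices n. borel) (\<lambda>\<omega>. entries n (Y \<omega>)) = (\<Pi>\<^sub>M ij\<in>upper_indices n. distr M borel (\<lambda>\<omega>. Y \<omega> $$ ij))"
    unfolding entries_def using indep_vars_iff_distr_eq_PiM'[OF ne rv] ind by simp
  also have "\<dots> = (\<Pi>\<^sub>M ij\<in>upper_indices n. distr N borel \<xi>)" by (rule PiM_cong) (simp_all add: law)
  finally show "distr M (\<Pi>\<^sub>M ij\<in>upper_indices n. borel) (\<lambda>\<omega>. entries n (Y \<omega>)) = (\<Pi>\<^sub>M ij\<in>upper_indices n. distr N borel \<xi>)" .
qed

lemma symmetric_resolvent_wigner: "Im z > 0 \<Longrightarrow> symmetric_resolvent (wigner n x) z"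
  by unfold_locales (simp_all add: wigner_sym)

lemma measurable_wigner_resolvent:
  assumes "Im z > 0"
  shows "(\<lambda>x. resolvent (wigner n x) z {..<n} k l) \<in> borel_measurable (\<Pi>\<^sub>M ij\<in>upper_indices n. borel)"
proof (rule measurable_resolvent[OF _ symmetric_resolvent_wigner[OF assms]])
  fix k l assume "k \<in> {..<n}" "l \<in> {..<n}"
  then have "up k l \<in> upper_indices n" by (intro up_in_upper_indices) auto
  then show "(\<lambda>x. wigner n x k l) \<in> borel_measurable (\<Pi>\<^sub>M ij\<in>upper_indices n. borel)"
    unfolding wigner_def by measurable
qed simp

text \<open>The trace depends on the matrix alone, so its law is transported directly. The form also
  involves the random vector, which is frozen; the hypothesis uniform in \<open>u\<close> enters
  there.\<close>

lemma matrix_local_law: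
  fixes z m :: complex and v :: "'a \<Rightarrow> real vec"
  defines "PP \<equiv> \<lambda>\<mu> n. (\<Pi>\<^sub>M k\<in>upper_indices n. \<mu>)"
  assumes M: "prob_space M" and iid: "iid_symmetric_matrix N \<xi> M n Y" and n: "n \<ge> 1" and z: "Im z > 0"
  shows "{\<omega> \<in> space M. t < cmod (res_trace (wigner n (entries n (Y \<omega>))) z {..<n} / n - m)} \<in> sets M"
    and "measure M {\<omega> \<in> space M. t < cmod (res_trace (wigner n (entries n (Y \<omega>))) z {..<n} / n - m)}
      = measure (PP (distr N borel \<xi>) n) {x \<in> space (PP (distr N borel \<xi>) n). t < cmod (res_trace (wigner n x) z {..<n} / n - m)}"
    and "vec_indep_of_matrix M n v Y \<Longrightarrow>
      {\<omega> \<in> space M. t < cmod (res_form (wigner n (entries n (Y \<omega>))) z {..<n} (\<lambda>k. v \<omega> $ k) - m)} \<in> sets M"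
    and "vec_indep_of_matrix M n v Y \<Longrightarrow> 0 \<le> e \<Longrightarrow> (\<And>\<omega>. \<omega> \<in> space M \<Longrightarrow> (\<Sum>k<n. (v \<omega> $ k)\<^sup>2) = 1) \<Longrightarrow>
      (\<And>u. (\<Sum>k<n. (u k)\<^sup>2) = 1 \<Longrightarrow> measure (PP (distr N borel \<xi>) n) {x \<in> space (PP (distr N borel \<xi>) n). t < cmod (res_form (wigner n x) z {..<n} u - m)} \<le> e) \<Longrightarrow>
      measure M {\<omega> \<in> space M. t < cmod (res_form (wigner n (entries n (Y \<omega>))) z {..<n} (\<lambda>k. v \<omega> $ k) - m)} \<le> e"
proof -
  let ?T = "\<Pi>\<^sub>M ij\<in>upper_indices n. (borel :: real measure)" and ?S = "\<Pi>\<^sub>M i\<in>{..<n}. (borel :: real measure)"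
  let ?V = "\<lambda>\<omega>. entries n (Y \<omega>)" and ?U = "\<lambda>\<omega>. \<lambda>i\<in>{..<n}. v \<omega> $ i"
  note law = iid_symmetric_matrix_law[OF M iid n]
  have sp: "space (PP (distr N borel \<xi>) n) = space ?T" by (simp add: PP_def space_PiM)
  have D: "PP (distr N borel \<xi>) n = distr M ?T ?V" unfolding PP_def law(2) ..
  note [measurable] = measurable_wigner_resolvent[OF z]
  have tr: "{x \<in> space ?T. t < cmod (res_trace (wigner n x) z {..<n} / n - m)} \<in> sets ?T"
    unfolding res_trace_def by measurable
  have pre: "{\<omega> \<in> space M. t < cmod (res_trace (wigner n (?V \<omega>)) z {..<n} / n - m)}
     = ?V -` {x \<in> space ?T. t < cmod (res_trace (wigner n x) z {..<n} / n - m)} \<inter> space M"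
    using measurable_space[OF law(1)] by auto
  show "{\<omega> \<in> space M. t < cmod (res_trace (wigner n (?V \<omega>)) z {..<n} / n - m)} \<in> sets M"
    unfolding pre by (rule measurable_sets[OF law(1) tr])
  show "measure M {\<omega> \<in> space M. t < cmod (res_trace (wigner n (?V \<omega>)) z {..<n} / n - m)}
      = measure (PP (distr N borel \<xi>) n) {x \<in> space (PP (distr N borel \<xi>) n). t < cmod (res_trace (wigner n x) z {..<n} / n - m)}"
    unfolding sp unfolding D pre by (rule measure_distr[OF law(1) tr, symmetric])
  define Q where "Q = {p \<in> space (?S \<Otimes>\<^sub>M ?T). t < cmod (res_form (wigner n (snd p)) z {..<n} (fst p) - m)}"
  have c: "\<And>k. k \<in> {..<n} \<Longrightarrow> (\<lambda>p. fst p k) \<in> borel_measurable (?S \<Otimes>\<^sub>M ?T)"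
    by (rule measurable_compose[OF measurable_fst]) (rule measurable_component_singleton)
  have g: "(\<lambda>p. resolvent (wigner n (snd p)) z {..<n} k l) \<in> borel_measurable (?S \<Otimes>\<^sub>M ?T)" for k l
    by (rule measurable_compose[OF measurable_snd measurable_wigner_resolvent[OF z]])
  have "(\<lambda>p. res_form (wigner n (snd p)) z {..<n} (fst p)) \<in> borel_measurable (?S \<Otimes>\<^sub>M ?T)"
    unfolding res_form_def res_vec_def
    by (intro borel_measurable_sum borel_measurable_times g measurable_compose[OF c borel_measurable_of_real])
  then have Q: "Q \<in> sets (?S \<Otimes>\<^sub>M ?T)" unfolding Q_def by measurable
  have V: "?V = (\<lambda>\<omega>. \<lambda>ij\<in>upper_indices n. Y \<omega> $$ ij)" by (simp add: entries_def)
  have formcong: "res_form H z {..<n} (\<lambda>i\<in>{..<n}. u i) = res_form H z {..<n} u" for H :: "nat \<Rightarrow> nat \<Rightarrow> real" and u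
    by (simp add: res_form_def res_vec_def)
  {
    assume "vec_indep_of_matrix M n v Y"
    then have ind: "independent M ?S ?U ?T ?V" unfolding vec_indep_of_matrix_def V .
    then have U: "?U \<in> M \<rightarrow>\<^sub>M ?S" by (simp add: independent_def)
    have eq: "{\<omega> \<in> space M. t < cmod (res_form (wigner n (?V \<omega>)) z {..<n} (\<lambda>k. v \<omega> $ k) - m)} = {\<omega> \<in> space M. (?U \<omega>, ?V \<omega>) \<in> Q}"
      using measurable_space[OF law(1)] measurable_space[OF U] by (auto simp: Q_def space_pair_measure formcong)
    show "{\<omega> \<in> space M. t < cmod (res_form (wigner n (?V \<omega>)) z {..<n} (\<lambda>k. v \<omega> $ k) - m)} \<in> sets M"
    proof -
      have "{\<omega> \<in> space M. (?U \<omega>, ?V \<omega>) \<in> Q} = (\<lambda>\<omega>. (?U \<omega>, ?V \<omega>)) -` Q \<inter> space M" by auto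
      then show ?thesis unfolding eq using measurable_sets[OF measurable_Pair[OF U law(1)] Q] by simp
    qed
    assume e: "0 \<le> e" and unit: "\<And>\<omega>. \<omega> \<in> space M \<Longrightarrow> (\<Sum>k<n. (v \<omega> $ k)\<^sup>2) = 1"
      and le: "\<And>u. (\<Sum>k<n. (u k)\<^sup>2) = 1 \<Longrightarrow> measure (PP (distr N borel \<xi>) n) {x \<in> space (PP (distr N borel \<xi>) n). t < cmod (res_form (wigner n x) z {..<n} u - m)} \<le> e"
    show "measure M {\<omega> \<in> space M. t < cmod (res_form (wigner n (?V \<omega>)) z {..<n} (\<lambda>k. v \<omega> $ k) - m)} \<le> e"
      unfolding eq
    proof (rule independent_prob_bound[OF M ind Q e])
      fix \<omega> assume \<omega>: "\<omega> \<in> space M"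
      have "{y \<in> space ?T. (?U \<omega>, y) \<in> Q} = {x \<in> space ?T. t < cmod (res_form (wigner n x) z {..<n} (\<lambda>k. v \<omega> $ k) - m)}"
        using measurable_space[OF U \<omega>] by (auto simp: Q_def space_pair_measure formcong)
      then show "measure (distr M ?T ?V) {y \<in> space ?T. (?U \<omega>, y) \<in> Q} \<le> e"
        using le[OF unit[OF \<omega>]] unfolding sp unfolding D by simp
    qed
  }
qed

section \<open>From the local law to the window average\<close>

lemma ratio_perturbation:
  fixes a b A B :: real
  assumes A: "A > 0" and a: "\<bar>a - A\<bar> \<le> \<kappa>" "\<kappa> \<le> A / 2" and b: "\<bar>b - B\<bar> \<le> \<kappa>"
    and t: "2 * \<kappa> * (A + \<bar>B\<bar>) \<le> t * A\<^sup>2"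
  shows "\<bar>b / a - B / A\<bar> \<le> t"
proof -
  have a2: "A / 2 \<le> a" using a by linarith
  have "b / a - B / A = ((b - B) * A - (a - A) * B) / (a * A)"
    using A a2 by (simp add: field_simps)
  also have "\<bar>\<dots>\<bar> = \<bar>(b - B) * A - (a - A) * B\<bar> / (a * A)" using A a2 by (simp add: abs_mult)
  also have "\<dots> \<le> (\<kappa> * A + \<kappa> * \<bar>B\<bar>) / (a * A)"
  proof (rule divide_right_mono)
    have "\<bar>(b - B) * A - (a - A) * B\<bar> \<le> \<bar>b - B\<bar> * A + \<bar>a - A\<bar> * \<bar>B\<bar>"
      using A abs_triangle_ineq4[of "(b - B) * A" "(a - A) * B"] by (simp add: abs_mult)
    also have "\<dots> \<le> \<kappa> * A + \<kappa> * \<bar>B\<bar>" using a b A by (intro add_mono mult_right_mono) auto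
    finally show "\<bar>(b - B) * A - (a - A) * B\<bar> \<le> \<kappa> * A + \<kappa> * \<bar>B\<bar>" .
  qed (use A a2 in simp)
  also have "\<dots> \<le> (\<kappa> * A + \<kappa> * \<bar>B\<bar>) / (A / 2 * A)"
    using a a2 A by (intro divide_left_mono mult_right_mono mult_pos_pos add_nonneg_nonneg mult_nonneg_nonneg) auto
  also have "\<dots> = 2 * \<kappa> * (A + \<bar>B\<bar>) / A\<^sup>2" by (simp add: power2_eq_square algebra_simps)
  also have "\<dots> \<le> t" using t A by (simp add: pos_divide_le_eq)
  finally show ?thesis .
qed

text \<open>The affine map taking \<open>[x - \<epsilon>, x + \<epsilon>]\<close> to
  \<open>[-1, 1]\<close> turns kernels at \<open>x + \<epsilon> w\<close> into kernels at
  \<open>w\<close>, with the masses divided by \<open>\<epsilon>\<close>.\<close>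

lemma window_sum:
  assumes \<epsilon>: "\<epsilon> > 0" and p: "\<And>i. i < n \<Longrightarrow> 0 \<le> p i"
    and window: "\<forall>(I::nat set) p t. finite I \<longrightarrow> (\<forall>i\<in>I. 0 \<le> p i) \<longrightarrow>
       (\<forall>w\<in>W. \<bar>(\<Sum>i\<in>I. p i * Im (1 / (of_real (t i) - w))) - c\<bar> \<le> \<tau>) \<longrightarrow>
       \<bar>(\<Sum>i\<in>{i\<in>I. \<bar>t i\<bar> \<le> 1}. p i) - 2 * c / pi\<bar> \<le> \<kappa>"
    and app: "\<And>w. w \<in> W \<Longrightarrow> \<bar>(\<Sum>i<n. p i * Im (1 / (of_real (l i) - (of_real x + of_real \<epsilon> * w)))) - c\<bar> \<le> \<tau>"
  shows "\<bar>(\<Sum>i\<in>spectral_window n l x \<epsilon>. p i) / \<epsilon> - 2 * c / pi\<bar> \<le> \<kappa>"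
proof -
  let ?t = "\<lambda>i. (l i - x) / \<epsilon>"
  have sc: "p i / \<epsilon> * Im (1 / (of_real (?t i) - w)) = p i * Im (1 / (of_real (l i) - (of_real x + of_real \<epsilon> * w)))" for i w
  proof -
    have "of_real (l i) - (of_real x + of_real \<epsilon> * w) = of_real \<epsilon> * (of_real (?t i) - w)"
    proof -
      have "of_real \<epsilon> * of_real (?t i) = (of_real (l i - x) :: complex)"
        using \<epsilon> by (simp only: of_real_mult[symmetric]) simp
      then show ?thesis by (simp add: right_diff_distrib)
    qed
    then have "1 / (of_real (l i) - (of_real x + of_real \<epsilon> * w)) = (1 / (of_real (?t i) - w)) / of_real \<epsilon>"
      by (simp add: divide_divide_eq_left mult.commute)
    then show ?thesis by (simp only: Im_divide_of_real times_divide_eq_left times_divide_eq_right)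
  qed
  have win: "{i \<in> {..<n}. \<bar>?t i\<bar> \<le> 1} = spectral_window n l x \<epsilon>"
    using \<epsilon> by (auto simp: spectral_window_def)
  have "\<bar>(\<Sum>i\<in>{i\<in>{..<n}. \<bar>?t i\<bar> \<le> 1}. p i / \<epsilon>) - 2 * c / pi\<bar> \<le> \<kappa>"
    by (rule window[rule_format]) (use \<epsilon> p app in \<open>simp_all only: sc, auto\<close>)
  then show ?thesis unfolding win by (simp add: sum_divide_distrib)
qed

text \<open>\<open>m\<close> is the boundary value of the semicircle transform. The target constant
  arises because \<open>|1 + \<theta> m|^2 = \<theta>^2 - \<theta> x + 1\<close>, while
  \<open>m\<close> times the conjugate of \<open>1 + \<theta> m\<close> has imaginary part
  \<open>Im m\<close>.\<close>

lemma semicircle_point: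
  fixes x \<theta> :: real and m :: complex
  assumes "x \<in> {-2<..<2}"
  defines "m \<equiv> Complex (- x / 2) (sqrt (4 - x\<^sup>2) / 2)"
  shows "Im m > 0" "cmod m = 1" "Re m = - x / 2" "1 + \<theta> * m \<noteq> 0" "\<theta>\<^sup>2 - \<theta> * x + 1 > 0"
    "Im (m / (1 + \<theta> * m)) = Im m / (\<theta>\<^sup>2 - \<theta> * x + 1)"
proof -
  have "0 < (2 - x) * (2 + x)" using assms(1) by simp
  then have x2: "x\<^sup>2 < 4" by (simp add: algebra_simps power2_eq_square)
  show im: "Im m > 0" using x2 by (simp add: m_def)
  show re: "Re m = - x / 2" by (simp add: m_def)
  have sq: "(Im m)\<^sup>2 = 1 - x\<^sup>2 / 4" using x2 by (simp add: m_def power_divide)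
  have norm2: "(Re m)\<^sup>2 + (Im m)\<^sup>2 = 1" unfolding re sq by (simp add: power_divide)
  then show "cmod m = 1" by (simp add: cmod_def)
  have den: "(Re (1 + \<theta> * m))\<^sup>2 + (Im (1 + \<theta> * m))\<^sup>2 = \<theta>\<^sup>2 - \<theta> * x + 1"
  proof -
    have "(Re (1 + \<theta> * m))\<^sup>2 + (Im (1 + \<theta> * m))\<^sup>2 = \<theta>\<^sup>2 * ((Re m)\<^sup>2 + (Im m)\<^sup>2) + 2 * \<theta> * Re m + 1"
      by (simp add: power2_eq_square algebra_simps)
    also have "\<dots> = \<theta>\<^sup>2 - \<theta> * x + 1" unfolding norm2 unfolding re by simp
    finally show ?thesis .
  qed
  have nz: "1 + \<theta> * m \<noteq> 0"
  proof
    assume a: "1 + \<theta> * m = 0"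
    then have "Im (1 + \<theta> * m) = 0" by simp
    then have "\<theta> = 0" using im by simp
    with a show False by simp
  qed
  then show "1 + \<theta> * m \<noteq> 0" .
  then show pos: "\<theta>\<^sup>2 - \<theta> * x + 1 > 0"
    unfolding den[symmetric] by (metis complex_neq_0)
  show "Im (m / (1 + \<theta> * m)) = Im m / (\<theta>\<^sup>2 - \<theta> * x + 1)"
    unfolding Im_divide den by (simp add: algebra_simps)
qed

text \<open>The deterministic core: the window average is the overlap mass divided by the fraction
  of eigenvalues, and the scale \<open>\<epsilon>\<close> cancels. Since \<open>\<kappa>\<close> is
  at most half the limiting eigenvalue mass, the window is not empty.\<close>

lemma window_average_approx:
  fixes m :: complex and w :: complex
  assumes n: "n \<ge> 1" and Y: "Y \<in> carrier_mat n n" "symmetric Y" and sp: "rank_one_spike n \<theta> A u"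
    and W: "W = (1 / sqrt (real n)) \<cdot>\<^sub>m Y + A" and eb: "ordered_orthonormal_eigenbasis n W l f"
    and \<epsilon>: "\<epsilon> > 0" and im: "\<And>w. w \<in> W1 \<union> W2 \<Longrightarrow> Im w > 0"
    and win1: "\<forall>(I::nat set) p t. finite I \<longrightarrow> (\<forall>i\<in>I. 0 \<le> p i) \<longrightarrow>
       (\<forall>w\<in>W1. \<bar>(\<Sum>i\<in>I. p i * Im (1 / (of_real (t i) - w))) - Im m\<bar> \<le> \<tau>1) \<longrightarrow>
       \<bar>(\<Sum>i\<in>{i\<in>I. \<bar>t i\<bar> \<le> 1}. p i) - 2 * Im m / pi\<bar> \<le> \<kappa>"
    and win2: "\<forall>(I::nat set) p t. finite I \<longrightarrow> (\<forall>i\<in>I. 0 \<le> p i) \<longrightarrow>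
       (\<forall>w\<in>W2. \<bar>(\<Sum>i\<in>I. p i * Im (1 / (of_real (t i) - w))) - c\<bar> \<le> \<tau>2) \<longrightarrow>
       \<bar>(\<Sum>i\<in>{i\<in>I. \<bar>t i\<bar> \<le> 1}. p i) - 2 * c / pi\<bar> \<le> \<kappa>"
    and tr: "\<And>w. w \<in> W1 \<Longrightarrow> cmod (res_trace (wigner n (entries n Y)) (of_real x + of_real \<epsilon> * w) {..<n} / n - m) \<le> \<tau>1 / 2"
    and rank: "\<And>w. w \<in> W1 \<Longrightarrow> \<bar>\<theta>\<bar> / (real n * (\<epsilon> * Im w)\<^sup>2) \<le> \<tau>1 / 2"
    and form: "\<And>w. w \<in> W2 \<Longrightarrow>
      \<bar>Im ((\<lambda>F. F / (1 + \<theta> * F)) (res_form (wigner n (entries n Y)) (of_real x + of_real \<epsilon> * w) {..<n} (\<lambda>k. u $ k))) - c\<bar> \<le> \<tau>2"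
    and pos: "Im m > 0" and \<kappa>: "\<kappa> \<le> Im m / pi"
      "2 * \<kappa> * (2 * Im m / pi + \<bar>2 * c / pi\<bar>) \<le> t * (2 * Im m / pi)\<^sup>2"
  shows "\<bar>window_average n l f u x \<epsilon> - c / Im m\<bar> \<le> t"
proof -
  let ?z = "\<lambda>w. of_real x + of_real \<epsilon> * w"
  let ?S = "spectral_window n l x \<epsilon>"
  have res: "spiked_resolvent (wigner n (entries n Y)) (?z w) n \<theta> (\<lambda>k. u $ k) l (\<lambda>i k. f i $ k)" if "w \<in> W1 \<union> W2" for w
    by (rule spiked_resolventI[OF n Y sp W eb]) (use \<epsilon> im[OF that] in \<open>simp_all add: entries_def\<close>)
  have a: "\<bar>(\<Sum>i\<in>?S. 1 / real n) / \<epsilon> - 2 * Im m / pi\<bar> \<le> \<kappa>"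
  proof (rule window_sum[OF \<epsilon> _ win1])
    fix w assume w: "w \<in> W1"
    interpret spiked_resolvent "wigner n (entries n Y)" "?z w" n \<theta> "\<lambda>k. u $ k" l "\<lambda>i k. f i $ k"
      by (rule res) (use w in simp)
    let ?s = "\<Sum>i<n. 1 / (of_real (l i) - ?z w)" and ?t = "res_trace (wigner n (entries n Y)) (?z w) {..<n}"
    \<comment> \<open>The tolerance is split evenly between replacing the trace for \<open>W\<close>
      by that for \<open>H\<close> and the local law for the latter.\<close>
    have "(\<Sum>i<n. 1 / real n * Im (1 / (of_real (l i) - ?z w))) - Im m = Im ((?s - ?t) / of_nat n) + Im (?t / of_nat n - m)"
      by (simp add: sum_divide_distrib[symmetric] diff_divide_distrib Im_divide_of_nat)
    also have "\<bar>\<dots>\<bar> \<le> cmod ((?s - ?t) / of_nat n) + cmod (?t / of_nat n - m)"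
      by (intro order_trans[OF abs_triangle_ineq] add_mono abs_Im_le_cmod)
    also have "cmod ((?s - ?t) / of_nat n) \<le> \<bar>\<theta>\<bar> / (\<epsilon> * Im w)\<^sup>2 / n"
    proof -
      have "cmod (?s - ?t) / n \<le> \<bar>\<theta>\<bar> / (\<epsilon> * Im w)\<^sup>2 / n"
        using trace_perturbation by (intro divide_right_mono) simp_all
      then show ?thesis by (simp only: norm_divide norm_of_nat)
    qed
    also have "\<dots> = \<bar>\<theta>\<bar> / (real n * (\<epsilon> * Im w)\<^sup>2)" by (simp add: mult.commute)
    also have "\<dots> \<le> \<tau>1 / 2" by (rule rank[OF w])
    also have "cmod (?t / of_nat n - m) \<le> \<tau>1 / 2" using tr[OF w] by simp
    finally show "\<bar>(\<Sum>i<n. 1 / real n * Im (1 / (of_real (l i) - ?z w))) - Im m\<bar> \<le> \<tau>1" by simp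
  qed simp
  have u: "u \<in> carrier_vec n" using rank_one_spike_entries[OF n sp] by simp
  have b: "\<bar>(\<Sum>i\<in>?S. (f i \<bullet> u)\<^sup>2) / \<epsilon> - 2 * c / pi\<bar> \<le> \<kappa>"
  proof (rule window_sum[OF \<epsilon> _ win2])
    fix w assume w: "w \<in> W2"
    interpret spiked_resolvent "wigner n (entries n Y)" "?z w" n \<theta> "\<lambda>k. u $ k" l "\<lambda>i k. f i $ k"
      by (rule res) (use w in simp)
    have "(\<Sum>i<n. (f i \<bullet> u)\<^sup>2 * Im (1 / (of_real (l i) - ?z w)))
      = Im (\<Sum>i<n. (\<Sum>k<n. f i $ k * u $ k)\<^sup>2 / (of_real (l i) - ?z w))"
      unfolding Im_sum
    proof (rule sum.cong[OF refl])
      fix i assume "i \<in> {..<n}"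
      have "f i \<bullet> u = (\<Sum>k<n. f i $ k * u $ k)" by (rule scalar_prod_sum[OF u])
      moreover have "Im (of_real q / y) = q * Im (1 / y)" for q :: real and y :: complex
        by (simp add: Im_divide)
      ultimately show "(f i \<bullet> u)\<^sup>2 * Im (1 / (of_real (l i) - ?z w))
         = Im (of_real ((\<Sum>k<n. f i $ k * u $ k)\<^sup>2) / (of_real (l i) - ?z w))" by (simp only:)
    qed
    then show "\<bar>(\<Sum>i<n. (f i \<bullet> u)\<^sup>2 * Im (1 / (of_real (l i) - ?z w))) - c\<bar> \<le> \<tau>2"
      using form[OF w] unfolding overlap_transform by simp
  qed simp
  have "\<bar>((\<Sum>i\<in>?S. (f i \<bullet> u)\<^sup>2) / \<epsilon>) / ((\<Sum>i\<in>?S. 1 / real n) / \<epsilon>) - (2 * c / pi) / (2 * Im m / pi)\<bar> \<le> t"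
    by (rule ratio_perturbation[OF _ a _ b]) (use pos \<kappa> in simp_all)
  moreover have "((\<Sum>i\<in>?S. (f i \<bullet> u)\<^sup>2) / \<epsilon>) / ((\<Sum>i\<in>?S. 1 / real n) / \<epsilon>) = window_average n l f u x \<epsilon>"
    using n \<epsilon> by (simp add: window_average_def)
  ultimately show ?thesis using pi_gt_zero by simp
qed

theorem theorem2:
  fixes N :: "'b measure" and \<xi> :: "'b \<Rightarrow> real"
    and M :: "nat \<Rightarrow> 'a measure"
    and X A W :: "nat \<Rightarrow> 'a \<Rightarrow> real mat"
    and v :: "nat \<Rightarrow> 'a \<Rightarrow> real vec"
    and ev :: "nat \<Rightarrow> 'a \<Rightarrow> nat \<Rightarrow> real"
    and \<phi> :: "nat \<Rightarrow> 'a \<Rightarrow> nat \<Rightarrow> real vec"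
    and \<epsilon> :: "nat \<Rightarrow> real"
    and \<theta> x \<delta> t :: real
  assumes "prob_space N" and "\<xi> \<in> borel_measurable N"
    and "\<And>k::nat. integrable N (\<lambda>\<omega>. \<bar>\<xi> \<omega>\<bar> ^ k)"
    and "prob_space.expectation N \<xi> = 0"
    and "prob_space.expectation N (\<lambda>\<omega>. (\<xi> \<omega>)\<^sup>2) = 1"
    and "\<And>n. n \<ge> 1 \<Longrightarrow> prob_space (M n)"
    and "\<And>n. n \<ge> 1 \<Longrightarrow> iid_symmetric_matrix N \<xi> (M n) n (X n)"
    and "\<And>n \<omega>. n \<ge> 1 \<Longrightarrow> \<omega> \<in> space (M n) \<Longrightarrow> rank_one_spike n \<theta> (A n \<omega>) (v n \<omega>)"
    and "\<And>n. n \<ge> 1 \<Longrightarrow> vec_indep_of_matrix (M n) n (v n) (X n)"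
    and "\<And>n \<omega>. n \<ge> 1 \<Longrightarrow> \<omega> \<in> space (M n) \<Longrightarrow>
           W n \<omega> = (1 / sqrt (real n)) \<cdot>\<^sub>m X n \<omega> + A n \<omega>"
    and "\<And>n \<omega>. n \<ge> 1 \<Longrightarrow> \<omega> \<in> space (M n) \<Longrightarrow>
           ordered_orthonormal_eigenbasis n (W n \<omega>) (ev n \<omega>) (\<phi> n \<omega>)"
    and "x \<in> {-2<..<2}"
    and "\<And>n. n \<ge> 1 \<Longrightarrow> \<epsilon> n > 0"
    and "\<delta> > 0"
    and "(\<lambda>n. real n powr \<delta> / sqrt (real n)) \<lless> \<epsilon>" and "\<epsilon> \<lless> (\<lambda>_. 1)"
    and "t > 0"
  shows "(\<lambda>n. \<P>(\<omega> in M n.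
            \<bar>window_average n (ev n \<omega>) (\<phi> n \<omega>) (v n \<omega>) x (\<epsilon> n)
              - 1 / (\<theta>\<^sup>2 - \<theta> * x + 1)\<bar> > t)) \<longlonglongrightarrow> 0"
proof -
  note hyp = assms
  define \<mu> where "\<mu> = distr N borel \<xi>"
  define m where "m = Complex (- x / 2) (sqrt (4 - x\<^sup>2) / 2)"
  define c where "c = Im m / (\<theta>\<^sup>2 - \<theta> * x + 1)"
  define z where "z = (\<lambda>(w :: complex) n. of_real x + of_real (\<epsilon> n) * w)"
  note m = semicircle_point[OF hyp(12), folded m_def]
  interpret N: prob_space N by fact
  have "unit_variance \<mu>"
  proof -
    interpret prob_space \<mu> unfolding \<mu>_def by (rule N.prob_space_distr) (rule hyp(2))
    show ?thesis
    proof
      show "integrable \<mu> (\<lambda>x. x ^ 4)"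
        unfolding \<mu>_def using hyp(2) hyp(3)[of 4] by (subst integrable_distr_eq) (simp_all add: power_even_abs)
    qed (use hyp(2,4,5) in \<open>simp_all add: \<mu>_def integral_distr\<close>)
  qed
  then interpret unit_variance \<mu> .
  have \<epsilon>0: "\<epsilon> \<longlonglongrightarrow> 0" and \<epsilon>\<delta>: "(\<lambda>n. real n powr \<delta> / sqrt (real n) / \<epsilon> n) \<longlonglongrightarrow> 0"
    using hyp(15,16) by (simp_all add: much_less_def)
  have im: "Im (z w n) = \<epsilon> n * Im w" for w n by (simp add: z_def)
  define tr where "tr = (\<lambda>s w n. {\<omega> \<in> space (M n). s < cmod (res_trace (wigner n (entries n (X n \<omega>))) (z w n) {..<n} / n - m)})"
  define fo where "fo = (\<lambda>s w n. {\<omega> \<in> space (M n). s < cmod (res_form (wigner n (entries n (X n \<omega>))) (z w n) {..<n} (\<lambda>k. v n \<omega> $ k) - m)})"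
  have sets: "tr s w n \<in> sets (M n)" "fo s w n \<in> sets (M n)" if "Im w > 0" "n \<ge> 1" for s w n
  proof -
    have "Im (z w n) > 0" using that hyp(13)[OF that(2)] by (simp add: im)
    note L = matrix_local_law[OF hyp(6)[OF that(2)] hyp(7)[OF that(2)] that(2) this]
    show "tr s w n \<in> sets (M n)" "fo s w n \<in> sets (M n)"
      unfolding tr_def fo_def by (rule L(1), rule L(3)[OF hyp(9)[OF that(2)]])
  qed
  have lim: "(\<lambda>n. measure (M n) (tr s w n)) \<longlonglongrightarrow> 0" "(\<lambda>n. measure (M n) (fo s w n)) \<longlonglongrightarrow> 0"
    if w: "Im w > 0" and s: "s > 0" for s w
  proof -
    have zp: "Im (z w n) > 0" if "n \<ge> 1" for n using w hyp(13)[OF that] by (simp add: im)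
    have lim1: "(\<lambda>n. Im (z w n)) \<longlonglongrightarrow> 0" unfolding im by (rule tendsto_mult_left_zero[OF \<epsilon>0])
    have "cmod (z w n + of_real (2 * Re m)) = \<bar>\<epsilon> n\<bar> * cmod w" for n
      by (simp add: z_def m norm_mult)
    moreover have "(\<lambda>n. \<bar>\<epsilon> n\<bar> * cmod w) \<longlonglongrightarrow> 0"
      by (intro tendsto_mult_left_zero tendsto_rabs_zero \<epsilon>0)
    ultimately have lim2: "(\<lambda>n. cmod (z w n + of_real (2 * Re m))) \<longlonglongrightarrow> 0" by simp
    have "real n powr \<delta> / (sqrt n * Im (z w n)) = real n powr \<delta> / sqrt (real n) / \<epsilon> n * (1 / Im w)" for n
      by (simp add: im)
    moreover have "(\<lambda>n. real n powr \<delta> / sqrt (real n) / \<epsilon> n * (1 / Im w)) \<longlonglongrightarrow> 0"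
      by (rule tendsto_mult_left_zero[OF \<epsilon>\<delta>])
    ultimately have lim3: "(\<lambda>n. real n powr \<delta> / (sqrt n * Im (z w n))) \<longlonglongrightarrow> 0" by (simp only:)
    obtain e where e: "e \<longlonglongrightarrow> 0" and ev: "\<forall>\<^sub>F n in sequentially.
       measure (\<Pi>\<^sub>M k\<in>upper_indices n. \<mu>) {x \<in> space (\<Pi>\<^sub>M k\<in>upper_indices n. \<mu>).
          s < cmod (res_trace (wigner n x) (z w n) {..<n} / n - m)} \<le> e n \<and>
       (\<forall>u. (\<Sum>i<n. (u i)\<^sup>2) = 1 \<longrightarrow>
         measure (\<Pi>\<^sub>M k\<in>upper_indices n. \<mu>) {x \<in> space (\<Pi>\<^sub>M k\<in>upper_indices n. \<mu>).
          s < cmod (res_form (wigner n x) (z w n) {..<n} u - m)} \<le> e n)"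
      using local_law[OF m(1,2) zp lim1 lim2 hyp(14) lim3 s] by blast
    have "\<forall>\<^sub>F n in sequentially. measure (M n) (tr s w n) \<le> e n \<and> measure (M n) (fo s w n) \<le> e n"
      using ev eventually_ge_at_top[of 1]
    proof eventually_elim
      case (elim n)
      note L = matrix_local_law[OF hyp(6)[OF elim(2)] hyp(7)[OF elim(2)] elim(2) zp[OF elim(2)]]
      have "measure (M n) (tr s w n) \<le> e n"
        unfolding tr_def L(2) \<mu>_def[symmetric] using elim(1) by blast
      moreover from this have "0 \<le> e n" using measure_nonneg order_trans by blast
      have "measure (M n) (fo s w n) \<le> e n"
        unfolding fo_def
      proof (rule L(4)[OF hyp(9)[OF elim(2)] \<open>0 \<le> e n\<close>])
        fix \<omega> assume "\<omega> \<in> space (M n)"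
        from hyp(8)[OF elim(2) this] show "(\<Sum>k<n. (v n \<omega> $ k)\<^sup>2) = 1"
          by (rule rank_one_spike_entries(2)[OF elim(2)])
      qed (use elim(1) in \<open>simp add: \<mu>_def\<close>)
      ultimately show ?case by blast
    qed
    then have ev: "\<forall>\<^sub>F n in sequentially. measure (M n) (tr s w n) \<le> e n"
      "\<forall>\<^sub>F n in sequentially. measure (M n) (fo s w n) \<le> e n"
      by (simp_all add: eventually_conj_iff)
    show "(\<lambda>n. measure (M n) (tr s w n)) \<longlonglongrightarrow> 0"
      by (rule tendsto_sandwich[OF _ ev(1) tendsto_const e]) simp
    show "(\<lambda>n. measure (M n) (fo s w n)) \<longlonglongrightarrow> 0"
      by (rule tendsto_sandwich[OF _ ev(2) tendsto_const e]) simp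
  qed
  have c: "c > 0" unfolding c_def using m(1) m(5)[of \<theta>] by simp
  define S where "S = 2 * Im m / pi + \<bar>2 * c / pi\<bar>"
  \<comment> \<open>Accuracy \<open>\<kappa>\<close> of both masses keeps their quotient within
    \<open>t\<close> of its limit by \<open>ratio_perturbation\<close>.\<close>
  define \<kappa> where "\<kappa> = min (Im m / pi) (t * (2 * Im m / pi)\<^sup>2 / (2 * S))"
  have S: "S > 0" unfolding S_def using m(1) by (intro add_pos_nonneg) simp_all
  have \<kappa>: "\<kappa> > 0" "\<kappa> \<le> Im m / pi" using S m(1) hyp(17) by (simp_all add: \<kappa>_def)
  have "\<kappa> \<le> t * (2 * Im m / pi)\<^sup>2 / (2 * S)" by (simp add: \<kappa>_def)
  then have \<kappa>S: "2 * \<kappa> * S \<le> t * (2 * Im m / pi)\<^sup>2" using S by (simp add: pos_le_divide_eq mult_ac)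
  obtain W1 \<tau>1 where W1: "finite W1" "\<forall>w\<in>W1. Im w > 0" "\<tau>1 > 0" and win1: "\<forall>(I::nat set) p t. finite I \<longrightarrow> (\<forall>i\<in>I. 0 \<le> p i) \<longrightarrow>
       (\<forall>w\<in>W1. \<bar>(\<Sum>i\<in>I. p i * Im (1 / (of_real (t i) - w))) - Im m\<bar> \<le> \<tau>1) \<longrightarrow>
       \<bar>(\<Sum>i\<in>{i\<in>I. \<bar>t i\<bar> \<le> 1}. p i) - 2 * Im m / pi\<bar> \<le> \<kappa>"
    using window_mass_from_poisson[OF m(1) \<kappa>(1)] by blast
  obtain W2 \<tau>2 where W2: "finite W2" "\<forall>w\<in>W2. Im w > 0" "\<tau>2 > 0" and win2: "\<forall>(I::nat set) p t. finite I \<longrightarrow> (\<forall>i\<in>I. 0 \<le> p i) \<longrightarrow>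
       (\<forall>w\<in>W2. \<bar>(\<Sum>i\<in>I. p i * Im (1 / (of_real (t i) - w))) - c\<bar> \<le> \<tau>2) \<longrightarrow>
       \<bar>(\<Sum>i\<in>{i\<in>I. \<bar>t i\<bar> \<le> 1}. p i) - 2 * c / pi\<bar> \<le> \<kappa>"
    using window_mass_from_poisson[OF c \<kappa>(1)] by blast
  \<comment> \<open>Continuity of \<open>F / (1 + \<theta> F)\<close> at \<open>m\<close>, where the
    denominator does not vanish, turns closeness of the form into closeness of the overlap
    transform.\<close>
  obtain \<sigma> where \<sigma>: "\<sigma> > 0" and close: "\<And>F :: complex. cmod (F - m) \<le> \<sigma> \<Longrightarrow> \<bar>Im (F / (1 + \<theta> * F)) - c\<bar> \<le> \<tau>2"
  proof -
    have "isCont (\<lambda>F. Im (F / (1 + \<theta> * F))) m"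
      unfolding isCont_def by (intro tendsto_intros m(4))
    then obtain d where "d > 0" and d: "\<And>F :: complex. dist F m < d \<Longrightarrow> dist (Im (F / (1 + \<theta> * F))) c < \<tau>2"
      unfolding continuous_at_eps_delta m(6) c_def using W2(3) by blast
    show thesis
    proof (rule that[of "d / 2"])
      fix F :: complex assume "cmod (F - m) \<le> d / 2"
      then have "dist F m < d" using \<open>d > 0\<close> by (simp add: dist_norm)
      from d[OF this] show "\<bar>Im (F / (1 + \<theta> * F)) - c\<bar> \<le> \<tau>2" by (simp add: dist_real_def)
    qed (use \<open>d > 0\<close> in simp)
  qed
  have rank: "\<forall>\<^sub>F n in sequentially. \<forall>w\<in>W1. \<bar>\<theta>\<bar> / (real n * (\<epsilon> n * Im w)\<^sup>2) \<le> \<tau>1 / 2"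
  proof (intro eventually_ball_finite W1(1) ballI)
    fix w assume "w \<in> W1"
    have "(\<lambda>n. \<bar>\<theta>\<bar> / (Im w)\<^sup>2 * (real n powr \<delta> / sqrt (real n) / \<epsilon> n)\<^sup>2) \<longlonglongrightarrow> \<bar>\<theta>\<bar> / (Im w)\<^sup>2 * 0\<^sup>2"
      by (intro tendsto_intros \<epsilon>\<delta>)
    then have "\<forall>\<^sub>F n in sequentially. \<bar>\<theta>\<bar> / (Im w)\<^sup>2 * (real n powr \<delta> / sqrt (real n) / \<epsilon> n)\<^sup>2 < \<tau>1 / 2"
      by (rule order_tendstoD(2)) (use W1(3) in simp)
    then show "\<forall>\<^sub>F n in sequentially. \<bar>\<theta>\<bar> / (real n * (\<epsilon> n * Im w)\<^sup>2) \<le> \<tau>1 / 2"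
      using eventually_ge_at_top[of 1]
    proof eventually_elim
      case (elim n)
      \<comment> \<open>Inserting this factor turns 1 / (n \<epsilon>^2) into the square of the
        sequence that the scale assumption sends to zero.\<close>
      have "1 \<le> (real n powr \<delta>)\<^sup>2" using elim(2) hyp(14) by (simp add: ge_one_powr_ge_zero one_le_power)
      then have "\<bar>\<theta>\<bar> / (real n * (\<epsilon> n * Im w)\<^sup>2) * 1 \<le> \<bar>\<theta>\<bar> / (real n * (\<epsilon> n * Im w)\<^sup>2) * (real n powr \<delta>)\<^sup>2"
        by (intro mult_left_mono) simp_all
      also have "\<dots> = \<bar>\<theta>\<bar> / (Im w)\<^sup>2 * (real n powr \<delta> / sqrt (real n) / \<epsilon> n)\<^sup>2"
        by (simp add: power_mult_distrib power_divide mult_ac)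
      finally show ?case using elim(1) by linarith
    qed
  qed
  let ?dev = "\<lambda>n. {\<omega> \<in> space (M n). \<bar>window_average n (ev n \<omega>) (\<phi> n \<omega>) (v n \<omega>) x (\<epsilon> n) - 1 / (\<theta>\<^sup>2 - \<theta> * x + 1)\<bar> > t}"
  let ?bound = "\<lambda>n. (\<Sum>w\<in>W1. measure (M n) (tr (\<tau>1 / 2) w n)) + (\<Sum>w\<in>W2. measure (M n) (fo \<sigma> w n))"
  have le: "\<forall>\<^sub>F n in sequentially. measure (M n) (?dev n) \<le> ?bound n"
    using rank eventually_ge_at_top[of 1]
  proof eventually_elim
    case (elim n)
    note n = elim(2)
    interpret Mn: prob_space "M n" by (rule hyp(6)[OF n])
    let ?T = "\<Union>w\<in>W1. tr (\<tau>1 / 2) w n" and ?F = "\<Union>w\<in>W2. fo \<sigma> w n"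
    have sT: "?T \<in> sets (M n)" and sF: "?F \<in> sets (M n)"
      using W1 W2 n by (auto intro!: sets.finite_UN sets)
    have "?dev n \<subseteq> ?T \<union> ?F"
    proof
      fix \<omega> assume dev: "\<omega> \<in> ?dev n"
      then have \<omega>: "\<omega> \<in> space (M n)" by simp
      show "\<omega> \<in> ?T \<union> ?F"
      proof (rule ccontr)
        assume good: "\<omega> \<notin> ?T \<union> ?F"
        have "X n \<omega> \<in> carrier_mat n n" "symmetric (X n \<omega>)"
          using hyp(7)[OF n] \<omega> by (simp_all add: iid_symmetric_matrix_def)
        then have "\<bar>window_average n (ev n \<omega>) (\<phi> n \<omega>) (v n \<omega>) x (\<epsilon> n) - c / Im m\<bar> \<le> t"
        proof (rule window_average_approx[OF n _ _ hyp(8)[OF n \<omega>] hyp(10)[OF n \<omega>] hyp(11)[OF n \<omega>] hyp(13)[OF n] _ win1 win2])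
          fix w assume "w \<in> W1"
          then show "cmod (res_trace (wigner n (entries n (X n \<omega>))) (of_real x + of_real (\<epsilon> n) * w) {..<n} / n - m) \<le> \<tau>1 / 2"
            using good \<omega> unfolding tr_def z_def by (auto simp: not_less)
        next
          fix w assume "w \<in> W2"
          then have "cmod (res_form (wigner n (entries n (X n \<omega>))) (of_real x + of_real (\<epsilon> n) * w) {..<n} (\<lambda>k. v n \<omega> $ k) - m) \<le> \<sigma>"
            using good \<omega> unfolding fo_def z_def by (auto simp: not_less)
          then show "\<bar>Im ((\<lambda>F. F / (1 + \<theta> * F)) (res_form (wigner n (entries n (X n \<omega>))) (of_real x + of_real (\<epsilon> n) * w) {..<n} (\<lambda>k. v n \<omega> $ k))) - c\<bar> \<le> \<tau>2"
            by (rule close)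
        qed (use W1 W2 elim(1) m(1) \<kappa> \<kappa>S in \<open>auto simp: S_def\<close>)
        moreover have "c / Im m = 1 / (\<theta>\<^sup>2 - \<theta> * x + 1)" using m(1) by (simp add: c_def)
        ultimately show False using dev by simp
      qed
    qed
    \<comment> \<open>Monotonicity asks only that the larger event be measurable, so an arbitrary
      choice of eigenvectors causes no difficulty.\<close>
    then have "measure (M n) (?dev n) \<le> measure (M n) (?T \<union> ?F)"
      by (rule Mn.finite_measure_mono) (intro sets.Un sT sF)
    also have "\<dots> \<le> measure (M n) ?T + measure (M n) ?F" by (rule measure_Un_le[OF sT sF])
    also have "\<dots> \<le> ?bound n"
      using W1 W2 n by (intro add_mono measure_UNION_le sets) auto
    finally show ?case .
  qed
  have "?bound \<longlonglongrightarrow> 0"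
    by (intro tendsto_add_zero tendsto_null_sum lim) (use W1 W2 \<sigma> in simp_all)
  from tendsto_sandwich[OF _ le tendsto_const this] show ?thesis by simp
qed

end
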